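(* Let $(S_i)_{i=1}^N$ be an (ordered) IFS on $\mathbb R^d$ and let $(\beta_1,\dots,\beta_N)\in\{-1,1\}^N$. Then $(S_i)_{i=1}^N$ is a self-similar zipper with signature $(\beta_1,\dots,\beta_N)$ if and only if the ordered GIFS with two states $1,-1$ given by $$E_1=S_1(E_{\beta_1})+S_2(E_{\beta_2})+\dots+S_N(E_{\beta_N}),$$ $$E_{-1}=S_N(E_{-\beta_N})+S_{N-1}(E_{-\beta_{N-1}})+\dots+S_1(E_{-\beta_1})$$ is a linear GIFS. If in addition $(S_i)_{i=1}^N$ satisfies the open set condition, then the invariant set $K$ of $(S_i)_{i=1}^N$ admits optimal parametrizations. (The last sentence is asserted for $(S_i)_{i=1}^N$ satisfying these equivalent conditions.)
   Context: An IFS is a finite family $(S_j)_{j=1}^N$, $N\ge2$, of contractive similitudes of $\mathbb R^d$; its invariant set $K$ is the unique nonempty compact set with $K=\bigcup_jS_j(K)$. Open set condition: there is a nonempty open $U$ with $\bigcup_iS_i(U)\subset U$ and the $S_i(U)$ pairwise disjoint. Self-similar zipper. The ordered IFS $(S_j)_{j=1}^N$ is a self-similar zipper with signature $(\beta_1,\dots,\beta_N)\in\{-1,1\}^N$ if there are points $x_0,\dots,x_N\in\mathbb R^d$ (the vertices) such that for each $j$: $S_j(x_0)=x_{j-1}$ and $S_j(x_N)=x_j$ if $\beta_j=1$; $S_j(x_0)=x_j$ and $S_j(x_N)=x_{j-1}$ if $\beta_j=-1$. Ordered and linear GIFS. A graph-directed IFS (GIFS) consists of a finite directed graph with state set $\mathcal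 A$ and edge set $\Gamma$, and a contractive similitude $g_\gamma$ for each $\gamma\in\Gamma$. Its invariant sets are the unique nonempty compact sets with $E_i=\bigcup_{j\in\mathcal A}\bigcup_{\gamma\in\Gamma_{ij}}g_\gamma(E_j)$, $i\in\mathcal A$, where $\Gamma_{ij}$ is the set of edges from $i$ to $j$. It is ordered if, for each $i$, the set of edges emanating from $i$ carries a linear order. Writing a set equation $E_i=g_1(E_{j_1})+\dots+g_\ell(E_{j_\ell})$ means that the edges from $i$ are, in increasing order, edges to $j_1,\dots,j_\ell$ with maps $g_1,\dots,g_\ell$ ("$+$" means union with order). Let $\Gamma_i^k$ be the set of walks of length $k$ starting at $i$, ordered lexicographically; two walks in $\Gamma_i^k$ are adjacent if they are consecutive in this order. For a walk $\gamma=\gamma_1\cdots\gamma_k$ with terminal state $t$, put $E_\gamma=g_{\gamma_1}\circ\dots\circ g_{\gamma_k}(E_t)$. The ordered GIFS is linear if for all $i\in\mathcal A$ and $k\ge1$, $E_\gamma\cap E_\omega\ne\emptyset$ whenever $\gamma,\omega\in\Gamma_i^k$ are adjacent. Optimal parametrization. For a compact $F$ with $0<\mathcal H^s(F)<\infty$ (here $F=K$, $s=\dim_HK$), an onto map $\psi:[0,1]\to F$ is an optimal parametrization if (i) there are full-measure $F'\subset F$, $I'\subset[0,1]$ with $\psi:I'\to F'$ bijective; (ii) with $c=\mathcal H^s(F)$, $\mathcal H^s(\psi(X))=c\,\mathcal L(X)$ for Borel $X\subset[0,1]$ and $\mathcal L(\psi^{-1}(B))=c^{-1}\mathcal H^s(B)$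 for Borel $B\subset F$; (iii) $|\psi(x)-\psi(y)|\le c'|x-y|^{1/s}$ for some $c'>0$ and all $x,y$. *)

theory Defs
  imports "HOL-Analysis.Analysis" "Graph_Theory.Arc_Walk"
begin

section \<open>Hausdorff measure and dimension\<close>

text \<open>The term \<open>|U|\<^sup>s\<close> of a cover, with the usual conventions \<open>|{}|\<^sup>s = 0\<close> and \<open>0\<^sup>0 = 1\<close>;
  the latter is needed because \<open>0 powr 0 = 0\<close> in HOL. With it, the case \<open>s = 0\<close> below is the
  counting measure.\<close>
definition diam_power :: "real \<Rightarrow> 'a::metric_space set \<Rightarrow> real" where
  "diam_power s U = (if U = {} then 0 else if s = 0 then 1 else diameter U powr s)"

text \<open>Boundedness is required explicitly because \<^const>\<open>diameter\<close> is unspecified on unbounded sets.\<close>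
definition hausdorff_premeasure :: "real \<Rightarrow> real \<Rightarrow> 'a::metric_space set \<Rightarrow> ennreal" where
  "hausdorff_premeasure \<delta> s A =
     (INF U \<in> {U :: nat \<Rightarrow> 'a set. A \<subseteq> (\<Union>i. U i) \<and> (\<forall>i. bounded (U i) \<and> diameter (U i) \<le> \<delta>)}.
        (\<Sum>i. ennreal (diam_power s (U i))))"

text \<open>The Hausdorff (outer) measure, without a normalizing factor.\<close>
definition hausdorff_measure :: "real \<Rightarrow> 'a::metric_space set \<Rightarrow> ennreal" where
  "hausdorff_measure s A = (SUP \<delta> \<in> {0<..}. hausdorff_premeasure \<delta> s A)"

text \<open>In Euclidean space the set below contains every \<open>s > DIM('a)\<close>, so the real infimum is
  meaningful.\<close>
definition hausdorff_dim :: "'a::euclidean_space set \<Rightarrow> real" where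
  "hausdorff_dim A = Inf {s. 0 \<le> s \<and> hausdorff_measure s A = 0}"


section \<open>Iterated function systems and self-similar zippers\<close>

definition contractive_similitude :: "('a::metric_space \<Rightarrow> 'a) \<Rightarrow> bool" where
  "contractive_similitude f \<longleftrightarrow> (\<exists>r. 0 < r \<and> r < 1 \<and> (\<forall>x y. dist (f x) (f y) = r * dist x y))"

text \<open>The family is indexed by \<open>1, \<dots>, N\<close>; values of \<open>S\<close> at other indices are irrelevant.\<close>
definition ifs :: "nat \<Rightarrow> (nat \<Rightarrow> 'a::euclidean_space \<Rightarrow> 'a) \<Rightarrow> bool" where
  "ifs N S \<longleftrightarrow> 2 \<le> N \<and> (\<forall>j\<in>{1..N}. contractive_similitude (S j))"

definition ifs_invariant_set :: "nat \<Rightarrow> (nat \<Rightarrow> 'a::euclidean_space \<Rightarrow> 'a) \<Rightarrow> 'a set" where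
  "ifs_invariant_set N S = (THE K. K \<noteq> {} \<and> compact K \<and> K = (\<Union>j\<in>{1..N}. S j ` K))"

definition open_set_condition :: "nat \<Rightarrow> (nat \<Rightarrow> 'a::euclidean_space \<Rightarrow> 'a) \<Rightarrow> bool" where
  "open_set_condition N S \<longleftrightarrow>
     (\<exists>U. open U \<and> U \<noteq> {} \<and> (\<Union>i\<in>{1..N}. S i ` U) \<subseteq> U \<and>
          disjoint_family_on (\<lambda>i. S i ` U) {1..N})"

definition self_similar_zipper ::
    "nat \<Rightarrow> (nat \<Rightarrow> 'a::euclidean_space \<Rightarrow> 'a) \<Rightarrow> (nat \<Rightarrow> int) \<Rightarrow> bool" where
  "self_similar_zipper N S \<beta> \<longleftrightarrow>
     (\<exists>x :: nat \<Rightarrow> 'a. \<forall>j\<in>{1..N}.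
        (\<beta> j = 1 \<longrightarrow> S j (x 0) = x (j - 1) \<and> S j (x N) = x j) \<and>
        (\<beta> j = -1 \<longrightarrow> S j (x 0) = x j \<and> S j (x N) = x (j - 1)))"


section \<open>Ordered and linear graph-directed systems\<close>

text \<open>Every state must have an outgoing edge, since otherwise there are no nonempty invariant
  sets.\<close>
locale graph_ifs = fin_digraph G
  for G :: "('v, 'e) pre_digraph" (structure) +
  fixes g :: "'e \<Rightarrow> 'a::euclidean_space \<Rightarrow> 'a"
  assumes similitude: "e \<in> arcs G \<Longrightarrow> contractive_similitude (g e)"
    and out_arcs_nonempty: "i \<in> verts G \<Longrightarrow> out_arcs G i \<noteq> {}"
begin

text \<open>The family \<open>E\<close> is a total function; it is made unique by the value \<open>{}\<close> off the state set.\<close>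
definition invariant_sets :: "'v \<Rightarrow> 'a set" where
  "invariant_sets = (THE E.
     (\<forall>i\<in>verts G. E i \<noteq> {} \<and> compact (E i) \<and>
        E i = (\<Union>j\<in>verts G. \<Union>e\<in>{e \<in> arcs G. tail G e = i \<and> head G e = j}. g e ` E j)) \<and>
     (\<forall>i. i \<notin> verts G \<longrightarrow> E i = {}))"

definition walks_from :: "'v \<Rightarrow> nat \<Rightarrow> 'e list set" where
  "walks_from i k = {p. length p = k \<and> (\<exists>t. awalk i p t)}"

definition walk_set :: "'v \<Rightarrow> 'e list \<Rightarrow> 'a set" where
  "walk_set i p = foldr (\<circ>) (map g p) id ` invariant_sets (awlast i p)"

end

text \<open>The strict relation \<open>R\<close> orders the outgoing edges of each state.\<close>
locale ordered_graph_ifs = graph_ifs G g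
  for G :: "('v, 'e) pre_digraph" (structure) and g :: "'e \<Rightarrow> 'a::euclidean_space \<Rightarrow> 'a" +
  fixes R :: "('e \<times> 'e) set"
  assumes order: "i \<in> verts G \<Longrightarrow> strict_linear_order_on (out_arcs G i) R"
begin

definition next_walk :: "'v \<Rightarrow> nat \<Rightarrow> 'e list \<Rightarrow> 'e list \<Rightarrow> bool" where
  "next_walk i k p q \<longleftrightarrow> p \<in> walks_from i k \<and> q \<in> walks_from i k \<and> (p, q) \<in> lexn R k \<and>
     \<not> (\<exists>w\<in>walks_from i k. (p, w) \<in> lexn R k \<and> (w, q) \<in> lexn R k)"

definition adjacent_walks :: "'v \<Rightarrow> nat \<Rightarrow> 'e list \<Rightarrow> 'e list \<Rightarrow> bool" where
  "adjacent_walks i k p q \<longleftrightarrow> next_walk i k p q \<or> next_walk i k q p"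

end

locale linear_graph_ifs = ordered_graph_ifs G g R
  for G :: "('v, 'e) pre_digraph" (structure) and g :: "'e \<Rightarrow> 'a::euclidean_space \<Rightarrow> 'a"
    and R :: "('e \<times> 'e) set" +
  assumes linear: "\<lbrakk>i \<in> verts G; 1 \<le> k; adjacent_walks i k p q\<rbrakk> \<Longrightarrow>
    walk_set i p \<inter> walk_set i q \<noteq> {}"

text \<open>A system of ordered set equations \<open>E\<^sub>i = g\<^sub>1(E\<^bsub>j\<^sub>1\<^esub>) + \<dots> + g\<^sub>l(E\<^bsub>j\<^sub>l\<^esub>)\<close>, \<open>i \<in> V\<close>, is given by the
  lists \<open>eqs i = [(g\<^sub>1, j\<^sub>1), \<dots>, (g\<^sub>l, j\<^sub>l)]\<close>. The edges of the resulting ordered GIFS are the pairs of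
  a state and a position in its list, so that repeated terms give distinct edges.\<close>

definition eqs_graph :: "'v set \<Rightarrow> ('v \<Rightarrow> (('a \<Rightarrow> 'a) \<times> 'v) list) \<Rightarrow> ('v, 'v \<times> nat) pre_digraph" where
  "eqs_graph V eqs =
     \<lparr> verts = V, arcs = (SIGMA i:V. {..<length (eqs i)}),
       tail = fst, head = (\<lambda>(i, k). snd (eqs i ! k)) \<rparr>"

definition eqs_map :: "('v \<Rightarrow> (('a \<Rightarrow> 'a) \<times> 'v) list) \<Rightarrow> 'v \<times> nat \<Rightarrow> 'a \<Rightarrow> 'a" where
  "eqs_map eqs = (\<lambda>(i, k). fst (eqs i ! k))"

definition eqs_order :: "(('v \<times> nat) \<times> ('v \<times> nat)) set" where
  "eqs_order = {((i, k), (i, l)) | i k l. k < l}"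

definition linear_eqs :: "'v set \<Rightarrow> ('v \<Rightarrow> (('a::euclidean_space \<Rightarrow> 'a) \<times> 'v) list) \<Rightarrow> bool" where
  "linear_eqs V eqs \<longleftrightarrow> linear_graph_ifs (eqs_graph V eqs) (eqs_map eqs) eqs_order"

text \<open>The two-state system of a signature; it is only used on the state set \<open>{1, -1}\<close>.\<close>
definition zipper_eqs ::
    "nat \<Rightarrow> (nat \<Rightarrow> 'a \<Rightarrow> 'a) \<Rightarrow> (nat \<Rightarrow> int) \<Rightarrow> int \<Rightarrow> (('a \<Rightarrow> 'a) \<times> int) list" where
  "zipper_eqs N S \<beta> i =
     (if i = 1 then map (\<lambda>j. (S j, \<beta> j)) [1..<Suc N]
      else map (\<lambda>j. (S j, - \<beta> j)) (rev [1..<Suc N]))"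


section \<open>Optimal parametrizations\<close>

text \<open>The first line records the standing assumptions under which the notion is defined;
  \<open>s > 0\<close> is implicit in the exponent \<open>1 / s\<close>.\<close>
definition optimal_parametrization ::
    "real \<Rightarrow> 'a::euclidean_space set \<Rightarrow> (real \<Rightarrow> 'a) \<Rightarrow> bool" where
  "optimal_parametrization s F \<psi> \<longleftrightarrow>
     compact F \<and> 0 < s \<and> 0 < hausdorff_measure s F \<and> hausdorff_measure s F < \<infinity> \<and>
     \<psi> ` {0..1} = F \<and>
     (\<exists>F' I'. F' \<subseteq> F \<and> hausdorff_measure s (F - F') = 0 \<and>
        I' \<subseteq> {0..1} \<and> {0..1} - I' \<in> null_sets lebesgue \<and> bij_betw \<psi> I' F') \<and>
     (\<forall>X\<in>sets borel. X \<subseteq> {0..1} \<longrightarrow>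
        hausdorff_measure s (\<psi> ` X) = hausdorff_measure s F * emeasure lebesgue X) \<and>
     (\<forall>B\<in>sets borel. B \<subseteq> F \<longrightarrow>
        emeasure lebesgue {t \<in> {0..1}. \<psi> t \<in> B} =
          inverse (hausdorff_measure s F) * hausdorff_measure s B) \<and>
     (\<exists>c'>0. \<forall>x\<in>{0..1}. \<forall>y\<in>{0..1}. dist (\<psi> x) (\<psi> y) \<le> c' * \<bar>x - y\<bar> powr (1 / s))"

end

theory Submission
  imports Defs
begin

text \<open>The equivalence rests on two observations. Let \<open>K\<close> be the invariant set of the IFS. Both states of the
system have invariant set \<open>K\<close>, because each of the two equations lists every \<open>S\<^sub>j\<close> exactly once.
If there are vertices \<open>x\<^sub>0, \<dots>, x\<^sub>N\<close>, then \<open>K\<close> is traversed from \<open>x\<^sub>0\<close> to \<open>x\<^sub>N\<close> in state \<open>1\<close> and from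
\<open>x\<^sub>N\<close> to \<open>x\<^sub>0\<close> in state \<open>-1\<close>, and the zipper equations say that this traversal is consistent: the
first piece of a state starts where the state starts, the last piece ends where it ends, and
consecutive pieces share a vertex. By induction on the length, the end point of every walk is the
starting point of the next walk (\<open>next_walk_points_agree\<close>), so adjacent walks have sets with a common
point. Conversely, the starting points of the two states solve a pair of fixed point equations and
therefore always exist (\<open>exists_vertex_pair\<close>). In a linear system, the last walk through the piece
\<open>j\<close> is adjacent to the first walk through the piece \<open>j + 1\<close>; their sets meet and shrink to the end
point of the one piece and the starting point of the other, so that these two points coincide
(\<open>linear_imp_glued\<close>).

For the parametrization, let \<open>s\<close> solve \<open>\<Sum>r\<^sub>j\<^sup>s = 1\<close>, where \<open>r\<^sub>j\<close> is the ratio of \<open>S\<^sub>j\<close>, and cut \<open>[0, 1]\<close>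
into consecutive intervals of lengths \<open>r\<^sub>j\<^sup>s\<close>. Let \<open>\<sigma>\<^sub>j\<close> be the affine map of \<open>[0, 1]\<close> onto the \<open>j\<close>-th
interval, increasing or decreasing according to the sign \<open>\<beta>\<^sub>j\<close>. The vertices make the equation
\<open>\<psi> (\<sigma>\<^sub>j u) = S\<^sub>j (\<psi> u)\<close> consistent at the common end points, so it has a bounded solution
(\<open>exists_self_similar_parametrization\<close>). As \<open>\<sigma>\<^sub>j\<close> contracts by \<open>r\<^sub>j\<^sup>s\<close> and \<open>S\<^sub>j\<close> by \<open>r\<^sub>j\<close>, the solution
is Hoelder with exponent \<open>1/s\<close> (\<open>holder\<close>), and its image is \<open>K\<close>.

All measure-theoretic claims come from one inequality. The Hoelder estimate gives that
\<open>c = H\<^sup>s(K)\<close> is finite, and the self-similarity gives \<open>H\<^sup>s(\<psi>[u, v]) \<le> c (v - u)\<close> for all intervals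
(\<open>H_interval\<close>), hence \<open>H\<^sup>s(\<psi>(X)) \<le> c L(X)\<close> for all measurable \<open>X\<close>. As equality holds for
\<open>X = [0, 1]\<close>, applying this to \<open>X\<close> and to its complement yields equality for every \<open>X\<close>
(\<open>H_eq_lebesgue\<close>). If \<open>c > 0\<close>, then the images of two disjoint closed intervals meet in a null set, since
otherwise the common part would be counted twice; so \<open>\<psi>\<close> is injective off a null set.

It remains to see that \<open>H\<^sup>s(K) > 0\<close> under the open set condition; this also gives \<open>dim K = s\<close>. By the
mass distribution principle it suffices that the set of parameters which \<open>\<psi>\<close> maps into a ball of
radius \<open>\<epsilon>\<close> has length \<open>O(\<epsilon>\<^sup>s)\<close>. This follows from the inequality
\<open>L(\<psi>\<^sup>-\<^sup>1(B(z, \<epsilon>))) \<le> A \<epsilon>\<^bsup>s - d\<^esup> vol(V \<inter> B(z, R \<epsilon>))\<close> for a bounded open set \<open>V\<close> as in the condition.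
It is trivial at the coarsest scales and, as the sets \<open>S\<^sub>j(V)\<close> are disjoint subsets of \<open>V\<close>, it is
inherited by all finer scales (\<open>mass_le_volume\<close>).\<close>

section \<open>Hausdorff measure\<close>

lemma diam_power_empty [simp]: "diam_power s {} = 0"
  by (simp add: diam_power_def)

lemma diam_power_nonneg: "0 \<le> diam_power s U"
  by (simp add: diam_power_def)

lemma hausdorff_premeasure_le:
  assumes "A \<subseteq> (\<Union>i. U i)" "\<And>i. bounded (U i)" "\<And>i. diameter (U i) \<le> \<delta>"
  shows "hausdorff_premeasure \<delta> s A \<le> (\<Sum>i. ennreal (diam_power s (U i)))"
  unfolding hausdorff_premeasure_def by (rule INF_lower) (use assms in auto)

lemma hausdorff_premeasure_antimono:
  "\<delta> \<le> \<delta>' \<Longrightarrow> hausdorff_premeasure \<delta>' s A \<le> hausdorff_premeasure \<delta> s A"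
  unfolding hausdorff_premeasure_def by (rule INF_superset_mono) (auto intro: order_trans)

lemma hausdorff_premeasure_le_measure:
  "0 < \<delta> \<Longrightarrow> hausdorff_premeasure \<delta> s A \<le> hausdorff_measure s A"
  unfolding hausdorff_measure_def by (rule SUP_upper) simp

lemma hausdorff_measure_mono:
  assumes "A \<subseteq> B"
  shows "hausdorff_measure s A \<le> hausdorff_measure s B"
  unfolding hausdorff_measure_def hausdorff_premeasure_def
  by (intro SUP_mono' INF_superset_mono) (use assms in auto)

text \<open>Covers of the sets \<open>A n\<close> that are optimal up to \<open>e / 2\<^bsup>n + 1\<^esup>\<close> combine to a countable cover of
the union.\<close>
lemma hausdorff_premeasure_countably_subadditive:
  "hausdorff_premeasure \<delta> s (\<Union>n. A n) \<le> (\<Sum>n. hausdorff_premeasure \<delta> s (A n))"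
proof (rule ennreal_le_epsilon)
  fix e :: real
  assume fin: "(\<Sum>n. hausdorff_premeasure \<delta> s (A n)) < top" and e: "0 < e"
  have "\<exists>U. A n \<subseteq> (\<Union>i. U i) \<and> (\<forall>i. bounded (U i) \<and> diameter (U i) \<le> \<delta>) \<and>
      (\<Sum>i. ennreal (diam_power s (U i))) \<le> hausdorff_premeasure \<delta> s (A n) + e * (1/2) ^ Suc n" for n
  proof -
    have "hausdorff_premeasure \<delta> s (A n) < hausdorff_premeasure \<delta> s (A n) + ennreal (e * (1/2) ^ Suc n)"
      using ennreal_suminf_lessD[OF fin, of n] e
      by (cases "hausdorff_premeasure \<delta> s (A n)") (auto simp: ennreal_plus[symmetric] ennreal_less_iff simp del: ennreal_plus)
    then obtain U where "U \<in> {U. A n \<subseteq> (\<Union>i. U i) \<and> (\<forall>i. bounded (U i) \<and> diameter (U i) \<le> \<delta>)}"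
      "(\<Sum>i. ennreal (diam_power s (U i))) < hausdorff_premeasure \<delta> s (A n) + ennreal (e * (1/2) ^ Suc n)"
      by (subst (asm) (1) hausdorff_premeasure_def) (auto simp: INF_less_iff)
    then show ?thesis by (intro exI[of _ U]) auto
  qed
  then obtain U where U: "\<And>n. A n \<subseteq> (\<Union>i. U n i)" "\<And>n i. bounded (U n i)" "\<And>n i. diameter (U n i) \<le> \<delta>"
     "\<And>n. (\<Sum>i. ennreal (diam_power s (U n i))) \<le> hausdorff_premeasure \<delta> s (A n) + e * (1/2) ^ Suc n"
    by metis
  let ?W = "\<lambda>k. case prod_decode k of (n, i) \<Rightarrow> U n i"
  have cov: "(\<Union>n. A n) \<subseteq> (\<Union>k. ?W k)"
  proof
    fix x assume "x \<in> (\<Union>n. A n)"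
    then obtain n i where "x \<in> U n i" using U(1) by blast
    then show "x \<in> (\<Union>k. ?W k)"
      by (intro UN_I[of "prod_encode (n, i)"]) auto
  qed
  have "hausdorff_premeasure \<delta> s (\<Union>n. A n) \<le> (\<Sum>k. ennreal (diam_power s (?W k)))"
    by (rule hausdorff_premeasure_le[OF cov]) (auto split: prod.split simp: U)
  also have "\<dots> = (\<Sum>k. (\<lambda>(n, i). ennreal (diam_power s (U n i))) (prod_decode k))"
    by (intro suminf_cong) (auto split: prod.split)
  also have "\<dots> = (\<Sum>n. \<Sum>i. ennreal (diam_power s (U n i)))"
    by (simp add: suminf_ennreal_2dimen[of _ "\<lambda>(n, i). ennreal (diam_power s (U n i))"])
  also have "\<dots> \<le> (\<Sum>n. hausdorff_premeasure \<delta> s (A n) + ennreal (e * (1/2) ^ Suc n))"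
    using U(4) by (intro suminf_le) auto
  also have "\<dots> = (\<Sum>n. hausdorff_premeasure \<delta> s (A n)) + (\<Sum>n. ennreal (e * (1/2) ^ Suc n))"
    by (rule suminf_add[symmetric]) auto
  also have "(\<Sum>n. ennreal (e * (1/2) ^ Suc n)) = ennreal e"
    using e sums_mult[OF power_half_series, of e] by (intro suminf_ennreal_eq) auto
  finally show "hausdorff_premeasure \<delta> s (\<Union>n. A n) \<le> (\<Sum>n. hausdorff_premeasure \<delta> s (A n)) + ennreal e" .
qed

lemma hausdorff_measure_countably_subadditive:
  "hausdorff_measure s (\<Union>n. A n) \<le> (\<Sum>n. hausdorff_measure s (A n))"
  unfolding hausdorff_measure_def[of s "\<Union>n. A n"]
proof (rule SUP_least)
  fix \<delta> :: real assume "\<delta> \<in> {0<..}"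
  then have "hausdorff_premeasure \<delta> s (A n) \<le> hausdorff_measure s (A n)" for n
    using hausdorff_premeasure_le_measure[of \<delta>] by auto
  then have "(\<Sum>n. hausdorff_premeasure \<delta> s (A n)) \<le> (\<Sum>n. hausdorff_measure s (A n))"
    by (intro suminf_le) auto
  then show "hausdorff_premeasure \<delta> s (\<Union>n. A n) \<le> (\<Sum>n. hausdorff_measure s (A n))"
    using hausdorff_premeasure_countably_subadditive order_trans by blast
qed

lemma hausdorff_measure_empty [simp]: "hausdorff_measure s {} = 0"
proof -
  have "hausdorff_premeasure \<delta> s {} \<le> 0" if "0 < \<delta>" for \<delta>
    using hausdorff_premeasure_le[of "{}" "\<lambda>_. {}" \<delta> s] that by (auto simp: diameter_def)
  then have "hausdorff_measure s {} \<le> 0"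
    unfolding hausdorff_measure_def by (intro SUP_least) auto
  then show ?thesis by simp
qed

lemma hausdorff_measure_Un:
  "hausdorff_measure s (A \<union> B) \<le> hausdorff_measure s A + hausdorff_measure s B"
proof -
  define C where "C = (\<lambda>n::nat. if n = 0 then A else if n = 1 then B else {})"
  have "A \<union> B \<subseteq> (\<Union>n. C n)"
    unfolding C_def by (auto intro: exI[of _ "0::nat"] exI[of _ "1::nat"])
  then have "hausdorff_measure s (A \<union> B) \<le> (\<Sum>n. hausdorff_measure s (C n))"
    using hausdorff_measure_mono hausdorff_measure_countably_subadditive order_trans by blast
  also have "\<dots> = (\<Sum>n\<in>{0,1}. hausdorff_measure s (C n))"
    by (rule suminf_finite) (auto simp: C_def)
  finally show ?thesis by (simp add: C_def)
qed

lemma diameter_image_le: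
  assumes "bounded U" "0 \<le> r" "\<And>x y. dist (f x) (f y) \<le> r * dist x y"
  shows "diameter (f ` U) \<le> r * diameter U"
proof (cases "U = {}")
  case False
  have "dist (f x) (f y) \<le> r * diameter U" if "x \<in> U" "y \<in> U" for x y
    using assms(3)[of x y] mult_left_mono[OF diameter_bounded_bound[OF assms(1) that] assms(2)]
    by linarith
  then show ?thesis
    using False unfolding diameter_def by (auto intro!: cSUP_least)
qed (simp add: diameter_def)

lemma bounded_lipschitz_image:
  assumes "bounded U" "0 \<le> r" "\<And>x y. dist (f x) (f y) \<le> r * dist x y"
  shows "bounded (f ` U)"
proof -
  obtain e c where e: "\<And>y. y \<in> U \<Longrightarrow> dist c y \<le> e" using assms(1) by (auto simp: bounded_def)
  have "dist (f c) (f y) \<le> r * e" if "y \<in> U" for y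
    using assms(3)[of c y] mult_left_mono[OF e[OF that] assms(2)] by linarith
  then show ?thesis unfolding bounded_def by blast
qed

text \<open>The images of the sets of a cover at scale \<open>\<delta> / r\<close> form a cover at scale \<open>\<delta>\<close>.\<close>
lemma hausdorff_measure_lipschitz_image:
  fixes f :: "'a::metric_space \<Rightarrow> 'b::metric_space"
  assumes r: "0 < r" and s: "0 < s" and f: "\<And>x y. dist (f x) (f y) \<le> r * dist x y"
  shows "hausdorff_measure s (f ` A) \<le> ennreal (r powr s) * hausdorff_measure s A"
  unfolding hausdorff_measure_def[of s "f ` A"]
proof (rule SUP_least)
  fix \<delta> :: real assume "\<delta> \<in> {0<..}"
  then have \<delta>: "0 < \<delta>" by simp
  have "hausdorff_premeasure \<delta> s (f ` A) \<le> ennreal (r powr s) * (\<Sum>i. ennreal (diam_power s (U i)))"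
    if U: "A \<subseteq> (\<Union>i. U i)" "\<And>i. bounded (U i)" "\<And>i. diameter (U i) \<le> \<delta> / r" for U
  proof -
    have diam: "diameter (f ` U i) \<le> r * diameter (U i)" for i
      using diameter_image_le U(2) r f by (metis less_imp_le)
    have "hausdorff_premeasure \<delta> s (f ` A) \<le> (\<Sum>i. ennreal (diam_power s (f ` U i)))"
    proof (rule hausdorff_premeasure_le)
      show "f ` A \<subseteq> (\<Union>i. f ` U i)" using U(1) by blast
      show "bounded (f ` U i)" for i
        using bounded_lipschitz_image U(2) r f by (metis less_imp_le)
      have "r * diameter (U i) \<le> \<delta>" for i
        using U(3)[of i] r by (simp add: field_simps)
      then show "diameter (f ` U i) \<le> \<delta>" for i
        using diam[of i] order_trans by blast
    qed
    also have "\<dots> \<le> (\<Sum>i. ennreal (r powr s) * ennreal (diam_power s (U i)))"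
    proof (rule suminf_le)
      fix i
      have "diameter (f ` U i) powr s \<le> (r * diameter (U i)) powr s"
        using diam[of i] s r
        by (metis U(2) bounded_lipschitz_image diameter_ge_0 f less_imp_le powr_mono2)
      then show "ennreal (diam_power s (f ` U i)) \<le> ennreal (r powr s) * ennreal (diam_power s (U i))"
        using s r U(2)[of i]
        by (auto simp: diam_power_def powr_mult diameter_ge_0 ennreal_leI simp flip: ennreal_mult)
    qed auto
    finally show ?thesis by simp
  qed
  then have "hausdorff_premeasure \<delta> s (f ` A) / ennreal (r powr s) \<le> hausdorff_premeasure (\<delta> / r) s A"
    unfolding hausdorff_premeasure_def[of "\<delta> / r"] using r
    by (intro INF_greatest divide_le_posI_ennreal) auto
  also have "\<dots> \<le> hausdorff_measure s A"
    using \<delta> r by (intro hausdorff_premeasure_le_measure) auto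
  finally have "ennreal (r powr s) * (hausdorff_premeasure \<delta> s (f ` A) / ennreal (r powr s))
      \<le> ennreal (r powr s) * hausdorff_measure s A"
    by (intro mult_left_mono) auto
  then show "hausdorff_premeasure \<delta> s (f ` A) \<le> ennreal (r powr s) * hausdorff_measure s A"
    using r mult_divide_eq_ennreal[of "ennreal (r powr s)" "hausdorff_premeasure \<delta> s (f ` A)"]
    by (simp add: ennreal_times_divide mult.commute)
qed

lemma diam_power_exponent_le:
  assumes "0 \<le> t" "t < s" "0 < \<delta>" "bounded U" "diameter U \<le> \<delta>"
  shows "diam_power s U \<le> \<delta> powr (s - t) * diam_power t U"
proof -
  let ?d = "diameter U"
  have d: "0 \<le> ?d" using assms(4) diameter_ge_0 by blast
  have "?d powr s \<le> \<delta> powr (s - t) * (if t = 0 then 1 else ?d powr t)"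
  proof (cases "?d = 0")
    case False
    have "?d powr s = ?d powr (s - t) * ?d powr t" by (simp flip: powr_add)
    also have "\<dots> \<le> \<delta> powr (s - t) * ?d powr t"
      using assms d by (intro mult_right_mono powr_mono2) auto
    finally show ?thesis using False d assms by auto
  qed (use assms in auto)
  then show ?thesis using assms by (auto simp: diam_power_def)
qed

text \<open>A cover by sets of diameter at most \<open>\<delta>\<close> has an \<open>s\<close>-sum of at most \<open>\<delta>\<^bsup>s - t\<^esup>\<close> times its \<open>t\<close>-sum, and
this factor tends to \<open>0\<close>.\<close>
lemma hausdorff_measure_eq_0_if_finite:
  assumes ts: "0 \<le> t" "t < s" and fin: "hausdorff_measure t A < \<infinity>"
  shows "hausdorff_measure s A = 0"
proof -
  obtain M where M: "0 \<le> M" "hausdorff_measure t A = ennreal M"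
    using fin by (cases "hausdorff_measure t A") auto
  have *: "hausdorff_premeasure \<delta> s A \<le> ennreal (\<delta> powr (s - t) * (M + 1))" if \<delta>: "0 < \<delta>" for \<delta>
  proof -
    have "hausdorff_premeasure \<delta> t A \<le> ennreal M"
      using hausdorff_premeasure_le_measure[OF \<delta>, of t A] M by simp
    then have "hausdorff_premeasure \<delta> t A < ennreal (M + 1)"
      using M by (simp add: ennreal_lessI le_less_trans)
    then obtain U where U: "A \<subseteq> (\<Union>i. U i)" "\<And>i. bounded (U i)" "\<And>i. diameter (U i) \<le> \<delta>"
       "(\<Sum>i. ennreal (diam_power t (U i))) < ennreal (M + 1)"
      unfolding hausdorff_premeasure_def by (auto simp: INF_less_iff)
    have "hausdorff_premeasure \<delta> s A \<le> (\<Sum>i. ennreal (diam_power s (U i)))"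
      using U by (intro hausdorff_premeasure_le) auto
    also have "\<dots> \<le> (\<Sum>i. ennreal (\<delta> powr (s - t)) * ennreal (diam_power t (U i)))"
      using diam_power_exponent_le[OF ts \<delta> U(2) U(3)]
      by (intro suminf_le) (auto simp: ennreal_mult[symmetric] diam_power_nonneg intro!: ennreal_leI)
    also have "\<dots> = ennreal (\<delta> powr (s - t)) * (\<Sum>i. ennreal (diam_power t (U i)))"
      by simp
    also have "\<dots> \<le> ennreal (\<delta> powr (s - t)) * ennreal (M + 1)"
      using U(4) by (intro mult_left_mono) auto
    finally show ?thesis using M by (simp add: ennreal_mult)
  qed
  have "hausdorff_premeasure \<delta> s A = 0" if \<delta>: "0 < \<delta>" for \<delta>
  proof -
    have "((\<lambda>\<delta>. ennreal (\<delta> powr (s - t) * (M + 1))) \<longlongrightarrow> ennreal (0 powr (s - t) * (M + 1))) (at_right 0)"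
      using ts by (intro tendsto_ennrealI tendsto_intros) (auto simp: eventually_at_filter)
    moreover have "\<forall>\<^sub>F \<epsilon> in at_right 0. hausdorff_premeasure \<delta> s A \<le> ennreal (\<epsilon> powr (s - t) * (M + 1))"
      using eventually_at_right_less eventually_at_right_field[of _ 0]
    proof -
      have "hausdorff_premeasure \<delta> s A \<le> ennreal (\<epsilon> powr (s - t) * (M + 1))" if "0 < \<epsilon>" "\<epsilon> < \<delta>" for \<epsilon>
        using hausdorff_premeasure_antimono[of \<epsilon> \<delta> s A] *[of \<epsilon>] that order_trans by fastforce
      then show ?thesis using \<delta> by (auto simp: eventually_at_right_field)
    qed
    ultimately have "hausdorff_premeasure \<delta> s A \<le> ennreal (0 powr (s - t) * (M + 1))"
      by (rule tendsto_lowerbound) simp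
    then show ?thesis by simp
  qed
  then have "hausdorff_measure s A \<le> 0"
    unfolding hausdorff_measure_def by (intro SUP_least) auto
  then show ?thesis by simp
qed

lemma hausdorff_dim_eqI:
  assumes "0 \<le> s" "0 < hausdorff_measure s A" "hausdorff_measure s A < \<infinity>"
  shows "hausdorff_dim A = s"
proof -
  have ge: "s \<le> t" if "0 \<le> t" "hausdorff_measure t A = 0" for t
    using hausdorff_measure_eq_0_if_finite[of t s A] that assms(2) by (cases "t < s") auto
  have zero: "hausdorff_measure t A = 0" if "s < t" for t
    using hausdorff_measure_eq_0_if_finite[of s t A] that assms by auto
  have "Inf {t. 0 \<le> t \<and> hausdorff_measure t A = 0} = s"
  proof (rule cInf_eq)
    fix y assume y: "\<And>x. x \<in> {t. 0 \<le> t \<and> hausdorff_measure t A = 0} \<Longrightarrow> y \<le> x"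
    show "y \<le> s"
    proof (rule dense_ge)
      fix t assume "s < t"
      then show "y \<le> t" using y[of t] zero[of t] assms(1) by auto
    qed
  qed (use ge in auto)
  then show ?thesis unfolding hausdorff_dim_def .
qed

text \<open>The mass distribution principle, for the image of \<open>M\<close> under \<open>\<psi>\<close>: a set \<open>U\<close> of a cover lies in a
ball around one of its points with the diameter of \<open>U\<close> as radius, so a cover of \<open>F\<close> has an \<open>s\<close>-sum
of at least the mass of \<open>F\<close> divided by \<open>C\<close>. Sets of diameter \<open>0\<close> carry no mass, since a point has
arbitrarily small balls around it.\<close>
lemma hausdorff_measure_pos_mass_distribution:
  fixes F :: "'a::metric_space set"
  assumes s: "0 < s" and "0 < C" and m: "0 < emeasure M (\<psi> -` F \<inter> space M)"
    and meas: "\<And>x \<rho>. \<psi> -` cball x \<rho> \<inter> space M \<in> sets M"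
    and bound: "\<And>x \<rho>. 0 < \<rho> \<Longrightarrow> \<rho> \<le> 1 \<Longrightarrow> emeasure M (\<psi> -` cball x \<rho> \<inter> space M) \<le> ennreal (C * \<rho> powr s)"
    and FM: "\<psi> -` F \<inter> space M \<in> sets M"
  shows "0 < hausdorff_measure s F"
proof -
  have zero: "emeasure M (\<psi> -` cball x 0 \<inter> space M) = 0" for x
  proof -
    have "((\<lambda>\<rho>. ennreal (C * \<rho> powr s)) \<longlongrightarrow> ennreal (C * 0 powr s)) (at_right 0)"
      using s by (intro tendsto_ennrealI tendsto_intros) (auto simp: eventually_at_filter)
    moreover have "\<forall>\<^sub>F \<rho> in at_right 0. emeasure M (\<psi> -` cball x 0 \<inter> space M) \<le> ennreal (C * \<rho> powr s)"
    proof -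
      have "emeasure M (\<psi> -` cball x 0 \<inter> space M) \<le> ennreal (C * \<rho> powr s)" if "0 < \<rho>" "\<rho> < 1" for \<rho>
      proof -
        have "emeasure M (\<psi> -` cball x 0 \<inter> space M) \<le> emeasure M (\<psi> -` cball x \<rho> \<inter> space M)"
          using that by (intro emeasure_mono meas) auto
        then show ?thesis using bound[of \<rho> x] that by (meson less_imp_le order_trans)
      qed
      then show ?thesis by (auto simp: eventually_at_right_field intro: exI[of _ 1])
    qed
    ultimately have "emeasure M (\<psi> -` cball x 0 \<inter> space M) \<le> ennreal (C * 0 powr s)"
      by (rule tendsto_lowerbound) simp
    then show ?thesis by simp
  qed
  have "emeasure M (\<psi> -` F \<inter> space M) / C \<le> hausdorff_premeasure 1 s F"
    unfolding hausdorff_premeasure_def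
  proof (rule INF_greatest)
    fix U :: "nat \<Rightarrow> 'a set"
    assume "U \<in> {U. F \<subseteq> (\<Union>i. U i) \<and> (\<forall>i. bounded (U i) \<and> diameter (U i) \<le> 1)}"
    then have U: "F \<subseteq> (\<Union>i. U i)" "\<And>i. bounded (U i)" "\<And>i. diameter (U i) \<le> 1" by auto
    define x where "x i = (SOME y. y \<in> U i)" for i
    define B where "B i = (if U i = {} then {} else \<psi> -` cball (x i) (diameter (U i)) \<inter> space M)" for i
    have UB: "\<psi> -` U i \<inter> space M \<subseteq> B i" for i
    proof
      fix t assume t: "t \<in> \<psi> -` U i \<inter> space M"
      then have "x i \<in> U i" unfolding x_def by (auto intro: someI)
      then have "dist (x i) (\<psi> t) \<le> diameter (U i)" using U(2) t by (auto intro: diameter_bounded_bound)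
      then show "t \<in> B i" using t by (auto simp: B_def)
    qed
    have B: "B i \<in> sets M" for i using meas by (auto simp: B_def)
    have "emeasure M (B i) \<le> ennreal C * ennreal (diam_power s (U i))" for i
    proof (cases "U i = {}")
      case False
      then show ?thesis
        using zero[of "x i"] bound[of "diameter (U i)" "x i"] U(3)[of i] diameter_ge_0[OF U(2)[of i]] s \<open>0 < C\<close>
        by (cases "diameter (U i) = 0") (auto simp: B_def diam_power_def simp flip: ennreal_mult)
    qed (simp add: B_def)
    then have "(\<Sum>i. emeasure M (B i)) \<le> (\<Sum>i. ennreal C * ennreal (diam_power s (U i)))"
      by (intro suminf_le) auto
    moreover have "emeasure M (\<psi> -` F \<inter> space M) \<le> emeasure M (\<Union>i. B i)"
    proof (rule emeasure_mono)
      show "\<psi> -` F \<inter> space M \<subseteq> (\<Union>i. B i)" using UB U(1) by fastforce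
    qed (use B in auto)
    moreover have "emeasure M (\<Union>i. B i) \<le> (\<Sum>i. emeasure M (B i))"
      using B by (intro emeasure_subadditive_countably) auto
    ultimately have "emeasure M (\<psi> -` F \<inter> space M) \<le> ennreal C * (\<Sum>i. ennreal (diam_power s (U i)))"
      by simp
    then show "emeasure M (\<psi> -` F \<inter> space M) / ennreal C \<le> (\<Sum>i. ennreal (diam_power s (U i)))"
      using \<open>0 < C\<close> by (auto intro: divide_le_posI_ennreal)
  qed
  also have "\<dots> \<le> hausdorff_measure s F" by (simp add: hausdorff_premeasure_le_measure)
  finally have "emeasure M (\<psi> -` F \<inter> space M) / ennreal C \<le> hausdorff_measure s F" .
  moreover have "0 < emeasure M (\<psi> -` F \<inter> space M) / ennreal C"
    using m by (simp add: ennreal_zero_less_divide)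
  ultimately show ?thesis by (rule less_le_trans[rotated])
qed

section \<open>Invariant sets of iterated function systems\<close>

text \<open>Hutchinson's uniqueness argument. The hypothesis \<open>step\<close> expresses that \<open>E i\<close> is covered by, and
\<open>E' i\<close> contains, contracted copies of members of the respective family under the same maps. Every
bound on the distances of the points of the \<open>E i\<close> from \<open>E' i\<close> can then be improved by the factor \<open>q\<close>, so
these distances are \<open>0\<close>. With compact sets \<open>E i\<close> the lemma yields the uniqueness of invariant sets;
with singletons \<open>E i\<close> it shows that certain points belong to an invariant set.\<close>
lemma contracted_family_subset:
  fixes E E' :: "'i \<Rightarrow> 'a::heine_borel set"
  assumes I: "finite I" and q: "0 \<le> q" "q < 1"
    and E: "\<And>i. i \<in> I \<Longrightarrow> bounded (E i)"
    and E': "\<And>i. i \<in> I \<Longrightarrow> compact (E' i) \<and> E' i \<noteq> {}"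
    and step: "\<And>i x. i \<in> I \<Longrightarrow> x \<in> E i \<Longrightarrow> \<exists>k\<in>I. \<exists>y\<in>E k. \<exists>f. x = f y \<and> f ` E' k \<subseteq> E' i \<and>
        (\<forall>u v. dist (f u) (f v) \<le> q * dist u v)"
    and i: "i \<in> I"
  shows "E i \<subseteq> E' i"
proof
  have "\<exists>D. \<forall>x\<in>E i. infdist x (E' i) \<le> D" if i: "i \<in> I" for i
  proof -
    obtain e where e: "e \<in> E' i" using E'[OF i] by auto
    obtain D where "\<And>x. x \<in> E i \<Longrightarrow> dist e x \<le> D" using E[OF i] bounded_any_center[of "E i" e] by auto
    then show ?thesis using infdist_le2[OF e] by (metis dist_commute)
  qed
  then obtain D where D: "\<And>i x. i \<in> I \<Longrightarrow> x \<in> E i \<Longrightarrow> infdist x (E' i) \<le> D i" by metis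
  define D' where "D' = Max (D ` I)"
  have *: "infdist x (E' i) \<le> q ^ n * D'" if "i \<in> I" "x \<in> E i" for i x n
    using that
  proof (induction n arbitrary: i x)
    case 0
    have "D i \<le> D'" using I 0 by (simp add: D'_def)
    then show ?case using D[OF 0] by simp
  next
    case (Suc n)
    then obtain k y f where k: "k \<in> I" "y \<in> E k" "x = f y" "f ` E' k \<subseteq> E' i"
      and f: "\<And>u v. dist (f u) (f v) \<le> q * dist u v" using step by meson
    obtain z where z: "z \<in> E' k" "infdist y (E' k) = dist y z"
      using infdist_attains_inf[of "E' k" y] E'[OF k(1)] compact_imp_closed by metis
    have "infdist x (E' i) \<le> dist (f y) (f z)" using k z by (auto intro: infdist_le)
    also have "\<dots> \<le> q * infdist y (E' k)" using f z by simp
    also have "\<dots> \<le> q * (q ^ n * D')" using Suc.IH[OF k(1,2)] q by (intro mult_left_mono)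
    finally show ?case by (simp add: mult.assoc)
  qed
  fix x assume x: "x \<in> E i"
  have "(\<lambda>n. q ^ n * D') \<longlonglongrightarrow> 0 * D'" using q by (intro tendsto_intros LIMSEQ_power_zero) auto
  then have "infdist x (E' i) \<le> 0"
    using *[OF i x] by (intro tendsto_lowerbound) auto
  then have "infdist x (E' i) = 0" using infdist_nonneg[of x "E' i"] by linarith
  then show "x \<in> E' i"
    using E'[OF i] in_closed_iff_infdist_zero[of "E' i" x] compact_imp_closed by blast
qed

locale similitude_ifs =
  fixes N :: nat and S :: "nat \<Rightarrow> 'a::euclidean_space \<Rightarrow> 'a" and r :: "nat \<Rightarrow> real"
  assumes N: "2 \<le> N"
    and r_pos: "j \<in> {1..N} \<Longrightarrow> 0 < r j" and r_less_1: "j \<in> {1..N} \<Longrightarrow> r j < 1"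
    and dist_S: "j \<in> {1..N} \<Longrightarrow> dist (S j u) (S j v) = r j * dist u v"

lemma ifs_imp_similitude_ifs:
  assumes "ifs N S" obtains r where "similitude_ifs N S r"
proof -
  have "\<forall>j\<in>{1..N}. \<exists>r. 0 < r \<and> r < 1 \<and> (\<forall>x y. dist (S j x) (S j y) = r * dist x y)"
    using assms unfolding ifs_def contractive_similitude_def by blast
  then obtain r where "\<forall>j\<in>{1..N}. 0 < r j \<and> r j < 1 \<and> (\<forall>x y. dist (S j x) (S j y) = r j * dist x y)"
    by metis
  then have "similitude_ifs N S r" using assms unfolding ifs_def by unfold_locales auto
  then show ?thesis using that by blast
qed

context similitude_ifs
begin

definition q :: real where "q = Max (r ` {1..N})"

lemma index_1 [simp]: "Suc 0 \<in> {Suc 0..N}"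
  using N by auto

lemma r_le_q: "j \<in> {1..N} \<Longrightarrow> r j \<le> q"
  unfolding q_def by (intro Max_ge) auto

lemma q_pos: "0 < q" and q_less_1: "q < 1"
proof -
  have "q \<in> r ` {1..N}" unfolding q_def by (intro Max_in) (use N in auto)
  then show "0 < q" "q < 1" using r_pos r_less_1 by auto
qed

lemma dist_S_le: "j \<in> {1..N} \<Longrightarrow> dist (S j u) (S j v) \<le> q * dist u v"
  using dist_S[of j u v] r_le_q[of j] by (simp add: mult_right_mono)

lemma continuous_on_S: "j \<in> {1..N} \<Longrightarrow> continuous_on X (S j)"
  using dist_S r_pos
  by (intro lipschitz_on_continuous_on[of "r j"] lipschitz_onI) (auto simp: less_imp_le)

lemma inj_S: "j \<in> {1..N} \<Longrightarrow> inj (S j)"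
  using dist_S[of j] r_pos[of j] by (intro injI) (metis dist_eq_0_iff mult_eq_0_iff less_irrefl)

text \<open>Every sufficiently large ball around the origin is mapped into itself by all the maps. Such a ball
starts the construction of the invariant set, bounds the iterates that define the parametrization,
and serves to replace the open set of the open set condition by a bounded one.\<close>
lemma exists_absorbing_radius:
  obtains M where "0 \<le> M" "\<And>R j u. M \<le> R \<Longrightarrow> j \<in> {1..N} \<Longrightarrow> norm (u :: 'a) \<le> R \<Longrightarrow> norm (S j u) \<le> R"
proof -
  define m where "m = Max ((\<lambda>j. norm (S j 0)) ` {1..N})"
  have m: "norm (S j 0) \<le> m" if "j \<in> {1..N}" for j
    unfolding m_def using that by (intro Max_ge) auto
  have m0: "0 \<le> m" using m[of 1] norm_ge_zero[of "S 1 0"] index_1 by (simp del: norm_ge_zero)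
  show ?thesis
  proof
    show "0 \<le> m / (1 - q)" using m0 q_less_1 by simp
    fix R j and u :: 'a assume R: "m / (1 - q) \<le> R" and j: "j \<in> {1..N}" and u: "norm u \<le> R"
    have "norm (S j u) \<le> norm (S j 0) + dist (S j u) (S j 0)"
      by (metis dist_norm norm_triangle_sub)
    also have "\<dots> \<le> m + q * norm u" using m[OF j] dist_S_le[OF j, of u 0] by simp
    also have "\<dots> \<le> m + q * R" using u q_pos by simp
    also have "\<dots> \<le> R" using R q_less_1 by (simp add: field_simps)
    finally show "norm (S j u) \<le> R" .
  qed
qed

definition K :: "'a set" where "K = ifs_invariant_set N S"

lemma invariant_compact_subset:
  assumes "bounded F" "F \<subseteq> (\<Union>j\<in>{1..N}. S j ` F)"
    and "compact F'" "F' \<noteq> {}" "(\<Union>j\<in>{1..N}. S j ` F') \<subseteq> F'"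
  shows "F \<subseteq> F'"
proof -
  have "(\<lambda>_::unit. F) () \<subseteq> (\<lambda>_. F') ()"
  proof (rule contracted_family_subset[of UNIV q "\<lambda>_::unit. F" "\<lambda>_. F'"])
    fix x assume "x \<in> F"
    then obtain j y where jy: "j \<in> {1..N}" "y \<in> F" "x = S j y" using assms(2) by blast
    moreover have "S j ` F' \<subseteq> F'" using jy(1) assms(5) by blast
    ultimately show "\<exists>k\<in>UNIV. \<exists>y\<in>F. \<exists>f. x = f y \<and> f ` F' \<subseteq> F' \<and> (\<forall>u v. dist (f u) (f v) \<le> q * dist u v)"
      using dist_S_le[OF jy(1)] by blast
  qed (use assms q_pos q_less_1 in auto)
  then show ?thesis by simp
qed

text \<open>The images of an absorbing ball under the Hutchinson operator decrease, and their intersection is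
invariant. A point of the intersection is, for each \<open>n\<close>, the image of a point of the \<open>n\<close>-th set under
some \<open>S j\<close>; one index \<open>j\<close> occurs infinitely often, and injectivity of \<open>S j\<close> makes the preimage
the same for all \<open>n\<close>.\<close>
lemma exists_invariant_compact:
  "\<exists>F. F \<noteq> {} \<and> compact F \<and> F = (\<Union>j\<in>{1..N}. S j ` F)"
proof -
  let ?H = "\<lambda>X. \<Union>j\<in>{1..N}. S j ` X"
  obtain M where M: "0 \<le> M" "\<And>j u. j \<in> {1..N} \<Longrightarrow> norm u \<le> M \<Longrightarrow> norm (S j u) \<le> M"
    using exists_absorbing_radius by (metis order_refl)
  define B where "B n = (?H ^^ n) (cball 0 M)" for n
  have B_Suc: "B (Suc n) = ?H (B n)" for n by (simp add: B_def)
  have comp: "compact (B n)" for n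
  proof (induction n)
    case (Suc n)
    then show ?case unfolding B_Suc
      by (intro compact_UN compact_continuous_image continuous_on_S) auto
  qed (simp add: B_def)
  have ne: "B n \<noteq> {}" for n
  proof (induction n)
    case (Suc n)
    then show ?case unfolding B_Suc using index_1 by auto
  qed (use M in \<open>simp add: B_def\<close>)
  have dec: "B (Suc n) \<subseteq> B n" for n
  proof (induction n)
    case 0
    show ?case using M by (auto simp: B_def)
  next
    case (Suc n)
    then show ?case unfolding B_Suc[of "Suc n"] B_Suc[of n] by blast
  qed
  then have anti: "B n \<subseteq> B m" if "m \<le> n" for m n
    using lift_Suc_antimono_le[of B] that by blast
  let ?F = "\<Inter>n. B n"
  have "?F \<noteq> {}" by (rule compact_nest[OF comp ne]) (rule anti)
  moreover have "compact ?F"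
    using comp compact_imp_closed by (intro compact_Inter) auto
  moreover have "?F \<subseteq> ?H ?F"
  proof
    fix x assume x: "x \<in> ?F"
    have "\<exists>j\<in>{1..N}. x \<in> S j ` B n" for n
    proof -
      have "x \<in> B (Suc n)" using x by blast
      then show ?thesis unfolding B_Suc by blast
    qed
    then obtain j where j: "\<And>n. j n \<in> {1..N}" "\<And>n. x \<in> S (j n) ` B n" by metis
    obtain i where i: "infinite {n. j n = i}" "i \<in> {1..N}"
    proof -
      have "finite (range j)" using j(1) by (meson finite_atLeastAtMost finite_subset image_subsetI)
      then obtain n0 where "infinite {n. j n = j n0}"
        using pigeonhole_infinite[of UNIV j] by auto
      then show ?thesis using that j(1) by blast
    qed
    have xi: "x \<in> S i ` B n" for n
    proof -
      obtain m where "n \<le> m" "j m = i" using i(1) unfolding infinite_nat_iff_unbounded_le by auto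
      then show ?thesis using j(2)[of m] anti by blast
    qed
    then obtain y where y: "x = S i y" "y \<in> B 0" by blast
    have "y \<in> B n" for n using xi[of n] y inj_S[OF i(2)] by (auto dest: injD)
    then show "x \<in> ?H ?F" using y i(2) by blast
  qed
  moreover have "?H ?F \<subseteq> ?F"
  proof safe
    fix j u n assume "j \<in> {1..N}" "u \<in> ?F"
    then have "S j u \<in> B (Suc n)" unfolding B_Suc by blast
    then show "S j u \<in> B n" using dec by blast
  qed
  ultimately show ?thesis by blast
qed

lemma invariant_compact_unique:
  assumes "F \<noteq> {}" "compact F" "F = (\<Union>j\<in>{1..N}. S j ` F)"
    and "F' \<noteq> {}" "compact F'" "F' = (\<Union>j\<in>{1..N}. S j ` F')"
  shows "F = F'"
  using invariant_compact_subset[of F F'] invariant_compact_subset[of F' F] assms compact_imp_bounded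
  by (metis order_refl subset_antisym)

lemma K: "K \<noteq> {} \<and> compact K \<and> K = (\<Union>j\<in>{1..N}. S j ` K)"
  unfolding K_def ifs_invariant_set_def
proof (rule theI')
  show "\<exists>!F. F \<noteq> {} \<and> compact F \<and> F = (\<Union>j\<in>{1..N}. S j ` F)"
    using exists_invariant_compact invariant_compact_unique by (intro ex_ex1I) (blast, metis)
qed

lemma K_nonempty: "K \<noteq> {}" and compact_K: "compact K" and K_eq: "K = (\<Union>j\<in>{1..N}. S j ` K)"
  using K by auto

lemma K_eqI: "F \<noteq> {} \<Longrightarrow> compact F \<Longrightarrow> F = (\<Union>j\<in>{1..N}. S j ` F) \<Longrightarrow> F = K"
  using invariant_compact_unique[of F K] K by blast

lemma S_in_K: "j \<in> {1..N} \<Longrightarrow> u \<in> K \<Longrightarrow> S j u \<in> K"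
  using K_eq by blast

end

section \<open>Zippers and linear graph-directed systems\<close>

lemma Cons_in_lexn_iff:
  "(x # xs, y # ys) \<in> lexn R (Suc n) \<longleftrightarrow>
     length xs = n \<and> length ys = n \<and> ((x, y) \<in> R \<or> x = y \<and> (xs, ys) \<in> lexn R n)"
  by (auto simp: image_iff dest: lexn_length intro!: bexI[of _ "((x, xs), (y, ys))"])

locale signed_ifs = similitude_ifs N S r
  for N :: nat and S :: "nat \<Rightarrow> 'a::euclidean_space \<Rightarrow> 'a" and r :: "nat \<Rightarrow> real" +
  fixes \<beta> :: "nat \<Rightarrow> int"
  assumes \<beta>: "j \<in> {1..N} \<Longrightarrow> \<beta> j = 1 \<or> \<beta> j = -1"
begin

text \<open>The index \<open>j\<close> of the map \<open>S\<^sub>j\<close> in the term at position \<open>k\<close> of the equation of the state \<open>i\<close>, where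
positions start at \<open>0\<close>: state \<open>-1\<close> runs through the maps backwards.\<close>
definition term_index :: "int \<Rightarrow> nat \<Rightarrow> nat" where
  "term_index i k = (if i = 1 then Suc k else N - k)"

text \<open>The state to which this term refers. Multiplication by \<open>i\<close> covers both equations at once, and makes
the symmetry \<open>i \<mapsto> -i\<close> visible.\<close>
definition term_state :: "int \<Rightarrow> nat \<Rightarrow> int" where
  "term_state i k = i * \<beta> (term_index i k)"

lemma term_index: "k < N \<Longrightarrow> term_index i k \<in> {1..N}"
  by (auto simp: term_index_def)

lemma term_state: "k < N \<Longrightarrow> i \<in> {1, -1} \<Longrightarrow> term_state i k \<in> {1, -1}"
  using \<beta>[OF term_index, of k i] by (auto simp: term_state_def)

lemma length_zipper_eqs [simp]: "length (zipper_eqs N S \<beta> i) = N"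
  by (simp add: zipper_eqs_def)

lemma nth_zipper_eqs:
  "k < N \<Longrightarrow> i \<in> {1, -1} \<Longrightarrow> zipper_eqs N S \<beta> i ! k = (S (term_index i k), term_state i k)"
  by (auto simp: zipper_eqs_def term_index_def term_state_def rev_nth Suc_diff_Suc simp del: upt_Suc)

abbreviation "zipper_graph \<equiv> eqs_graph {1, -1} (zipper_eqs N S \<beta>)"
abbreviation "zipper_map \<equiv> eqs_map (zipper_eqs N S \<beta>)"

lemma verts_zipper_graph: "verts zipper_graph = {1, -1}"
  by (simp add: eqs_graph_def)

lemma arcs_zipper_graph: "arcs zipper_graph = {1, -1} \<times> {..<N}"
  by (auto simp: eqs_graph_def)

lemma tail_zipper_graph: "tail zipper_graph = fst"
  by (simp add: eqs_graph_def)

lemma head_zipper_graph: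
  "i \<in> {1, -1} \<Longrightarrow> k < N \<Longrightarrow> head zipper_graph (i, k) = term_state i k"
  by (auto simp: eqs_graph_def nth_zipper_eqs)

lemma zipper_map: "i \<in> {1, -1} \<Longrightarrow> k < N \<Longrightarrow> zipper_map (i, k) = S (term_index i k)"
  by (auto simp: eqs_map_def nth_zipper_eqs)

lemmas zipper_graph_simps = verts_zipper_graph arcs_zipper_graph tail_zipper_graph

sublocale Z: ordered_graph_ifs zipper_graph zipper_map eqs_order
proof unfold_locales
  fix e assume e: "e \<in> arcs zipper_graph"
  then obtain i k where ik: "e = (i, k)" "i \<in> {1, -1}" "k < N" by (auto simp: arcs_zipper_graph)
  show "tail zipper_graph e \<in> verts zipper_graph"
    using ik by (simp add: zipper_graph_simps)
  show "head zipper_graph e \<in> verts zipper_graph"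
    using ik term_state[of k i] head_zipper_graph[of i k] by (simp add: verts_zipper_graph)
  show "contractive_similitude (zipper_map e)"
    using term_index[of k i] ik zipper_map[of i k] r_pos r_less_1 dist_S
    unfolding contractive_similitude_def by auto
next
  show "finite (verts zipper_graph)" "finite (arcs zipper_graph)"
    by (auto simp: zipper_graph_simps)
next
  fix i assume "i \<in> verts zipper_graph"
  then have "(i, 0) \<in> out_arcs zipper_graph i"
    using N by (auto simp: zipper_graph_simps out_arcs_def)
  then show "out_arcs zipper_graph i \<noteq> {}" by blast
next
  fix i
  show "strict_linear_order_on (out_arcs zipper_graph i) eqs_order"
    unfolding strict_linear_order_on_def
  proof (intro conjI)
    show "trans eqs_order" unfolding eqs_order_def trans_def by auto
    show "irrefl eqs_order" unfolding eqs_order_def irrefl_def by auto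
    show "total_on (out_arcs zipper_graph i) eqs_order"
      unfolding eqs_order_def total_on_def out_arcs_def by (auto simp: tail_zipper_graph)
  qed
qed

lemma union_zipper_arcs:
  assumes "i \<in> {1, -1}"
  shows "(\<Union>j\<in>verts zipper_graph. \<Union>e\<in>{e \<in> arcs zipper_graph. tail zipper_graph e = i \<and> head zipper_graph e = j}.
      zipper_map e ` E j) = (\<Union>k<N. S (term_index i k) ` E (term_state i k))" (is "?L = ?R")
proof
  show "?L \<subseteq> ?R"
  proof
    fix z assume "z \<in> ?L"
    then obtain k y where ky: "(i, k) \<in> arcs zipper_graph" "y \<in> E (head zipper_graph (i, k))" "z = zipper_map (i, k) y"
      by (auto simp: tail_zipper_graph)
    then have "k < N" by (simp add: arcs_zipper_graph)
    then show "z \<in> ?R" using ky head_zipper_graph[OF assms] zipper_map[OF assms] by auto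
  qed
  show "?R \<subseteq> ?L"
  proof
    fix z assume "z \<in> ?R"
    then obtain k y where k: "k < N" "y \<in> E (term_state i k)" "z = S (term_index i k) y" by auto
    have "(i, k) \<in> {e \<in> arcs zipper_graph. tail zipper_graph e = i \<and> head zipper_graph e = term_state i k}"
      using k assms head_zipper_graph[OF assms k(1)] by (simp add: zipper_graph_simps)
    moreover have "z \<in> zipper_map (i, k) ` E (term_state i k)"
      using k zipper_map[OF assms k(1)] by simp
    moreover have "term_state i k \<in> verts zipper_graph"
      using term_state[OF k(1) assms] by (simp add: verts_zipper_graph)
    ultimately show "z \<in> ?L" by blast
  qed
qed

lemma term_index_onto: "i \<in> {1, -1} \<Longrightarrow> j \<in> {1..N} \<Longrightarrow> \<exists>k<N. term_index i k = j"
  by (intro exI[of _ "if i = 1 then j - 1 else N - j"]) (auto simp: term_index_def)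

text \<open>Each of the two equations applies every \<open>S\<^sub>j\<close> exactly once, so the constant family \<open>K\<close> solves both.\<close>
lemma invariant_sets_zipper: "Z.invariant_sets = (\<lambda>i. if i \<in> {1, -1} then K else {})"
  unfolding Z.invariant_sets_def
proof (rule the_equality)
  have eq: "K = (\<Union>k<N. S (term_index i k) ` K)" if "i \<in> {1, -1}" for i
  proof -
    have im: "{1..N} = term_index i ` {..<N}" using term_index term_index_onto[OF that] by blast
    have "(\<Union>j\<in>{1..N}. S j ` K) = (\<Union>k<N. S (term_index i k) ` K)"
      unfolding im by simp
    then show ?thesis using K_eq by (rule trans[rotated])
  qed
  let ?E = "\<lambda>i::int. if i \<in> {1, -1} then K else {}"
  show "(\<forall>i\<in>verts zipper_graph. ?E i \<noteq> {} \<and> compact (?E i) \<and>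
        ?E i = (\<Union>j\<in>verts zipper_graph. \<Union>e\<in>{e \<in> arcs zipper_graph. tail zipper_graph e = i \<and> head zipper_graph e = j}. zipper_map e ` ?E j)) \<and>
     (\<forall>i. i \<notin> verts zipper_graph \<longrightarrow> ?E i = {})"
  proof (intro conjI ballI allI impI)
    fix i assume "i \<in> verts zipper_graph"
    then have i: "i \<in> {1, -1}" by (simp add: verts_zipper_graph)
    have "(\<Union>k<N. S (term_index i k) ` ?E (term_state i k)) = (\<Union>k<N. S (term_index i k) ` K)"
      using term_state[OF _ i] by (intro SUP_cong) auto
    then show "?E i = (\<Union>j\<in>verts zipper_graph. \<Union>e\<in>{e \<in> arcs zipper_graph. tail zipper_graph e = i \<and> head zipper_graph e = j}. zipper_map e ` ?E j)"
      unfolding union_zipper_arcs[OF i] using i eq[OF i] by simp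
    show "?E i \<noteq> {}" "compact (?E i)" using i K_nonempty compact_K by auto
  qed (simp add: verts_zipper_graph)
  fix E
  assume A: "(\<forall>i\<in>verts zipper_graph. E i \<noteq> {} \<and> compact (E i) \<and>
        E i = (\<Union>j\<in>verts zipper_graph. \<Union>e\<in>{e \<in> arcs zipper_graph. tail zipper_graph e = i \<and> head zipper_graph e = j}. zipper_map e ` E j)) \<and>
     (\<forall>i. i \<notin> verts zipper_graph \<longrightarrow> E i = {})"
  have E3: "E i = (\<Union>k<N. S (term_index i k) ` E (term_state i k))" if i: "i \<in> {1, -1}" for i
  proof -
    have "i \<in> verts zipper_graph" using i by (simp add: verts_zipper_graph)
    note bspec[OF conjunct1[OF A] this, THEN conjunct2, THEN conjunct2]
    then show ?thesis unfolding union_zipper_arcs[OF i, of E] .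
  qed
  have E12: "E i \<noteq> {}" "compact (E i)" if "i \<in> {1, -1}" for i
    using bspec[OF conjunct1[OF A], of i] that unfolding verts_zipper_graph by fast+
  have E4: "E i = {}" if "i \<notin> {1, -1}" for i
    using conjunct2[OF A] that unfolding verts_zipper_graph by blast
  note E = E12 E3 E4
  have "E i \<subseteq> K" if "i \<in> {1, -1}" for i
  proof (rule contracted_family_subset[of "{1, -1::int}" q E "\<lambda>_. K"])
    fix i x assume i: "i \<in> {1, -1::int}" and "x \<in> E i"
    then obtain k y where k: "k < N" "y \<in> E (term_state i k)" "x = S (term_index i k) y"
      using E(3)[OF i] by blast
    then show "\<exists>k\<in>{1, -1}. \<exists>y\<in>E k. \<exists>f. x = f y \<and> f ` K \<subseteq> K \<and> (\<forall>u v. dist (f u) (f v) \<le> q * dist u v)"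
      using term_state[OF k(1) i] term_index[OF k(1)] dist_S_le S_in_K
      by (intro bexI[of _ "term_state i k"] bexI[of _ y] exI[of _ "S (term_index i k)"]) auto
  qed (use that compact_imp_bounded[OF E12(2)] q_pos q_less_1 K_nonempty compact_K in auto)
  moreover have "K \<subseteq> E i" if "i \<in> {1, -1}" for i
  proof (rule contracted_family_subset[of "{1, -1::int}" q "\<lambda>_. K" E])
    fix i x assume i: "i \<in> {1, -1::int}" and "x \<in> K"
    then obtain k y where k: "k < N" "y \<in> K" "x = S (term_index i k) y"
      using eq[OF i] by blast
    moreover have "S (term_index i k) ` E (term_state i k) \<subseteq> E i" using E(3)[OF i] k(1) by blast
    ultimately show "\<exists>k\<in>{1, -1}. \<exists>y\<in>K. \<exists>f. x = f y \<and> f ` E k \<subseteq> E i \<and> (\<forall>u v. dist (f u) (f v) \<le> q * dist u v)"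
      using term_state[OF k(1) i] term_index[OF k(1)] dist_S_le
      by (intro bexI[of _ "term_state i k"] bexI[of _ y] exI[of _ "S (term_index i k)"]) auto
  qed (use that E12 q_pos q_less_1 compact_imp_bounded[OF compact_K] in auto)
  ultimately have "E i = K" if "i \<in> {1, -1}" for i using that by blast
  then show "E = ?E" using E(4) by (auto simp: fun_eq_iff)
qed

abbreviation walks :: "int \<Rightarrow> nat \<Rightarrow> (int \<times> nat) list set" where
  "walks \<equiv> Z.walks_from"

definition walk_map :: "(int \<times> nat) list \<Rightarrow> 'a \<Rightarrow> 'a" where
  "walk_map p = foldr (\<circ>) (map zipper_map p) id"

abbreviation walk_end :: "int \<Rightarrow> (int \<times> nat) list \<Rightarrow> int" where
  "walk_end \<equiv> Z.awlast"

lemma walks_0: "walks i 0 = (if i \<in> {1, -1} then {[]} else {})"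
  by (auto simp: Z.walks_from_def Z.awalk_Nil_iff verts_zipper_graph)

lemma walks_Suc:
  assumes "i \<in> {1, -1}"
  shows "walks i (Suc n) = {(i, k) # p | k p. k < N \<and> p \<in> walks (term_state i k) n}"
proof (rule set_eqI)
  fix v
  show "v \<in> walks i (Suc n) \<longleftrightarrow> v \<in> {(i, k) # p | k p. k < N \<and> p \<in> walks (term_state i k) n}"
  proof (cases v)
    case (Cons e p)
    obtain j k where e: "e = (j, k)" by (cases e)
    have "v \<in> walks i (Suc n) \<longleftrightarrow> i = j \<and> k < N \<and> length p = n \<and> (\<exists>t. Z.awalk (head zipper_graph (i, k)) p t)"
      using assms unfolding Cons e
      by (auto simp: Z.walks_from_def Z.awalk_Cons_iff zipper_graph_simps)
    then show ?thesis
      using head_zipper_graph[OF assms, of k] unfolding Cons e by (auto simp: Z.walks_from_def)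
  qed (simp add: Z.walks_from_def)
qed

lemma walk_end_Cons: "i \<in> {1, -1} \<Longrightarrow> k < N \<Longrightarrow> walk_end i ((i, k) # p) = walk_end (term_state i k) p"
  by (simp add: head_zipper_graph)

lemma walk_map_Cons: "i \<in> {1, -1} \<Longrightarrow> k < N \<Longrightarrow> walk_map ((i, k) # p) u = S (term_index i k) (walk_map p u)"
  by (simp add: walk_map_def zipper_map)

lemma walk_map_Nil [simp]: "walk_map [] = id"
  by (simp add: walk_map_def)

lemma walk_end_in_states: "p \<in> walks i n \<Longrightarrow> walk_end i p \<in> {1, -1}"
  unfolding Z.walks_from_def using Z.awalk_last_in_verts Z.awlast_if_cas
  by (fastforce simp: Z.awalk_def verts_zipper_graph)

lemma dist_walk_map_le:
  "i \<in> {1, -1} \<Longrightarrow> p \<in> walks i n \<Longrightarrow> dist (walk_map p u) (walk_map p v) \<le> q ^ n * dist u v"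
proof (induction n arbitrary: i p)
  case 0
  then show ?case by (auto simp: walks_0)
next
  case (Suc n)
  then obtain k p' where k: "p = (i, k) # p'" "k < N" "p' \<in> walks (term_state i k) n"
    by (auto simp: walks_Suc)
  have "dist (walk_map p u) (walk_map p v) \<le> q * dist (walk_map p' u) (walk_map p' v)"
    unfolding k(1) walk_map_Cons[OF Suc.prems(1) k(2)] using dist_S_le term_index k(2) by blast
  also have "\<dots> \<le> q * (q ^ n * dist u v)"
    using Suc.IH[OF term_state[OF k(2) Suc.prems(1)] k(3)] q_pos by simp
  finally show ?case by (simp add: mult.assoc)
qed

lemma walks_nonempty: "i \<in> {1, -1} \<Longrightarrow> \<exists>p. p \<in> walks i n"
proof (induction n arbitrary: i)
  case (Suc n)
  have "\<exists>p. p \<in> walks (term_state i 0) n" using N Suc by (intro Suc.IH term_state) auto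
  moreover have "0 < N" using N by simp
  ultimately show ?case unfolding walks_Suc[OF Suc.prems] by blast
qed (simp add: walks_0)

text \<open>\<open>P i\<close> is the point where the state \<open>i\<close> starts, and it has to be the starting point of its first
piece. State \<open>-i\<close> is state \<open>i\<close> in reverse, so the state \<open>i\<close> ends at \<open>P (- i)\<close>. For a zipper,
\<open>P 1 = x\<^sub>0\<close> and \<open>P (-1) = x\<^sub>N\<close>.\<close>
definition vertex_pair :: "(int \<Rightarrow> 'a) \<Rightarrow> bool" where
  "vertex_pair P \<longleftrightarrow> (\<forall>i\<in>{1, -1}. P i = S (term_index i 0) (P (term_state i 0)))"

text \<open>The piece of \<open>j\<close> ends where the piece of \<open>j + 1\<close> starts, in the order of state \<open>1\<close>.\<close>
definition glued :: "(int \<Rightarrow> 'a) \<Rightarrow> bool" where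
  "glued P \<longleftrightarrow> (\<forall>j\<in>{1..<N}. S j (P (- \<beta> j)) = S (Suc j) (P (\<beta> (Suc j))))"

text \<open>The last term of the equation of state \<open>i\<close> is the first term of that of \<open>-i\<close> with reversed sign, so
the condition on starting points for \<open>-i\<close> is the condition on end points for \<open>i\<close>.\<close>
lemma vertex_pair_last:
  assumes "vertex_pair P" "i \<in> {1, -1}"
  shows "S (term_index i (N - 1)) (P (- term_state i (N - 1))) = P (- i)"
proof -
  have "term_index i (N - 1) = term_index (- i) 0"
    using assms(2) N by (auto simp: term_index_def)
  moreover from this have "term_state (- i) 0 = - term_state i (N - 1)"
    by (simp add: term_state_def)
  ultimately show ?thesis using assms unfolding vertex_pair_def by (metis insertE insertI1 insertI2 minus_minus singletonD)
qed

lemma glued_consecutive: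
  assumes "glued P" "i \<in> {1, -1}" "Suc k < N"
  shows "S (term_index i k) (P (- term_state i k)) = S (term_index i (Suc k)) (P (term_state i (Suc k)))"
proof (cases "i = 1")
  case True
  then show ?thesis using assms unfolding glued_def by (auto simp: term_index_def term_state_def)
next
  case False
  then have i: "i = -1" using assms(2) by simp
  define m where "m = N - Suc k"
  have m: "m \<in> {1..<N}" "N - k = Suc m" using assms(3) by (auto simp: m_def)
  then have "S m (P (- \<beta> m)) = S (Suc m) (P (\<beta> (Suc m)))" using assms(1) unfolding glued_def by blast
  then show ?thesis using m(2) by (simp add: i term_index_def term_state_def flip: m_def)
qed

text \<open>The inner vertex \<open>x\<^sub>j\<close> is determined as the end point of the \<open>j\<close>-th piece; that it is also the
starting point of the next piece is the gluing condition.\<close>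
lemma self_similar_zipper_iff: "self_similar_zipper N S \<beta> \<longleftrightarrow> (\<exists>P. vertex_pair P \<and> glued P)"
proof
  assume "self_similar_zipper N S \<beta>"
  then obtain x where x: "\<And>j. j \<in> {1..N} \<Longrightarrow> \<beta> j = 1 \<Longrightarrow> S j (x 0) = x (j - 1) \<and> S j (x N) = x j"
     "\<And>j. j \<in> {1..N} \<Longrightarrow> \<beta> j = -1 \<Longrightarrow> S j (x 0) = x j \<and> S j (x N) = x (j - 1)"
    unfolding self_similar_zipper_def by blast
  define P where "P i = (if i = (1::int) then x 0 else x N)" for i
  have P: "S j (P (\<beta> j)) = x (j - 1)" "S j (P (- \<beta> j)) = x j" if "j \<in> {1..N}" for j
    using \<beta>[OF that] x[OF that] by (auto simp: P_def)
  have "vertex_pair P"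
    using P[of 1] P[of N] N by (auto simp: vertex_pair_def term_index_def term_state_def) (auto simp: P_def)
  moreover have "glued P" unfolding glued_def using P by auto
  ultimately show "\<exists>P. vertex_pair P \<and> glued P" by blast
next
  assume "\<exists>P. vertex_pair P \<and> glued P"
  then obtain P where P: "vertex_pair P" "glued P" by blast
  define x where "x j = (if j = 0 then P 1 else S j (P (- \<beta> j)))" for j
  have x0: "x 0 = P 1" by (simp add: x_def)
  have xN: "x N = P (-1)"
    using vertex_pair_last[OF P(1), of 1] N by (simp add: x_def term_index_def term_state_def)
  have "S j (P (\<beta> j)) = x (j - 1)" if j: "j \<in> {1..N}" for j
  proof (cases "j = 1")
    case True
    then show ?thesis using P(1) by (simp add: vertex_pair_def x_def term_index_def term_state_def)
  next
    case False
    then have "j - 1 \<in> {1..<N}" "Suc (j - 1) = j" using j by auto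
    then show ?thesis using P(2) unfolding glued_def by (metis x_def atLeastLessThan_iff not_one_le_zero)
  qed
  moreover have "S j (P (- \<beta> j)) = x j" if "j \<in> {1..N}" for j using that by (simp add: x_def)
  ultimately have "(\<beta> j = 1 \<longrightarrow> S j (x 0) = x (j - 1) \<and> S j (x N) = x j) \<and>
        (\<beta> j = -1 \<longrightarrow> S j (x 0) = x j \<and> S j (x N) = x (j - 1))" if "j \<in> {1..N}" for j
    using that xN x0 by (metis minus_minus)
  then show "self_similar_zipper N S \<beta>"
    unfolding self_similar_zipper_def by blast
qed

lemma vertex_pair_in_K:
  assumes "vertex_pair P" "i \<in> {1, -1}"
  shows "P i \<in> K"
proof -
  have "(\<lambda>i. {P i}) i \<subseteq> (\<lambda>_. K) i"
  proof (rule contracted_family_subset[of "{1, -1}" q "\<lambda>i. {P i}" "\<lambda>_. K"])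
    fix i :: int and x assume i: "i \<in> {1, -1}" "x \<in> {P i}"
    have N0: "0 < N" using N by simp
    have "x = S (term_index i 0) (P (term_state i 0))"
      using i assms(1) unfolding vertex_pair_def by blast
    moreover have "S (term_index i 0) ` K \<subseteq> K" using S_in_K[OF term_index[OF N0]] by blast
    ultimately show "\<exists>k\<in>{1, -1}. \<exists>y\<in>{P k}. \<exists>f. x = f y \<and> f ` K \<subseteq> K \<and> (\<forall>u v. dist (f u) (f v) \<le> q * dist u v)"
      using term_state[OF N0 i(1)] dist_S_le[OF term_index[OF N0]] by blast
  qed (use assms K_nonempty compact_K q_pos q_less_1 in auto)
  then show ?thesis by simp
qed

text \<open>A maximal walk takes the last edge at each step. So its set, traversed in its order, ends where the
state ends.\<close>
lemma last_point_maximal_walk: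
  assumes P: "vertex_pair P"
  shows "i \<in> {1, -1} \<Longrightarrow> p \<in> walks i n \<Longrightarrow> \<forall>w\<in>walks i n. (p, w) \<notin> lexn eqs_order n \<Longrightarrow>
    walk_map p (P (- walk_end i p)) = P (- i)"
proof (induction n arbitrary: i p)
  case 0
  then show ?case by (auto simp: walks_0)
next
  case (Suc n)
  then obtain k p' where k: "p = (i, k) # p'" "k < N" "p' \<in> walks (term_state i k) n"
    by (auto simp: walks_Suc)
  have len: "length w = n" if "w \<in> walks j n" for w j using that by (simp add: Z.walks_from_def)
  have "k = N - 1"
  proof (rule ccontr)
    assume "k \<noteq> N - 1"
    then have k': "k < N - 1" "N - 1 < N" using k by auto
    obtain w where w: "w \<in> walks (term_state i (N - 1)) n"
      using walks_nonempty[OF term_state[OF k'(2) Suc.prems(1)]] by blast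
    have "(i, N - 1) # w \<in> walks i (Suc n)" using w k' by (auto simp: walks_Suc[OF Suc.prems(1)])
    moreover have "(p, (i, N - 1) # w) \<in> lexn eqs_order (Suc n)"
      unfolding k(1) Cons_in_lexn_iff using len w k k' by (auto simp: eqs_order_def)
    ultimately show False using Suc.prems(3) by blast
  qed
  moreover have "walk_map p' (P (- walk_end (term_state i k) p')) = P (- term_state i k)"
  proof (rule Suc.IH[OF term_state[OF k(2) Suc.prems(1)] k(3)], rule ballI, rule notI)
    fix w assume w: "w \<in> walks (term_state i k) n" "(p', w) \<in> lexn eqs_order n"
    have "(i, k) # w \<in> walks i (Suc n)" using w k by (auto simp: walks_Suc[OF Suc.prems(1)])
    moreover have "(p, (i, k) # w) \<in> lexn eqs_order (Suc n)"
      unfolding k(1) Cons_in_lexn_iff using len w k by auto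
    ultimately show False using Suc.prems(3) by blast
  qed
  ultimately show ?case
    unfolding k(1) walk_map_Cons[OF Suc.prems(1) k(2)] walk_end_Cons[OF Suc.prems(1) k(2)]
    using vertex_pair_last[OF P Suc.prems(1)] by simp
qed

lemma first_point_minimal_walk:
  assumes P: "vertex_pair P"
  shows "i \<in> {1, -1} \<Longrightarrow> p \<in> walks i n \<Longrightarrow> \<forall>w\<in>walks i n. (w, p) \<notin> lexn eqs_order n \<Longrightarrow>
    walk_map p (P (walk_end i p)) = P i"
proof (induction n arbitrary: i p)
  case 0
  then show ?case by (auto simp: walks_0)
next
  case (Suc n)
  then obtain k p' where k: "p = (i, k) # p'" "k < N" "p' \<in> walks (term_state i k) n"
    by (auto simp: walks_Suc)
  have len: "length w = n" if "w \<in> walks j n" for w j using that by (simp add: Z.walks_from_def)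
  have "k = 0"
  proof (rule ccontr)
    assume "k \<noteq> 0"
    then have k': "0 < k" "0 < N" using k by auto
    obtain w where w: "w \<in> walks (term_state i 0) n"
      using walks_nonempty[OF term_state[OF k'(2) Suc.prems(1)]] by blast
    have "(i, 0) # w \<in> walks i (Suc n)" using w k' by (auto simp: walks_Suc[OF Suc.prems(1)])
    moreover have "((i, 0) # w, p) \<in> lexn eqs_order (Suc n)"
      unfolding k(1) Cons_in_lexn_iff using len w k k' by (auto simp: eqs_order_def)
    ultimately show False using Suc.prems(3) by blast
  qed
  moreover have "walk_map p' (P (walk_end (term_state i k) p')) = P (term_state i k)"
  proof (rule Suc.IH[OF term_state[OF k(2) Suc.prems(1)] k(3)], rule ballI, rule notI)
    fix w assume w: "w \<in> walks (term_state i k) n" "(w, p') \<in> lexn eqs_order n"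
    have "(i, k) # w \<in> walks i (Suc n)" using w k by (auto simp: walks_Suc[OF Suc.prems(1)])
    moreover have "((i, k) # w, p) \<in> lexn eqs_order (Suc n)"
      unfolding k(1) Cons_in_lexn_iff using len w k by auto
    ultimately show False using Suc.prems(3) by blast
  qed
  ultimately show ?case
    unfolding k(1) walk_map_Cons[OF Suc.prems(1) k(2)] walk_end_Cons[OF Suc.prems(1) k(2)]
    using P Suc.prems(1) unfolding vertex_pair_def by metis
qed

text \<open>If consecutive walks start with the same edge, their remainders are consecutive as well. Otherwise
the two first edges are consecutive, the remainder of the first walk is maximal and that of the
second is minimal, and the gluing condition applies to the two points in which these remainders end
and start.\<close>
lemma next_walk_points_agree:
  assumes P: "vertex_pair P" "glued P"
  shows "i \<in> {1, -1} \<Longrightarrow> Z.next_walk i n p w \<Longrightarrow>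
    walk_map p (P (- walk_end i p)) = walk_map w (P (walk_end i w))"
proof (induction n arbitrary: i p w)
  case 0
  then show ?case by (auto simp: Z.next_walk_def)
next
  case (Suc n)
  have p: "p \<in> walks i (Suc n)" and w: "w \<in> walks i (Suc n)" and pw: "(p, w) \<in> lexn eqs_order (Suc n)"
    and nothing_between: "\<And>v. v \<in> walks i (Suc n) \<Longrightarrow> (p, v) \<in> lexn eqs_order (Suc n) \<Longrightarrow> (v, w) \<notin> lexn eqs_order (Suc n)"
    using Suc.prems(2) by (auto simp del: lexn.simps simp: Z.next_walk_def)
  have len: "length v = n" if "v \<in> walks j n" for v j using that by (simp add: Z.walks_from_def)
  obtain k p' where k: "p = (i, k) # p'" "k < N" "p' \<in> walks (term_state i k) n"
    using p Suc.prems(1) by (auto simp: walks_Suc)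
  obtain l w' where l: "w = (i, l) # w'" "l < N" "w' \<in> walks (term_state i l) n"
    using w Suc.prems(1) by (auto simp: walks_Suc)
  have *: "(i, m) # v \<in> walks i (Suc n)" if "m < N" "v \<in> walks (term_state i m) n" for m v
    using that by (auto simp: walks_Suc[OF Suc.prems(1)])
  consider "k < l" | "k = l" "(p', w') \<in> lexn eqs_order n"
    using pw unfolding k(1) l(1) Cons_in_lexn_iff by (auto simp: eqs_order_def)
  then show ?case
  proof cases
    case 1
    have "l = Suc k"
    proof (rule ccontr)
      assume "l \<noteq> Suc k"
      then have m: "k < Suc k" "Suc k < l" "Suc k < N" using 1 l by auto
      obtain v where v: "v \<in> walks (term_state i (Suc k)) n"
        using walks_nonempty[OF term_state[OF m(3) Suc.prems(1)]] by blast
      have "(p, (i, Suc k) # v) \<in> lexn eqs_order (Suc n)" "((i, Suc k) # v, w) \<in> lexn eqs_order (Suc n)"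
        unfolding k(1) l(1) Cons_in_lexn_iff using len k l v m by (auto simp: eqs_order_def)
      then show False using nothing_between[OF *[OF m(3) v]] by blast
    qed
    have "walk_map p' (P (- walk_end (term_state i k) p')) = P (- term_state i k)"
    proof (rule last_point_maximal_walk[OF P(1) term_state[OF k(2) Suc.prems(1)] k(3)], rule ballI, rule notI)
      fix v assume v: "v \<in> walks (term_state i k) n" "(p', v) \<in> lexn eqs_order n"
      then have "(p, (i, k) # v) \<in> lexn eqs_order (Suc n)" "((i, k) # v, w) \<in> lexn eqs_order (Suc n)"
        unfolding k(1) l(1) Cons_in_lexn_iff using len k l 1 by (auto simp: eqs_order_def)
      then show False using nothing_between[OF *[OF k(2) v(1)]] by blast
    qed
    moreover have "walk_map w' (P (walk_end (term_state i l) w')) = P (term_state i l)"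
    proof (rule first_point_minimal_walk[OF P(1) term_state[OF l(2) Suc.prems(1)] l(3)], rule ballI, rule notI)
      fix v assume v: "v \<in> walks (term_state i l) n" "(v, w') \<in> lexn eqs_order n"
      then have "(p, (i, l) # v) \<in> lexn eqs_order (Suc n)" "((i, l) # v, w) \<in> lexn eqs_order (Suc n)"
        unfolding k(1) l(1) Cons_in_lexn_iff using len k l 1 by (auto simp: eqs_order_def)
      then show False using nothing_between[OF *[OF l(2) v(1)]] by blast
    qed
    ultimately show ?thesis
      unfolding k(1) l(1) walk_map_Cons[OF Suc.prems(1) k(2)] walk_end_Cons[OF Suc.prems(1) k(2)]
        walk_map_Cons[OF Suc.prems(1) l(2)] walk_end_Cons[OF Suc.prems(1) l(2)]
      using glued_consecutive[OF P(2) Suc.prems(1)] l(2) \<open>l = Suc k\<close> by simp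
  next
    case 2
    have "Z.next_walk (term_state i k) n p' w'"
      unfolding Z.next_walk_def
    proof (intro conjI notI)
      assume "\<exists>v\<in>walks (term_state i k) n. (p', v) \<in> lexn eqs_order n \<and> (v, w') \<in> lexn eqs_order n"
      then obtain v where v: "v \<in> walks (term_state i k) n" "(p', v) \<in> lexn eqs_order n" "(v, w') \<in> lexn eqs_order n"
        by blast
      then have "(p, (i, k) # v) \<in> lexn eqs_order (Suc n)" "((i, k) # v, w) \<in> lexn eqs_order (Suc n)"
        unfolding k(1) l(1) Cons_in_lexn_iff using len k l 2 by auto
      then show False using nothing_between[OF *[OF k(2) v(1)]] by blast
    qed (use k l 2 in auto)
    then have "walk_map p' (P (- walk_end (term_state i k) p')) = walk_map w' (P (walk_end (term_state i k) w'))"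
      by (rule Suc.IH[OF term_state[OF k(2) Suc.prems(1)]])
    then show ?thesis
      unfolding k(1) l(1) 2(1)[symmetric] walk_map_Cons[OF Suc.prems(1) k(2)] walk_end_Cons[OF Suc.prems(1) k(2)]
      by simp
  qed
qed

lemma zipper_imp_linear:
  assumes "vertex_pair P" "glued P"
  shows "linear_eqs {1, -1} (zipper_eqs N S \<beta>)"
  unfolding linear_eqs_def
proof unfold_locales
  fix i n p w assume i: "i \<in> verts zipper_graph" and adj: "Z.adjacent_walks i n p w"
  have *: "Z.walk_set i p \<inter> Z.walk_set i w \<noteq> {}" if "Z.next_walk i n p w" for p w
  proof -
    have i': "i \<in> {1, -1}" using i by (simp add: verts_zipper_graph)
    have ends: "walk_end i p \<in> {1, -1}" "walk_end i w \<in> {1, -1}"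
      using that walk_end_in_states unfolding Z.next_walk_def by blast+
    then have "P (- walk_end i p) \<in> K" "P (walk_end i w) \<in> K"
      by (auto intro!: vertex_pair_in_K[OF assms(1)])
    then have "walk_map p (P (- walk_end i p)) \<in> Z.walk_set i p" "walk_map w (P (walk_end i w)) \<in> Z.walk_set i w"
      unfolding Z.walk_set_def walk_map_def[symmetric] invariant_sets_zipper using ends by auto
    then show ?thesis using next_walk_points_agree[OF assms i' that] by auto
  qed
  show "Z.walk_set i p \<inter> Z.walk_set i w \<noteq> {}"
    using adj *[of p w] *[of w p] unfolding Z.adjacent_walks_def by blast
qed

text \<open>The two equations for \<open>P 1\<close> and \<open>P (-1)\<close> each refer to one of the two unknowns. Depending on the
signs of the first and the last map, they are solved by the fixed points of these maps or of their
composition.\<close>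
lemma exists_vertex_pair: "\<exists>P. vertex_pair P"
proof -
  define f where "f i = S (term_index i 0)" for i
  define h where "h i = term_state i 0" for i
  have N0: "0 < N" using N by simp
  have h: "h i \<in> {1, -1}" if "i \<in> {1, -1}" for i using term_state[OF N0 that] by (simp add: h_def)
  have f: "dist (f i u) (f i v) \<le> q * dist u v" for i u v
    unfolding f_def using dist_S_le[OF term_index[OF N0]] .
  have fix1: "\<exists>u. f i u = u" for i
    using banach_fix_type[of q "f i"] q_pos q_less_1 f by auto
  have fix2: "\<exists>u. f i (f j u) = u" for i j
  proof -
    have "dist (f i (f j u)) (f i (f j v)) \<le> q * dist u v" for u v
    proof -
      have "q * dist (f j u) (f j v) \<le> q * (q * dist u v)" using f q_pos by simp
      also have "\<dots> \<le> q * (1 * dist u v)" using q_pos q_less_1 by (intro mult_left_mono mult_right_mono) auto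
      finally show ?thesis using f[of i "f j u" "f j v"] by simp
    qed
    then show ?thesis using banach_fix_type[of q "\<lambda>u. f i (f j u)"] q_pos q_less_1 by auto
  qed
  have "\<exists>a b. a = f 1 (if h 1 = 1 then a else b) \<and> b = f (-1) (if h (-1) = 1 then a else b)"
  proof (cases "h 1 = 1")
    case True
    obtain a b where "f 1 a = a" "f (-1) b = b" using fix1 by metis
    then show ?thesis using True
      by (cases "h (-1) = 1") (auto intro: exI[of _ a] exI[of _ b])
  next
    case False
    obtain b where b: "f (-1) b = b" using fix1 by metis
    obtain c where c: "f 1 (f (-1) c) = c" using fix2 by metis
    show ?thesis
    proof (cases "h (-1) = 1")
      case True
      then show ?thesis using False c by (intro exI[of _ c] exI[of _ "f (-1) c"]) simp
    next
      case h: False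
      then show ?thesis using False b by (intro exI[of _ "f 1 b"] exI[of _ b]) auto
    qed
  qed
  then obtain a b where ab: "a = f 1 (if h 1 = 1 then a else b)" "b = f (-1) (if h (-1) = 1 then a else b)"
    by blast
  define P where "P i = (if i = (1::int) then a else b)" for i
  have "vertex_pair P"
    unfolding vertex_pair_def using ab by (auto simp: P_def f_def h_def)
  then show ?thesis by blast
qed

text \<open>For \<open>k = 0\<close> and \<open>k = N - 1\<close>, these are the first and the last walk of length \<open>n\<close> that start at \<open>i\<close>.\<close>
fun extreme_walk :: "nat \<Rightarrow> int \<Rightarrow> nat \<Rightarrow> (int \<times> nat) list" where
  "extreme_walk k i 0 = []"
| "extreme_walk k i (Suc n) = (i, k) # extreme_walk k (term_state i k) n"

lemma extreme_walk_in_walks: "i \<in> {1, -1} \<Longrightarrow> k < N \<Longrightarrow> extreme_walk k i n \<in> walks i n"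
proof (induction n arbitrary: i)
  case (Suc n)
  then show ?case using Suc.IH[OF term_state[OF Suc.prems(2,1)]] by (auto simp: walks_Suc)
qed (simp add: walks_0)

lemma no_walk_before_first:
  "i \<in> {1, -1} \<Longrightarrow> w \<in> walks i n \<Longrightarrow> (w, extreme_walk 0 i n) \<notin> lexn eqs_order n"
proof (induction n arbitrary: i w)
  case (Suc n)
  then obtain k w' where k: "w = (i, k) # w'" "k < N" "w' \<in> walks (term_state i k) n"
    by (auto simp: walks_Suc)
  show ?case
    using Suc.IH[OF term_state[OF k(2) Suc.prems(1)] k(3)]
    unfolding k(1) extreme_walk.simps Cons_in_lexn_iff by (auto simp: eqs_order_def)
qed simp

lemma no_walk_after_last:
  "i \<in> {1, -1} \<Longrightarrow> w \<in> walks i n \<Longrightarrow> (extreme_walk (N - 1) i n, w) \<notin> lexn eqs_order n"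
proof (induction n arbitrary: i w)
  case (Suc n)
  then obtain k w' where k: "w = (i, k) # w'" "k < N" "w' \<in> walks (term_state i k) n"
    by (auto simp: walks_Suc)
  show ?case
    using Suc.IH[OF term_state[OF k(2) Suc.prems(1)] k(3)] k(2)
    unfolding k(1) extreme_walk.simps Cons_in_lexn_iff by (auto simp: eqs_order_def)
qed simp

text \<open>The last walk of length \<open>n + 1\<close> through the piece \<open>j\<close> and the first one through the piece \<open>j + 1\<close> are
adjacent. Their sets meet, have diameter at most \<open>q\<^bsup>n + 1\<^esup> diam K\<close>, and contain the two points to be
identified.\<close>
lemma linear_imp_glued:
  assumes lin: "linear_eqs {1, -1} (zipper_eqs N S \<beta>)" and P: "vertex_pair P"
  shows "glued P"
  unfolding glued_def
proof
  fix j assume j: "j \<in> {1..<N}"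
  define k where "k = j - 1"
  have k: "Suc k = j" "k < N" "Suc k < N" using j by (auto simp: k_def)
  have idx: "term_index 1 k = j" "term_index 1 (Suc k) = Suc j" using k by (auto simp: term_index_def)
  have one: "(1::int) \<in> {1, -1}" by simp
  define s t where "s = term_state 1 k" and "t = term_state 1 (Suc k)"
  have st: "s = \<beta> j" "t = \<beta> (Suc j)" using idx by (auto simp: s_def t_def term_state_def)
  have st': "s \<in> {1, -1}" "t \<in> {1, -1}" using term_state k one unfolding s_def t_def by blast+
  interpret L: linear_graph_ifs zipper_graph zipper_map eqs_order
    using lin unfolding linear_eqs_def .
  define D where "D = diameter K"
  have D: "dist u v \<le> D" if "u \<in> K" "v \<in> K" for u v
    unfolding D_def using that compact_imp_bounded[OF compact_K] diameter_bounded_bound by blast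
  have *: "dist (S j (P (- s))) (S (Suc j) (P t)) \<le> q ^ n * (2 * D)" for n
  proof -
    define p w where "p = extreme_walk (N - 1) s n" and "w = extreme_walk 0 t n"
    have p: "p \<in> walks s n" and w: "w \<in> walks t n"
      unfolding p_def w_def using st' k by (auto intro!: extreme_walk_in_walks)
    have len: "length v = n" if "v \<in> walks i n" for v i using that by (simp add: Z.walks_from_def)
    have walks: "(1, k) # p \<in> walks 1 (Suc n)" "(1, Suc k) # w \<in> walks 1 (Suc n)"
      using p w k by (auto simp: walks_Suc[OF one] s_def t_def)
    have "Z.next_walk 1 (Suc n) ((1, k) # p) ((1, Suc k) # w)"
      unfolding Z.next_walk_def
    proof (intro conjI notI walks)
      show "((1, k) # p, (1, Suc k) # w) \<in> lexn eqs_order (Suc n)"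
        unfolding Cons_in_lexn_iff using len p w by (auto simp: eqs_order_def)
      assume "\<exists>v\<in>walks 1 (Suc n). ((1, k) # p, v) \<in> lexn eqs_order (Suc n) \<and> (v, (1, Suc k) # w) \<in> lexn eqs_order (Suc n)"
      then obtain m v where mv: "v \<in> walks (term_state 1 m) n" "m < N"
         "((1, k) # p, (1, m) # v) \<in> lexn eqs_order (Suc n)" "((1, m) # v, (1, Suc k) # w) \<in> lexn eqs_order (Suc n)"
        by (auto simp: walks_Suc[OF one] simp del: lexn.simps)
      have "k < m \<or> k = m \<and> (p, v) \<in> lexn eqs_order n" "m < Suc k \<or> m = Suc k \<and> (v, w) \<in> lexn eqs_order n"
        using mv(3,4) unfolding Cons_in_lexn_iff by (auto simp: eqs_order_def)
      then show False
        using no_walk_after_last[OF st'(1), of v n] no_walk_before_first[OF st'(2), of v n] mv(1)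
        by (auto simp: s_def t_def p_def w_def)
    qed
    then have "Z.walk_set 1 ((1, k) # p) \<inter> Z.walk_set 1 ((1, Suc k) # w) \<noteq> {}"
      by (intro L.linear[of 1 "Suc n"]) (auto simp: verts_zipper_graph Z.adjacent_walks_def)
    moreover have "walk_end 1 ((1, k) # p) \<in> {1, -1}" "walk_end 1 ((1, Suc k) # w) \<in> {1, -1}"
      using walks walk_end_in_states by blast+
    ultimately obtain u v where u: "u \<in> K" and v: "v \<in> K"
      and uv: "walk_map ((1, k) # p) u = walk_map ((1, Suc k) # w) v"
      unfolding Z.walk_set_def walk_map_def[symmetric] invariant_sets_zipper by auto
    have pts: "walk_map p (P (- walk_end s p)) = P (- s)" "walk_map w (P (walk_end t w)) = P t"
      using last_point_maximal_walk[OF P st'(1) p] first_point_minimal_walk[OF P st'(2) w]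
        no_walk_after_last[OF st'(1)] no_walk_before_first[OF st'(2)] by (auto simp: p_def w_def)
    have ends: "- walk_end s p \<in> {1, -1}" "walk_end t w \<in> {1, -1}"
      using walk_end_in_states p w by fastforce+
    have "dist (S j (P (- s))) (walk_map ((1, k) # p) u) \<le> q ^ Suc n * D"
    proof -
      have "S j (P (- s)) = walk_map ((1, k) # p) (P (- walk_end s p))"
        using walk_map_Cons[OF one k(2)] pts idx by simp
      then have "dist (S j (P (- s))) (walk_map ((1, k) # p) u) \<le> q ^ Suc n * dist (P (- walk_end s p)) u"
        using dist_walk_map_le[OF one walks(1)] by metis
      also have "\<dots> \<le> q ^ Suc n * D"
        using D vertex_pair_in_K[OF P ends(1)] u q_pos by (intro mult_left_mono) auto
      finally show ?thesis .
    qed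
    moreover have "dist (walk_map ((1, Suc k) # w) v) (S (Suc j) (P t)) \<le> q ^ Suc n * D"
    proof -
      have "S (Suc j) (P t) = walk_map ((1, Suc k) # w) (P (walk_end t w))"
        using walk_map_Cons[OF one k(3)] pts idx by simp
      then have "dist (walk_map ((1, Suc k) # w) v) (S (Suc j) (P t)) \<le> q ^ Suc n * dist v (P (walk_end t w))"
        using dist_walk_map_le[OF one walks(2)] by metis
      also have "\<dots> \<le> q ^ Suc n * D"
        using D vertex_pair_in_K[OF P ends(2)] v q_pos by (intro mult_left_mono) auto
      finally show ?thesis .
    qed
    ultimately have "dist (S j (P (- s))) (S (Suc j) (P t)) \<le> q ^ Suc n * D + q ^ Suc n * D"
      unfolding uv[symmetric]
      using dist_triangle[of "S j (P (- s))" "S (Suc j) (P t)" "walk_map ((1, k) # p) u"] by linarith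
    also have "\<dots> = q * (q ^ n * (2 * D))" by simp
    also have "\<dots> \<le> 1 * (q ^ n * (2 * D))"
      using q_less_1 q_pos D[OF u u] by (intro mult_right_mono) auto
    finally show ?thesis by simp
  qed
  have "(\<lambda>n. q ^ n * (2 * D)) \<longlonglongrightarrow> 0 * (2 * D)"
    using q_pos q_less_1 by (intro tendsto_intros LIMSEQ_power_zero) auto
  then have "dist (S j (P (- s))) (S (Suc j) (P t)) \<le> 0"
    using * by (intro tendsto_lowerbound) auto
  then show "S j (P (- \<beta> j)) = S (Suc j) (P (\<beta> (Suc j)))" by (simp add: st)
qed

theorem zipper_iff_linear:
  "self_similar_zipper N S \<beta> \<longleftrightarrow> linear_eqs {1, -1} (zipper_eqs N S \<beta>)"
  using self_similar_zipper_iff zipper_imp_linear linear_imp_glued exists_vertex_pair by blast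

end

section \<open>The self-similar parametrization of a zipper\<close>

text \<open>A zipper with vertices \<open>x\<close>, together with the solution \<open>s\<close> of Moran's equation. The two conditions
on the vertices merge the cases of the signature.\<close>
locale zipper_curve = signed_ifs N S r \<beta>
  for N :: nat and S :: "nat \<Rightarrow> 'a::euclidean_space \<Rightarrow> 'a" and r :: "nat \<Rightarrow> real" and \<beta> :: "nat \<Rightarrow> int" +
  fixes x :: "nat \<Rightarrow> 'a" and s :: real
  assumes S_first: "j \<in> {1..N} \<Longrightarrow> S j (if \<beta> j = 1 then x 0 else x N) = x (j - 1)"
    and S_last: "j \<in> {1..N} \<Longrightarrow> S j (if \<beta> j = 1 then x N else x 0) = x j"
    and s_pos: "0 < s" and sum_r_powr: "(\<Sum>j = 1..N. r j powr s) = 1"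
begin

text \<open>The weights \<open>p j\<close> sum up to \<open>1\<close>; the \<open>j\<close>-th child of \<open>[0, 1]\<close> is the interval from \<open>a (j - 1)\<close> to
\<open>a j\<close>, and \<open>\<sigma> j\<close> is its affine parametrization, with the orientation given by the signature. All
these contractions have ratio at most \<open>\<rho>\<close>, and each child has length at least \<open>m\<close>.\<close>
definition p :: "nat \<Rightarrow> real" where "p j = r j powr s"
definition a :: "nat \<Rightarrow> real" where "a k = (\<Sum>j = 1..k. p j)"
definition \<sigma> :: "nat \<Rightarrow> real \<Rightarrow> real" where
  "\<sigma> j u = (if \<beta> j = 1 then a (j - 1) + p j * u else a j - p j * u)"
definition \<rho> :: real where "\<rho> = q powr s"
definition m :: real where "m = Min (p ` {1..N})"

lemma p_pos: "j \<in> {1..N} \<Longrightarrow> 0 < p j"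
  using r_pos[of j] by (simp add: p_def)

lemma p_le: "j \<in> {1..N} \<Longrightarrow> p j \<le> \<rho>"
  unfolding p_def \<rho>_def using r_pos[of j] r_le_q[of j] s_pos by (intro powr_mono2) auto

lemma p_powr: "j \<in> {1..N} \<Longrightarrow> p j powr (1 / s) = r j"
  using r_pos[of j] s_pos by (simp add: p_def powr_powr)

lemma \<rho>_pos: "0 < \<rho>" using q_pos by (simp add: \<rho>_def)

lemma \<rho>_less_1: "\<rho> < 1"
  unfolding \<rho>_def using q_pos q_less_1 s_pos powr_less_mono2[of s q 1] by simp

lemma m_pos: "0 < m" and m_le: "j \<in> {1..N} \<Longrightarrow> m \<le> p j"
proof -
  have "m \<in> p ` {1..N}" unfolding m_def by (intro Min_in) (use N in auto)
  then show "0 < m" using p_pos by auto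
  show "j \<in> {1..N} \<Longrightarrow> m \<le> p j" unfolding m_def by (intro Min_le) auto
qed

lemma a_0 [simp]: "a 0 = 0" and a_N [simp]: "a N = 1"
  using sum_r_powr by (simp_all add: a_def p_def)

lemma a_step: "j \<in> {1..N} \<Longrightarrow> a j = a (j - 1) + p j"
  by (cases j) (auto simp: a_def)

lemma a_gap:
  assumes "i < k" "k \<le> N" shows "a i + m \<le> a k"
proof -
  have "a k = (\<Sum>j\<in>{1..i} \<union> {i<..k}. p j)"
    unfolding a_def using assms by (intro sum.cong) auto
  also have "\<dots> = a i + (\<Sum>j\<in>{i<..k}. p j)"
    unfolding a_def by (rule sum.union_disjoint) auto
  finally have "a k = a i + (\<Sum>j\<in>{i<..k}. p j)" .
  moreover have "p k \<le> (\<Sum>j\<in>{i<..k}. p j)"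
    using assms p_pos by (intro member_le_sum) (auto simp: less_imp_le)
  ultimately show ?thesis using m_le[of k] assms by simp
qed

lemma a_mono: "i \<le> k \<Longrightarrow> k \<le> N \<Longrightarrow> a i \<le> a k"
  using a_gap[of i k] m_pos by (cases "i = k") auto

lemma a_inj: "a i = a k \<Longrightarrow> i \<le> N \<Longrightarrow> k \<le> N \<Longrightarrow> i = k"
  using a_gap[of i k] a_gap[of k i] m_pos by (cases i k rule: linorder_cases) auto

lemma a_bounds: "k \<le> N \<Longrightarrow> 0 \<le> a k \<and> a k \<le> 1"
  using a_mono[of 0 k] a_mono[of k N] by auto

lemma dist_\<sigma>: "j \<in> {1..N} \<Longrightarrow> \<bar>\<sigma> j u - \<sigma> j v\<bar> = p j * \<bar>u - v\<bar>"
  using p_pos[of j] by (auto simp: \<sigma>_def abs_mult abs_minus_commute simp flip: right_diff_distrib)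

lemma \<sigma>_inj: "j \<in> {1..N} \<Longrightarrow> \<sigma> j u = \<sigma> j v \<Longrightarrow> u = v"
  using dist_\<sigma>[of j u v] p_pos[of j] by auto

lemma \<sigma>_bounds: "j \<in> {1..N} \<Longrightarrow> u \<in> {0..1} \<Longrightarrow> a (j - 1) \<le> \<sigma> j u \<and> \<sigma> j u \<le> a j"
  using p_pos[of j] a_step[of j] mult_left_le[of u "p j"] by (auto simp: \<sigma>_def)

lemma \<sigma>_in: "j \<in> {1..N} \<Longrightarrow> u \<in> {0..1} \<Longrightarrow> \<sigma> j u \<in> {0..1}"
  using \<sigma>_bounds[of j u] a_bounds[of j] a_bounds[of "j - 1"] by fastforce

lemma \<sigma>_onto:
  assumes j: "j \<in> {1..N}" and t: "a (j - 1) \<le> t" "t \<le> a j"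
  shows "\<exists>u\<in>{0..1}. \<sigma> j u = t"
  using p_pos[OF j] a_step[OF j] t
  by (intro bexI[of _ "if \<beta> j = 1 then (t - a (j - 1)) / p j else (a j - t) / p j"])
     (auto simp: \<sigma>_def field_simps)

lemma \<sigma>_ends:
  assumes j: "j \<in> {1..N}"
  shows "\<exists>e\<in>{0, 1}. \<sigma> j e = a (j - 1)" "\<exists>e\<in>{0, 1}. \<sigma> j e = a j"
  using a_step[OF j] by (auto simp: \<sigma>_def)

lemma exists_child:
  assumes "t \<in> {0..1}" shows "\<exists>j\<in>{1..N}. \<exists>u\<in>{0..1}. \<sigma> j u = t"
proof -
  define j where "j = (LEAST k. 1 \<le> k \<and> t \<le> a k)"
  have N': "1 \<le> N \<and> t \<le> a N" using assms N by auto
  have j: "1 \<le> j \<and> t \<le> a j" unfolding j_def using N' by (rule LeastI)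
  have jN: "j \<le> N" unfolding j_def using N' by (rule Least_le)
  have "a (j - 1) \<le> t"
  proof (cases "j = 1")
    case False
    then have "\<not> (1 \<le> j - 1 \<and> t \<le> a (j - 1))"
      unfolding j_def by (intro not_less_Least) (use j in \<open>auto simp: j_def\<close>)
    then show ?thesis using False j by auto
  qed (use assms in auto)
  then show ?thesis using \<sigma>_onto[of j t] j jN by auto
qed

text \<open>Two different children share at most an end point \<open>a j\<close>, and there both values equal the vertex \<open>x j\<close>
as soon as \<open>g\<close> joins \<open>x 0\<close> to \<open>x N\<close>.\<close>
lemma child_values_agree:
  assumes ends: "g 0 = x 0" "g 1 = x N"
    and "j \<in> {1..N}" "k \<in> {1..N}" "u \<in> {0..1}" "v \<in> {0..1}" "\<sigma> j u = \<sigma> k v"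
  shows "S j (g u) = S k (g v)"
proof -
  have first: "S j (g u) = x (j - 1)" if j: "j \<in> {1..N}" and u: "\<sigma> j u = a (j - 1)" for j u
  proof -
    have "\<sigma> j (if \<beta> j = 1 then 0 else 1) = a (j - 1)" using a_step[OF j] by (simp add: \<sigma>_def)
    then have "u = (if \<beta> j = 1 then 0 else 1)" using \<sigma>_inj[OF j] u by metis
    then show ?thesis using S_first[OF j] ends by auto
  qed
  have last: "S j (g u) = x j" if j: "j \<in> {1..N}" and u: "\<sigma> j u = a j" for j u
  proof -
    have "\<sigma> j (if \<beta> j = 1 then 1 else 0) = a j" using a_step[OF j] by (simp add: \<sigma>_def)
    then have "u = (if \<beta> j = 1 then 1 else 0)" using \<sigma>_inj[OF j] u by metis
    then show ?thesis using S_last[OF j] ends by auto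
  qed
  have less: "S j (g u) = S k (g v)"
    if jk: "j < k" and "j \<in> {1..N}" "k \<in> {1..N}" "u \<in> {0..1}" "v \<in> {0..1}" "\<sigma> j u = \<sigma> k v" for j k u v
  proof -
    have "\<sigma> j u \<le> a j" "a j \<le> a (k - 1)" "a (k - 1) \<le> \<sigma> k v"
      using \<sigma>_bounds[of j u] \<sigma>_bounds[of k v] that a_mono[of j "k - 1"] by auto
    then have *: "\<sigma> j u = a j" "a j = a (k - 1)" "\<sigma> k v = a (k - 1)" using that by auto
    then have "j = k - 1" using a_inj[of j "k - 1"] that by auto
    then show ?thesis using first[of k v] last[of j u] * that by simp
  qed
  show ?thesis
  proof (cases j k rule: linorder_cases)
    case equal
    then show ?thesis using \<sigma>_inj assms by metis
  qed (use less[of j k u v] less[of k j v u] assms in auto)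
qed

text \<open>The solution is the limit of the iterates of \<open>g \<mapsto> S\<^sub>j \<circ> g \<circ> \<sigma>\<^sub>j\<^sup>-\<^sup>1\<close> on the \<open>j\<close>-th child. They
preserve the values at \<open>0\<close> and \<open>1\<close>, so that overlapping children prescribe the same values, and they
converge uniformly because the maps \<open>S\<^sub>j\<close> contract. The iteration starts with a step function;
the limit will turn out to be continuous as a consequence of its functional equation.\<close>
lemma exists_self_similar_parametrization:
  "\<exists>\<psi>. bounded (\<psi> ` {0..1}) \<and> (\<forall>j\<in>{1..N}. \<forall>u\<in>{0..1}. \<psi> (\<sigma> j u) = S j (\<psi> u))"
proof -
  obtain J \<tau> where J: "\<And>t. t \<in> {0..1} \<Longrightarrow> J t \<in> {1..N} \<and> \<tau> t \<in> {0..1} \<and> \<sigma> (J t) (\<tau> t) = t"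
    using exists_child by metis
  \<comment> \<open>The value at \<open>1\<close> is \<open>x N\<close>, all others are \<open>x 0\<close>; each step uses an arbitrary child that contains \<open>t\<close>.\<close>
  define f where "f = rec_nat (\<lambda>t. if t = 1 then x N else x 0) (\<lambda>_ g t. S (J t) (g (\<tau> t)))"
  have f_0: "f 0 t = (if t = 1 then x N else x 0)" for t by (simp add: f_def)
  have f_Suc: "f (Suc n) t = S (J t) (f n (\<tau> t))" for n t by (simp add: f_def)
  have f_\<sigma>: "f (Suc n) (\<sigma> j u) = S j (f n u)"
    if "f n 0 = x 0" "f n 1 = x N" "j \<in> {1..N}" "u \<in> {0..1}" for n j u
    unfolding f_Suc using child_values_agree[OF that(1,2) _ that(3) _ that(4)] J[OF \<sigma>_in[OF that(3,4)]] by blast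
  have ends: "f n 0 = x 0 \<and> f n 1 = x N" for n
  proof (induction n)
    case (Suc n)
    have j: "1 \<in> {1..N}" "N \<in> {1..N}" using N by auto
    have "\<sigma> 1 (if \<beta> 1 = 1 then 0 else 1) = 0" using a_step[OF j(1)] by (simp add: \<sigma>_def)
    then have "f (Suc n) 0 = x 0"
      using f_\<sigma>[OF _ _ j(1), of n "if \<beta> 1 = 1 then 0 else 1"] S_first[OF j(1)] Suc by (auto split: if_splits)
    moreover have "\<sigma> N (if \<beta> N = 1 then 1 else 0) = 1" using a_step[OF j(2)] by (simp add: \<sigma>_def)
    then have "f (Suc n) 1 = x N"
      using f_\<sigma>[OF _ _ j(2), of n "if \<beta> N = 1 then 1 else 0"] S_last[OF j(2)] Suc by (auto split: if_splits)
    ultimately show ?case by simp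
  qed (simp add: f_0)
  obtain M where M: "0 \<le> M" "\<And>j u. j \<in> {1..N} \<Longrightarrow> norm (u::'a) \<le> M \<Longrightarrow> norm (S j u) \<le> M" "norm (x 0) \<le> M" "norm (x N) \<le> M"
  proof -
    obtain R where R: "0 \<le> R" "\<And>M j u. R \<le> M \<Longrightarrow> j \<in> {1..N} \<Longrightarrow> norm (u::'a) \<le> M \<Longrightarrow> norm (S j u) \<le> M"
      using exists_absorbing_radius by metis
    define M where "M = max R (max (norm (x 0)) (norm (x N)))"
    have "R \<le> M" "norm (x 0) \<le> M" "norm (x N) \<le> M" by (auto simp: M_def)
    then show ?thesis using that[of M] R(1) R(2)[of M] by force
  qed
  have bd: "norm (f n t) \<le> M" if "t \<in> {0..1}" for n t
    using that
  proof (induction n arbitrary: t)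
    case (Suc n)
    then show ?case unfolding f_Suc using M(2) J[OF Suc.prems] by blast
  qed (use M in \<open>auto simp: f_0\<close>)
  have close: "dist (f (n + k) t) (f n t) \<le> q ^ n * (2 * M)" if "t \<in> {0..1}" for n k t
    using that
  proof (induction n arbitrary: t)
    case 0
    have "dist (f k t) (f 0 t) \<le> norm (f k t) + norm (f 0 t)" by (simp add: dist_norm norm_triangle_ineq4)
    then show ?case using bd[OF 0, of k] bd[OF 0, of 0] by simp
  next
    case (Suc n)
    have J': "J t \<in> {1..N}" "\<tau> t \<in> {0..1}" using J[OF Suc.prems] by auto
    have "dist (f (Suc n + k) t) (f (Suc n) t) \<le> q * dist (f (n + k) (\<tau> t)) (f n (\<tau> t))"
      using dist_S_le[OF J'(1)] by (simp add: f_Suc)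
    also have "\<dots> \<le> q * (q ^ n * (2 * M))" using Suc.IH[OF J'(2)] q_pos by simp
    finally show ?case by (simp add: mult.assoc)
  qed
  have lim0: "(\<lambda>n. q ^ n * (2 * M)) \<longlonglongrightarrow> 0"
    using q_pos q_less_1 tendsto_mult[OF LIMSEQ_power_zero tendsto_const, of q "2 * M"] by simp
  have "convergent (\<lambda>n. f n t)" if t: "t \<in> {0..1}" for t
  proof (rule Cauchy_convergent, rule CauchyI')
    fix e :: real assume "0 < e"
    then have "\<forall>\<^sub>F n in sequentially. q ^ n * (2 * M) < e"
      using lim0 by (rule order_tendstoD(2)[rotated])
    then obtain n0 where n0: "\<And>n. n0 \<le> n \<Longrightarrow> q ^ n * (2 * M) < e" unfolding eventually_sequentially by blast
    show "\<exists>n0. \<forall>i\<ge>n0. \<forall>n>i. dist (f i t) (f n t) < e"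
    proof (intro exI[of _ n0] allI impI)
      fix i n assume "n0 \<le> i" "i < n"
      then have "dist (f n t) (f i t) \<le> q ^ i * (2 * M)" using close[OF t, of i "n - i"] by simp
      then show "dist (f i t) (f n t) < e"
        using n0[OF \<open>n0 \<le> i\<close>] by (simp add: dist_commute)
    qed
  qed
  then have "\<forall>t\<in>{0..1}. \<exists>y. (\<lambda>n. f n t) \<longlonglongrightarrow> y" by (simp add: convergent_def)
  then obtain \<psi> where \<psi>: "\<And>t. t \<in> {0..1} \<Longrightarrow> (\<lambda>n. f n t) \<longlonglongrightarrow> \<psi> t" by metis
  show ?thesis
  proof (intro exI[of _ \<psi>] conjI ballI)
    have "norm (\<psi> t) \<le> M" if "t \<in> {0..1}" for t
      using tendsto_norm[OF \<psi>[OF that]] bd[OF that] by (intro tendsto_upperbound) auto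
    then show "bounded (\<psi> ` {0..1})" unfolding bounded_iff by blast
    fix j u assume j: "j \<in> {1..N}" and u: "u \<in> {0..1::real}"
    have "(\<lambda>n. S j (f n u)) \<longlonglongrightarrow> S j (\<psi> u)"
      using continuous_on_tendsto_compose[OF continuous_on_S[OF j, of UNIV] \<psi>[OF u]] by simp
    moreover have "(\<lambda>n. S j (f n u)) \<longlonglongrightarrow> \<psi> (\<sigma> j u)"
      using LIMSEQ_Suc[OF \<psi>[OF \<sigma>_in[OF j u]]] f_\<sigma>[OF _ _ j u] ends by simp
    ultimately show "\<psi> (\<sigma> j u) = S j (\<psi> u)" by (rule LIMSEQ_unique[rotated])
  qed
qed

end

text \<open>Boundedness and the functional equation imply all further properties of \<open>\<psi>\<close>.\<close>
locale zipper_parametrization = zipper_curve N S r \<beta> x s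
  for N :: nat and S :: "nat \<Rightarrow> 'a::euclidean_space \<Rightarrow> 'a" and r \<beta> x s +
  fixes \<psi> :: "real \<Rightarrow> 'a"
  assumes bounded_\<psi>: "bounded (\<psi> ` {0..1})"
    and \<psi>_\<sigma>: "j \<in> {1..N} \<Longrightarrow> u \<in> {0..1} \<Longrightarrow> \<psi> (\<sigma> j u) = S j (\<psi> u)"
begin

definition D :: real where "D = diameter (\<psi> ` {0..1})"

lemma D: "u \<in> {0..1} \<Longrightarrow> v \<in> {0..1} \<Longrightarrow> dist (\<psi> u) (\<psi> v) \<le> D"
  unfolding D_def by (intro diameter_bounded_bound bounded_\<psi>) auto

lemma D_nonneg: "0 \<le> D" using D[of 0 0] by simp

text \<open>The constant for which the Hoelder estimate is trivial for points with distance at least \<open>m\<close>.\<close>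
definition C :: real where "C = D / m powr (1 / s)"

lemma C_nonneg: "0 \<le> C" using D_nonneg by (simp add: C_def)

lemma dist_le_if_far:
  assumes "u \<in> {0..1}" "v \<in> {0..1}" "m \<le> \<bar>u - v\<bar>"
  shows "dist (\<psi> u) (\<psi> v) \<le> C * \<bar>u - v\<bar> powr (1 / s)"
proof -
  have "dist (\<psi> u) (\<psi> v) \<le> C * m powr (1 / s)" using D[OF assms(1,2)] m_pos by (simp add: C_def)
  also have "\<dots> \<le> C * \<bar>u - v\<bar> powr (1 / s)"
    using assms(3) m_pos s_pos C_nonneg by (intro mult_left_mono powr_mono2) auto
  finally show ?thesis .
qed

text \<open>The Hoelder estimate with exponent \<open>1/s\<close> is invariant under the passage to a child, because
\<open>p\<^sub>j\<^bsup>1/s\<^esup> = r\<^sub>j\<close>.\<close>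
lemma dist_scale:
  assumes j: "j \<in> {1..N}" and uv: "u \<in> {0..1}" "v \<in> {0..1}"
    and le: "dist (\<psi> u) (\<psi> v) \<le> c * \<bar>u - v\<bar> powr (1 / s)"
  shows "dist (\<psi> (\<sigma> j u)) (\<psi> (\<sigma> j v)) \<le> c * \<bar>\<sigma> j u - \<sigma> j v\<bar> powr (1 / s)"
proof -
  have "dist (\<psi> (\<sigma> j u)) (\<psi> (\<sigma> j v)) = r j * dist (\<psi> u) (\<psi> v)"
    using \<psi>_\<sigma>[OF j] uv dist_S[OF j] by simp
  also have "\<dots> \<le> r j * (c * \<bar>u - v\<bar> powr (1 / s))" using le r_pos[OF j] by simp
  also have "\<dots> = c * (p j * \<bar>u - v\<bar>) powr (1 / s)"
    using p_powr[OF j] p_pos[OF j] by (simp add: powr_mult)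
  finally show ?thesis unfolding dist_\<sigma>[OF j] .
qed

lemma end_child:
  assumes "e \<in> {0, 1}"
  obtains j e' where "j \<in> {1..N}" "e' \<in> {0, 1}" "\<sigma> j e' = e"
    "\<And>t. t \<in> {0..1} \<Longrightarrow> (\<exists>u\<in>{0..1}. t = \<sigma> j u) \<or> m \<le> \<bar>t - e\<bar>"
proof (cases "e = 0")
  case True
  have j: "1 \<in> {1..N}" using N by simp
  obtain e' where "e' \<in> {0, 1}" "\<sigma> 1 e' = e" using \<sigma>_ends(1)[OF j] True by auto
  moreover have "(\<exists>u\<in>{0..1}. t = \<sigma> 1 u) \<or> m \<le> \<bar>t - e\<bar>" if "t \<in> {0..1}" for t
    using \<sigma>_onto[OF j, of t] a_step[OF j] m_le[OF j] that True by (cases "t \<le> a 1") force+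
  ultimately show ?thesis using that j by blast
next
  case False
  then have e: "e = 1" using assms by simp
  have j: "N \<in> {1..N}" using N by simp
  obtain e' where "e' \<in> {0, 1}" "\<sigma> N e' = e" using \<sigma>_ends(2)[OF j] e by auto
  moreover have "(\<exists>u\<in>{0..1}. t = \<sigma> N u) \<or> m \<le> \<bar>t - e\<bar>" if "t \<in> {0..1}" for t
    using \<sigma>_onto[OF j, of t] a_step[OF j] m_le[OF j] that e by (cases "a (N - 1) \<le> t") force+
  ultimately show ?thesis using that j by blast
qed

lemma exists_level:
  assumes "0 < d" obtains n where "\<rho> ^ n < d"
  using real_arch_pow_inv[OF assms \<rho>_less_1] by blast

text \<open>Induction on the scale: a point close to the end point \<open>e\<close> lies in the same child as \<open>e\<close>, and \<open>e\<close> is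
an end point of that child, too; rescaling increases the distance by the factor \<open>1/\<rho>\<close> at least.\<close>
lemma holder_at_end:
  assumes "t \<in> {0..1}" "e \<in> {0, 1}"
  shows "dist (\<psi> t) (\<psi> e) \<le> C * \<bar>t - e\<bar> powr (1 / s)"
proof (cases "t = e")
  case False
  have "\<rho> ^ n < \<bar>t - e\<bar> \<Longrightarrow> dist (\<psi> t) (\<psi> e) \<le> C * \<bar>t - e\<bar> powr (1 / s)" for n
    using assms
  proof (induction n arbitrary: t e)
    case 0
    then show ?case by auto
  next
    case (Suc n)
    obtain j e' where j: "j \<in> {1..N}" "e' \<in> {0, 1}" "\<sigma> j e' = e"
      and t: "(\<exists>u\<in>{0..1}. t = \<sigma> j u) \<or> m \<le> \<bar>t - e\<bar>"
      using end_child[OF Suc.prems(3)] Suc.prems(2) by metis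
    show ?case
    proof (cases "m \<le> \<bar>t - e\<bar>")
      case True
      then show ?thesis using dist_le_if_far[of t e] Suc.prems by auto
    next
      case False
      then obtain u where u: "u \<in> {0..1}" "t = \<sigma> j u" using t by blast
      have "\<rho> * \<rho> ^ n < p j * \<bar>u - e'\<bar>" using Suc.prems(1) dist_\<sigma>[OF j(1), of u e'] u j by simp
      also have "\<dots> \<le> \<rho> * \<bar>u - e'\<bar>" using p_le[OF j(1)] by (intro mult_right_mono) auto
      finally have "\<rho> ^ n < \<bar>u - e'\<bar>" using \<rho>_pos by simp
      then have "dist (\<psi> u) (\<psi> e') \<le> C * \<bar>u - e'\<bar> powr (1 / s)" using Suc.IH u j by blast
      then show ?thesis using dist_scale[OF j(1) u(1), of e' C] j u by auto
    qed
  qed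
  moreover obtain n where "\<rho> ^ n < \<bar>t - e\<bar>" using exists_level[of "\<bar>t - e\<bar>"] False by auto
  ultimately show ?thesis by blast
qed simp

text \<open>Points in different children are separated by end points of their children. This reduces estimates
for general pairs of points to pairs that contain an end point.\<close>
lemma separate_children:
  assumes "u \<in> {0..1}" "v \<in> {0..1}" "u < v"
  obtains (same) j u' v' where "j \<in> {1..N}" "u' \<in> {0..1}" "v' \<in> {0..1}" "u = \<sigma> j u'" "v = \<sigma> j v'"
  | (different) i j u' v' e e' where "i < j" "i \<in> {1..N}" "j \<in> {1..N}" "u' \<in> {0..1}" "v' \<in> {0..1}"
      "e \<in> {0, 1}" "e' \<in> {0, 1}" "u = \<sigma> i u'" "v = \<sigma> j v'" "\<sigma> i e = a i" "\<sigma> j e' = a (j - 1)"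
      "u \<le> a i" "a i \<le> a (j - 1)" "a (j - 1) \<le> v"
proof -
  obtain i u' where i: "i \<in> {1..N}" "u' \<in> {0..1}" "\<sigma> i u' = u" using exists_child[OF assms(1)] by blast
  obtain j v' where j: "j \<in> {1..N}" "v' \<in> {0..1}" "\<sigma> j v' = v" using exists_child[OF assms(2)] by blast
  show ?thesis
  proof (cases "i = j")
    case True
    then show ?thesis using same i j by blast
  next
    case False
    have "i < j"
    proof (rule ccontr)
      assume "\<not> i < j"
      then have "j \<le> i - 1" using False by auto
      then have "a j \<le> a (i - 1)" using i by (intro a_mono) auto
      then show False using \<sigma>_bounds[OF i(1,2)] \<sigma>_bounds[OF j(1,2)] i j assms(3) by auto
    qed
    moreover have "a i \<le> a (j - 1)" using \<open>i < j\<close> j(1) by (intro a_mono) auto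
    moreover obtain e e' where "e \<in> {0, 1}" "e' \<in> {0, 1}" "\<sigma> i e = a i" "\<sigma> j e' = a (j - 1)"
      using \<sigma>_ends[OF i(1)] \<sigma>_ends[OF j(1)] by blast
    ultimately show ?thesis using different[of i j u' v' e e'] i j \<sigma>_bounds[OF i(1,2)] \<sigma>_bounds[OF j(1,2)] by auto
  qed
qed

text \<open>Within a common child the estimate rescales. Points of different children are joined through the two
separating end points; the three steps account for the factor \<open>3\<close>.\<close>
lemma holder:
  assumes "u \<in> {0..1}" "v \<in> {0..1}"
  shows "dist (\<psi> u) (\<psi> v) \<le> 3 * C * \<bar>u - v\<bar> powr (1 / s)"
proof -
  have ordered: "dist (\<psi> u) (\<psi> v) \<le> 3 * C * \<bar>u - v\<bar> powr (1 / s)"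
    if "\<rho> ^ n < v - u" "u \<in> {0..1}" "v \<in> {0..1}" for u v n
    using that
  proof (induction n arbitrary: u v)
    case 0
    then show ?case by auto
  next
    case (Suc n)
    have "u < v" using Suc.prems(1) \<rho>_pos by (smt (verit) zero_less_power)
    show ?case using Suc.prems(2,3) \<open>u < v\<close>
    proof (cases rule: separate_children)
      case (same j u' v')
      have "\<rho> * \<rho> ^ n < p j * \<bar>u' - v'\<bar>" using Suc.prems(1) dist_\<sigma>[OF same(1), of u' v'] same \<open>u < v\<close> by simp
      also have "\<dots> \<le> \<rho> * \<bar>u' - v'\<bar>" using p_le[OF same(1)] by (intro mult_right_mono) auto
      finally have *: "\<rho> ^ n < \<bar>u' - v'\<bar>" using \<rho>_pos by simp
      have "dist (\<psi> u') (\<psi> v') \<le> 3 * C * \<bar>u' - v'\<bar> powr (1 / s)"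
      proof (cases "u' < v'")
        case True
        then show ?thesis using Suc.IH[of v' u'] * same by simp
      next
        case False
        then have "dist (\<psi> v') (\<psi> u') \<le> 3 * C * \<bar>v' - u'\<bar> powr (1 / s)" using Suc.IH[of u' v'] * same by simp
        then show ?thesis by (simp add: dist_commute abs_minus_commute)
      qed
      then show ?thesis using dist_scale same by simp
    next
      case (different i j u' v' e e')
      have mono: "C * \<bar>b - c\<bar> powr (1 / s) \<le> C * \<bar>u - v\<bar> powr (1 / s)" if "u \<le> b" "b \<le> c" "c \<le> v" for b c
        using that C_nonneg s_pos by (intro mult_left_mono powr_mono2) auto
      have ee: "e \<in> {0..1}" "e' \<in> {0..1}" using different by auto
      have "dist (\<psi> u) (\<psi> (a i)) \<le> C * \<bar>u - a i\<bar> powr (1 / s)"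
        using dist_scale[OF different(2,4) ee(1) holder_at_end[OF different(4,6)]] different by simp
      moreover have "dist (\<psi> (a (j - 1))) (\<psi> v) \<le> C * \<bar>a (j - 1) - v\<bar> powr (1 / s)"
        using dist_scale[OF different(3,5) ee(2) holder_at_end[OF different(5,7)]] different
        by (simp add: dist_commute abs_minus_commute)
      moreover have "dist (\<psi> (a i)) (\<psi> (a (j - 1))) \<le> C * \<bar>a i - a (j - 1)\<bar> powr (1 / s)"
      proof (cases "i = j - 1")
        case False
        then have "a i + m \<le> a (j - 1)" using different by (intro a_gap) auto
        then show ?thesis using different a_bounds[of i] a_bounds[of "j - 1"] by (intro dist_le_if_far) auto
      qed simp
      moreover have "C * \<bar>u - a i\<bar> powr (1 / s) \<le> C * \<bar>u - v\<bar> powr (1 / s)"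
        "C * \<bar>a i - a (j - 1)\<bar> powr (1 / s) \<le> C * \<bar>u - v\<bar> powr (1 / s)"
        "C * \<bar>a (j - 1) - v\<bar> powr (1 / s) \<le> C * \<bar>u - v\<bar> powr (1 / s)"
        using different(12-14) by - (rule mono; linarith)+
      ultimately show ?thesis
        using dist_triangle[of "\<psi> u" "\<psi> v" "\<psi> (a i)"] dist_triangle[of "\<psi> (a i)" "\<psi> v" "\<psi> (a (j - 1))"] by linarith
    qed
  qed
  show ?thesis
  proof (cases u v rule: linorder_cases)
    case less
    then obtain n where "\<rho> ^ n < v - u" using exists_level[of "v - u"] by auto
    then show ?thesis using ordered assms by blast
  next
    case greater
    then obtain n where "\<rho> ^ n < u - v" using exists_level[of "u - v"] by auto
    then have "dist (\<psi> v) (\<psi> u) \<le> 3 * C * \<bar>v - u\<bar> powr (1 / s)" using ordered assms by blast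
    then show ?thesis by (simp add: dist_commute abs_minus_commute)
  qed simp
qed

lemma continuous_\<psi>: "continuous_on {0..1} \<psi>"
  unfolding continuous_on_def
proof
  fix u :: real assume u: "u \<in> {0..1}"
  have "((\<lambda>v. 3 * C * \<bar>v - u\<bar> powr (1 / s)) \<longlongrightarrow> 3 * C * \<bar>u - u\<bar> powr (1 / s)) (at u within {0..1})"
    using s_pos by (intro tendsto_intros) auto
  then have "((\<lambda>v. 3 * C * \<bar>v - u\<bar> powr (1 / s)) \<longlongrightarrow> 0) (at u within {0..1})" by simp
  then show "(\<psi> \<longlongrightarrow> \<psi> u) (at u within {0..1})"
    by (rule metric_tendsto_imp_tendsto[OF _ _ , of _ 0])
       (use holder[OF _ u] C_nonneg in \<open>auto simp: eventually_at_filter abs_mult\<close>)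
qed

lemma \<psi>_image: "\<psi> ` {0..1} = K"
proof (rule K_eqI)
  show "compact (\<psi> ` {0..1})" by (intro compact_continuous_image continuous_\<psi>) simp
  show "\<psi> ` {0..1} = (\<Union>j\<in>{1..N}. S j ` \<psi> ` {0..1})"
  proof
    show "\<psi> ` {0..1} \<subseteq> (\<Union>j\<in>{1..N}. S j ` \<psi> ` {0..1})"
    proof
      fix y assume "y \<in> \<psi> ` {0..1}"
      then obtain t where t: "t \<in> {0..1}" "y = \<psi> t" by blast
      obtain j u where j: "j \<in> {1..N}" "u \<in> {0..1}" "\<sigma> j u = t" using exists_child[OF t(1)] by blast
      then have "y = S j (\<psi> u)" using \<psi>_\<sigma> t by auto
      then show "y \<in> (\<Union>j\<in>{1..N}. S j ` \<psi> ` {0..1})" using j by blast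
    qed
    show "(\<Union>j\<in>{1..N}. S j ` \<psi> ` {0..1}) \<subseteq> \<psi> ` {0..1}"
    proof
      fix y assume "y \<in> (\<Union>j\<in>{1..N}. S j ` \<psi> ` {0..1})"
      then obtain j u where j: "j \<in> {1..N}" "u \<in> {0..1}" "y = S j (\<psi> u)" by blast
      then show "y \<in> \<psi> ` {0..1}" using \<psi>_\<sigma>[OF j(1,2)] \<sigma>_in[OF j(1,2)] by (metis imageI)
    qed
  qed
qed simp

end

section \<open>Hausdorff measure along the parametrization\<close>

text \<open>The images of the \<open>n\<close> intervals of length \<open>1/n\<close> have diameter at most \<open>C n\<^bsup>-1/s\<^esup>\<close>.\<close>
lemma hausdorff_measure_holder_image_finite:
  fixes f :: "real \<Rightarrow> 'a::metric_space"
  assumes s: "0 < s" and C: "0 \<le> C"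
    and f: "\<And>u v. u \<in> {0..1} \<Longrightarrow> v \<in> {0..1} \<Longrightarrow> dist (f u) (f v) \<le> C * \<bar>u - v\<bar> powr (1 / s)"
  shows "hausdorff_measure s (f ` {0..1}) \<le> ennreal (C powr s)"
  unfolding hausdorff_measure_def
proof (rule SUP_least)
  fix \<delta> :: real assume "\<delta> \<in> {0<..}"
  then have \<delta>: "0 < \<delta>" by simp
  have "((\<lambda>n. C * (1 / real n) powr (1 / s)) \<longlongrightarrow> C * 0 powr (1 / s)) sequentially"
    using s by (intro tendsto_intros lim_1_over_n) auto
  then have "\<forall>\<^sub>F n in sequentially. C * (1 / real n) powr (1 / s) < \<delta>"
    using \<delta> by (intro order_tendstoD(2)) auto
  then obtain n where n: "0 < n" "C * (1 / real n) powr (1 / s) < \<delta>"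
    using eventually_gt_at_top[of 0] by (metis (no_types, lifting) eventually_conj eventually_happens sequentially_bot)
  define d where "d = C * (1 / real n) powr (1 / s)"
  define U where "U i = (if i < n then f ` {real i / n..(real i + 1) / n} else {})" for i
  have sub: "{real i / n..(real i + 1) / n} \<subseteq> {0..1}" if "i < n" for i
    using that n(1) by (auto simp: field_simps)
  have dist: "dist y z \<le> d" if "y \<in> U i" "z \<in> U i" for i y z
  proof -
    from that obtain u v where uv: "i < n" "u \<in> {real i / n..(real i + 1) / n}" "v \<in> {real i / n..(real i + 1) / n}"
       "y = f u" "z = f v"
      by (auto simp: U_def split: if_splits)
    have "\<bar>u - v\<bar> \<le> 1 / n" using uv(2,3) by (auto simp: add_divide_distrib)
    then have "C * \<bar>u - v\<bar> powr (1 / s) \<le> d"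
      unfolding d_def using s C by (intro mult_left_mono powr_mono2) auto
    moreover have "u \<in> {0..1}" "v \<in> {0..1}" using sub[OF uv(1)] uv(2,3) by blast+
    ultimately show ?thesis using f[of u v] uv(4,5) by simp
  qed
  have "0 \<le> d" using C by (simp add: d_def)
  have bd: "bounded (U i)" for i unfolding bounded_two_points using dist by blast
  have diam: "diameter (U i) \<le> d" for i
    using \<open>0 \<le> d\<close> dist unfolding diameter_def by (auto intro!: cSUP_least)
  have "f ` {0..1} \<subseteq> (\<Union>i. U i)"
  proof
    fix y assume "y \<in> f ` {0..1}"
    then obtain t where t: "t \<in> {0..1}" "y = f t" by blast
    show "y \<in> (\<Union>i. U i)"
    proof (cases "t = 1")
      case True
      then have "t \<in> {real (n - 1) / n..(real (n - 1) + 1) / n}" using n(1) by (auto simp: field_simps)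
      then show ?thesis using t n(1) by (auto simp: U_def intro!: exI[of _ "n - 1"])
    next
      case False
      define i where "i = nat \<lfloor>t * n\<rfloor>"
      have i: "real i \<le> t * n" "t * n < real i + 1" using t by (auto simp: i_def)
      have "t * real n < 1 * real n" using False t n(1) by (intro mult_strict_right_mono) auto
      then have "i < n" using i(1) by simp
      moreover have "t \<in> {real i / n..(real i + 1) / n}" using i n(1) by (auto simp: field_simps)
      ultimately show ?thesis using t by (auto simp: U_def intro!: exI[of _ i])
    qed
  qed
  then have "hausdorff_premeasure \<delta> s (f ` {0..1}) \<le> (\<Sum>i. ennreal (diam_power s (U i)))"
    using bd order_trans[OF diam] n(2) by (intro hausdorff_premeasure_le) (auto simp: d_def)
  also have "\<dots> = (\<Sum>i<n. ennreal (diam_power s (U i)))"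
    by (rule suminf_finite) (auto simp: U_def)
  also have "\<dots> \<le> (\<Sum>i<n. ennreal (C powr s / n))"
  proof (rule sum_mono)
    fix i
    have "diam_power s (U i) \<le> d powr s"
      using diam[of i] diameter_ge_0[OF bd[of i]] s by (auto simp: diam_power_def intro!: powr_mono2)
    also have "d powr s = C powr s / n"
      using s C n(1) by (simp add: d_def powr_mult powr_powr powr_divide)
    finally show "ennreal (diam_power s (U i)) \<le> ennreal (C powr s / n)" by (rule ennreal_leI)
  qed
  also have "\<dots> = ennreal (C powr s)" using n(1) by (simp add: ennreal_of_nat_eq_real_of_nat flip: ennreal_mult')
  finally show "hausdorff_premeasure \<delta> s (f ` {0..1}) \<le> ennreal (C powr s)" .
qed

text \<open>The set \<open>X\<close> is covered by countably many intervals with disjoint interiors whose union exceeds \<open>X\<close> in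
measure by little; their lengths add up to the measure of the union.\<close>
lemma le_lebesgue_if_le_on_intervals:
  fixes \<mu> :: "real set \<Rightarrow> ennreal"
  assumes mono: "\<And>A B. A \<subseteq> B \<Longrightarrow> \<mu> A \<le> \<mu> B"
    and subadd: "\<And>A :: nat \<Rightarrow> real set. \<mu> (\<Union>n. A n) \<le> (\<Sum>n. \<mu> (A n))"
    and empty: "\<mu> {} = 0"
    and interval: "\<And>u v. 0 \<le> u \<Longrightarrow> u \<le> v \<Longrightarrow> v \<le> 1 \<Longrightarrow> \<mu> {u..v} \<le> ennreal (c * (v - u))"
    and c: "0 \<le> c" and X: "X \<in> sets lebesgue" "X \<subseteq> {0..1}"
  shows "\<mu> X \<le> ennreal c * emeasure lebesgue X"
proof (rule ennreal_le_epsilon)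
  fix e :: real assume e: "0 < e"
  have Xm: "X \<in> lmeasurable"
    using X by (intro bounded_set_imp_lmeasurable bounded_subset[OF compact_imp_bounded[OF compact_Icc] X(2)])
  obtain \<D> where \<D>: "countable \<D>" "\<And>J. J \<in> \<D> \<Longrightarrow> J \<subseteq> cbox 0 1 \<and> J \<noteq> {} \<and> (\<exists>u v. J = cbox u v)"
     "pairwise (\<lambda>A B. interior A \<inter> interior B = {}) \<D>"
     "X \<subseteq> \<Union>\<D>" "\<Union>\<D> \<in> lmeasurable" "measure lebesgue (\<Union>\<D>) \<le> measure lebesgue X + e / (c + 1)"
  proof (rule measurable_outer_intervals_bounded[OF Xm, of 0 1 "e / (c + 1)"])
    show "X \<subseteq> cbox 0 1" using X(2) by simp
    show "0 < e / (c + 1)" using e c by simp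
  qed (rule that)
  define A where "A n = \<Union>{J \<in> \<D>. to_nat_on \<D> J = n}" for n
  have A: "A n = {} \<or> A n \<in> \<D> \<and> to_nat_on \<D> (A n) = n" for n
  proof (cases "\<exists>J\<in>\<D>. to_nat_on \<D> J = n")
    case True
    then obtain J where J: "J \<in> \<D>" "to_nat_on \<D> J = n" by blast
    then have "{J \<in> \<D>. to_nat_on \<D> J = n} = {J}" using to_nat_on_inj[OF \<D>(1)] by auto
    then show ?thesis using J by (simp add: A_def)
  qed (auto simp: A_def)
  have UA: "(\<Union>n. A n) = \<Union>\<D>" by (auto simp: A_def)
  have meas: "emeasure lborel (A n) = emeasure lborel (interior (A n)) \<and> \<mu> (A n) \<le> ennreal c * emeasure lborel (interior (A n))" for n
  proof (cases "A n = {}")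
    case False
    then obtain u v where uv: "A n = {u..v}" "{u..v} \<subseteq> {0..1}" "u \<le> v" using A[of n] \<D>(2)[of "A n"] by auto
    then show ?thesis using interval[of u v] c by (simp add: interior_atLeastAtMost_real ennreal_mult)
  qed (simp add: empty)
  have disj: "disjoint_family (\<lambda>n. interior (A n))"
  proof (unfold disjoint_family_on_def, intro ballI impI)
    fix i k :: nat assume "i \<noteq> k"
    show "interior (A i) \<inter> interior (A k) = {}"
    proof (cases "A i = {} \<or> A k = {}")
      case False
      then have "A i \<in> \<D>" "A k \<in> \<D>" "A i \<noteq> A k" using A[of i] A[of k] \<open>i \<noteq> k\<close> by metis+
      then show ?thesis using \<D>(3) unfolding pairwise_def by blast
    qed auto
  qed
  have "\<mu> X \<le> \<mu> (\<Union>n. A n)" using \<D>(4) UA by (intro mono) auto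
  also have "\<dots> \<le> (\<Sum>n. \<mu> (A n))" by (rule subadd)
  also have "\<dots> \<le> (\<Sum>n. ennreal c * emeasure lborel (interior (A n)))" using meas by (intro suminf_le) auto
  also have "\<dots> = ennreal c * (\<Sum>n. emeasure lborel (interior (A n)))" by simp
  also have "(\<Sum>n. emeasure lborel (interior (A n))) = emeasure lborel (\<Union>n. interior (A n))"
    using disj by (intro suminf_emeasure) auto
  also have "\<dots> = emeasure lebesgue (\<Union>n. interior (A n))" by simp
  also have "ennreal c * \<dots> \<le> ennreal c * emeasure lebesgue (\<Union>\<D>)"
  proof (intro mult_left_mono emeasure_mono)
    show "(\<Union>n. interior (A n)) \<subseteq> \<Union>\<D>" unfolding UA[symmetric] using interior_subset by fast
  qed (use \<D>(5) in \<open>auto simp: fmeasurableD\<close>)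
  also have "\<dots> \<le> ennreal c * ennreal (measure lebesgue X + e / (c + 1))"
    using \<D>(6) \<D>(5) by (intro mult_left_mono) (auto simp: emeasure_eq_measure2 intro: ennreal_leI)
  also have "\<dots> = ennreal (c * (measure lebesgue X + e / (c + 1)))"
    using c e by (intro ennreal_mult[symmetric]) auto
  also have "\<dots> \<le> ennreal (c * measure lebesgue X + e)"
  proof (rule ennreal_leI)
    have "c * (e / (c + 1)) \<le> e" using c e by (simp add: field_simps)
    then show "c * (measure lebesgue X + e / (c + 1)) \<le> c * measure lebesgue X + e"
      by (simp add: distrib_left)
  qed
  also have "\<dots> = ennreal (c * measure lebesgue X) + ennreal e"
    using c e by (intro ennreal_plus) auto
  also have "ennreal (c * measure lebesgue X) = ennreal c * emeasure lebesgue X"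
    using c Xm by (simp add: ennreal_mult emeasure_eq_measure2)
  finally show "\<mu> X \<le> ennreal c * emeasure lebesgue X + ennreal e" .
qed

context zipper_parametrization
begin

abbreviation H :: "real set \<Rightarrow> ennreal" where "H X \<equiv> hausdorff_measure s (\<psi> ` X)"

definition c :: real where "c = enn2real (H {0..1})"

lemma c_nonneg: "0 \<le> c" by (simp add: c_def)

lemma H_unit: "H {0..1} = ennreal c"
proof -
  have "H {0..1} \<le> ennreal ((3 * C) powr s)"
    using holder s_pos C_nonneg by (intro hausdorff_measure_holder_image_finite) auto
  then have "H {0..1} < top" using le_less_trans ennreal_less_top by blast
  then show ?thesis by (simp add: c_def)
qed

lemma H_mono: "X \<subseteq> Y \<Longrightarrow> H X \<le> H Y"
  by (intro hausdorff_measure_mono image_mono)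

lemma H_Un: "H (X \<union> Y) \<le> H X + H Y"
  by (simp add: image_Un hausdorff_measure_Un)

lemma H_le: "X \<subseteq> {0..1} \<Longrightarrow> H X \<le> ennreal c"
  using H_mono[of X "{0..1}"] H_unit by simp

lemma H_finite: "X \<subseteq> {0..1} \<Longrightarrow> H X < top"
  using H_le le_less_trans ennreal_less_top by blast

text \<open>All values of \<open>H\<close> on subsets of \<open>[0, 1]\<close> are finite, so the estimates below can be done in the reals.\<close>
definition h :: "real set \<Rightarrow> real" where "h X = enn2real (H X)"

lemma H_eq_h: "X \<subseteq> {0..1} \<Longrightarrow> H X = ennreal (h X)"
  using H_finite[of X] by (simp add: h_def)

lemma h_nonneg: "0 \<le> h X" by (simp add: h_def)

lemma h_mono: "X \<subseteq> Y \<Longrightarrow> Y \<subseteq> {0..1} \<Longrightarrow> h X \<le> h Y"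
  unfolding h_def using H_mono[of X Y] H_finite[of Y] by (intro enn2real_mono)

lemma h_le: "X \<subseteq> {0..1} \<Longrightarrow> h X \<le> c"
  using H_le[of X] H_eq_h[of X] c_nonneg by simp

lemma h_Un:
  assumes "X \<subseteq> Y \<union> Z" "Y \<subseteq> {0..1}" "Z \<subseteq> {0..1}"
  shows "h X \<le> h Y + h Z"
proof -
  have "h X \<le> h (Y \<union> Z)" using assms by (intro h_mono) auto
  moreover have "ennreal (h (Y \<union> Z)) \<le> ennreal (h Y + h Z)"
    using H_Un[of Y Z] H_eq_h[of Y] H_eq_h[of Z] H_eq_h[of "Y \<union> Z"] assms by (simp add: h_nonneg)
  then have "h (Y \<union> Z) \<le> h Y + h Z" by (simp add: h_nonneg flip: ennreal_plus)
  ultimately show ?thesis by simp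
qed

lemma h_scale:
  assumes j: "j \<in> {1..N}" and X: "X \<subseteq> {0..1}"
  shows "h (\<sigma> j ` X) \<le> p j * h X"
proof -
  have "\<psi> ` \<sigma> j ` X = S j ` \<psi> ` X" using \<psi>_\<sigma>[OF j] X by (force simp: image_image)
  then have "H (\<sigma> j ` X) \<le> ennreal (p j) * H X"
    unfolding p_def using hausdorff_measure_lipschitz_image[of "r j" s "S j" "\<psi> ` X"] r_pos[OF j] s_pos dist_S[OF j] by simp
  moreover have "\<sigma> j ` X \<subseteq> {0..1}" using \<sigma>_in[OF j] X by blast
  ultimately show ?thesis using H_eq_h[of X] H_eq_h[of "\<sigma> j ` X"] X p_pos[OF j] h_nonneg
    by (simp add: less_imp_le flip: ennreal_mult)
qed

lemma segment_\<sigma>: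
  assumes "j \<in> {1..N}"
  shows "closed_segment (\<sigma> j u) (\<sigma> j v) = \<sigma> j ` closed_segment u v"
proof -
  have "\<sigma> j = (\<lambda>t. (if \<beta> j = 1 then a (j - 1) else a j) + (if \<beta> j = 1 then p j else - p j) * t)"
    by (auto simp: \<sigma>_def)
  then show ?thesis
    by (metis (no_types) closed_segment_translation closed_segment_linear_image image_image linear_times)
qed

lemma segment_subset: "u \<in> {0..1} \<Longrightarrow> v \<in> {0..1} \<Longrightarrow> closed_segment u v \<subseteq> {0..1::real}"
  by (auto simp: closed_segment_eq_real_ivl)

text \<open>Estimates of the form \<open>c |u - v| + d\<close> rescale, and the error \<open>d\<close> is multiplied by \<open>p\<^sub>j\<close>. Segments
are used instead of intervals because \<open>\<sigma> j\<close> may reverse the orientation.\<close>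
lemma h_segment_scale:
  assumes j: "j \<in> {1..N}" and uv: "u \<in> {0..1}" "v \<in> {0..1}"
    and le: "h (closed_segment u v) \<le> c * \<bar>u - v\<bar> + d"
  shows "h (closed_segment (\<sigma> j u) (\<sigma> j v)) \<le> c * \<bar>\<sigma> j u - \<sigma> j v\<bar> + p j * d"
proof -
  have "h (closed_segment (\<sigma> j u) (\<sigma> j v)) \<le> p j * h (closed_segment u v)"
    unfolding segment_\<sigma>[OF j] by (rule h_scale[OF j segment_subset[OF uv]])
  also have "\<dots> \<le> p j * (c * \<bar>u - v\<bar> + d)" using le p_pos[OF j] by simp
  finally show ?thesis unfolding dist_\<sigma>[OF j] by (simp add: algebra_simps)
qed

lemma h_child:
  assumes j: "j \<in> {1..N}" shows "h {a (j - 1)..a j} \<le> c * p j"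
proof -
  have "h {a (j - 1)..a j} \<le> h (\<sigma> j ` {0..1})"
    using \<sigma>_onto[OF j] \<sigma>_in[OF j] by (intro h_mono) (force simp: image_iff)+
  also have "\<dots> \<le> p j * h {0..1}" by (rule h_scale[OF j]) simp
  also have "\<dots> = c * p j" by (simp add: h_def c_def)
  finally show ?thesis .
qed

lemma h_singleton: "h {t} = 0"
proof -
  have "hausdorff_premeasure \<delta> s {\<psi> t} \<le> 0" if "0 < \<delta>" for \<delta>
  proof -
    have "hausdorff_premeasure \<delta> s {\<psi> t} \<le> (\<Sum>i::nat. ennreal (diam_power s {\<psi> t}))"
      using that by (intro hausdorff_premeasure_le) auto
    then show ?thesis using s_pos by (simp add: diam_power_def)
  qed
  then have "hausdorff_measure s {\<psi> t} \<le> 0" unfolding hausdorff_measure_def by (intro SUP_least) auto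
  then show ?thesis by (simp add: h_def)
qed

lemma h_children: "i \<le> k \<Longrightarrow> k \<le> N \<Longrightarrow> h {a i..a k} \<le> c * (a k - a i)"
proof (induction k)
  case (Suc k)
  show ?case
  proof (cases "i = Suc k")
    case False
    then have ik: "i \<le> k" using Suc.prems by simp
    have "h {a i..a (Suc k)} \<le> h {a i..a k} + h {a k..a (Suc k)}"
      using a_bounds[of i] a_bounds[of k] a_bounds[of "Suc k"] Suc.prems ik by (intro h_Un) auto
    also have "h {a k..a (Suc k)} \<le> c * p (Suc k)" using h_child[of "Suc k"] Suc.prems by simp
    also have "h {a i..a k} \<le> c * (a k - a i)" using Suc.IH ik Suc.prems by simp
    finally show ?thesis using a_step[of "Suc k"] Suc.prems by (simp add: algebra_simps)
  qed (simp add: h_singleton)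
qed (simp add: h_singleton)

text \<open>A segment that starts at an end point of \<open>[0, 1]\<close> consists of full children and of one partial child,
whose part again starts at an end point of this child. So there is only one error term, and it gains
the factor \<open>\<rho>\<close>.\<close>
lemma h_at_end_approx:
  "t \<in> {0..1} \<Longrightarrow> e \<in> {0, 1} \<Longrightarrow> h (closed_segment e t) \<le> c * \<bar>e - t\<bar> + c * \<rho> ^ n"
proof (induction n arbitrary: t e)
  case 0
  have "h (closed_segment e t) \<le> c" using 0 by (intro h_le segment_subset) auto
  then show ?case using c_nonneg by (simp add: add_increasing)
next
  case (Suc n)
  obtain j u where j: "j \<in> {1..N}" "u \<in> {0..1}" "\<sigma> j u = t" using exists_child[OF Suc.prems(1)] by blast
  have j1: "j - 1 \<le> N" using j(1) by auto
  note b = \<sigma>_bounds[OF j(1,2)]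
  have err: "p j * (c * \<rho> ^ n) \<le> c * \<rho> ^ Suc n"
    using mult_right_mono[OF p_le[OF j(1)], of "c * \<rho> ^ n"] c_nonneg \<rho>_pos by (simp add: algebra_simps)
  have bounds: "0 \<le> a (j - 1)" "a j \<le> 1" "a (j - 1) \<le> 1" "0 \<le> a j"
    using a_bounds[of j] a_bounds[OF j1] j by auto
  show ?case
  proof (cases "e = 0")
    case True
    obtain e' where e': "e' \<in> {0, 1}" "\<sigma> j e' = a (j - 1)" using \<sigma>_ends(1)[OF j(1)] by blast
    have "e' \<in> {0..1}" using e' by auto
    have "h (closed_segment e t) \<le> h {a 0..a (j - 1)} + h (closed_segment (a (j - 1)) t)"
      using True b j bounds Suc.prems(1) by (intro h_Un) (auto simp: closed_segment_eq_real_ivl)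
    also have "h {a 0..a (j - 1)} \<le> c * a (j - 1)" using h_children[of 0 "j - 1"] j1 by simp
    also have "h (closed_segment (a (j - 1)) t) \<le> c * \<bar>a (j - 1) - t\<bar> + p j * (c * \<rho> ^ n)"
      using h_segment_scale[OF j(1) \<open>e' \<in> {0..1}\<close> j(2) Suc.IH[OF j(2) e'(1)]] e' j by simp
    finally show ?thesis using err b j True Suc.prems(1) by (simp add: algebra_simps)
  next
    case False
    then have e: "e = 1" using Suc.prems by simp
    obtain e' where e': "e' \<in> {0, 1}" "\<sigma> j e' = a j" using \<sigma>_ends(2)[OF j(1)] by blast
    have "e' \<in> {0..1}" using e' by auto
    have "h (closed_segment e t) \<le> h {a j..a N} + h (closed_segment (a j) t)"
      using e b j bounds Suc.prems(1) by (intro h_Un) (auto simp: closed_segment_eq_real_ivl)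
    also have "h {a j..a N} \<le> c * (1 - a j)" using h_children[of j N] j by simp
    also have "h (closed_segment (a j) t) \<le> c * \<bar>a j - t\<bar> + p j * (c * \<rho> ^ n)"
      using h_segment_scale[OF j(1) \<open>e' \<in> {0..1}\<close> j(2) Suc.IH[OF j(2) e'(1)]] e' j by simp
    finally show ?thesis using err b j e Suc.prems(1) by (simp add: algebra_simps)
  qed
qed

lemma le_if_le_approx: "(\<And>n. y \<le> z + c * \<rho> ^ n) \<Longrightarrow> y \<le> z"
proof -
  assume *: "\<And>n. y \<le> z + c * \<rho> ^ n"
  have "(\<lambda>n. z + c * \<rho> ^ n) \<longlonglongrightarrow> z + c * 0"
    using \<rho>_pos \<rho>_less_1 by (intro tendsto_intros LIMSEQ_power_zero) auto
  then show "y \<le> z" using * by (intro tendsto_lowerbound[of "\<lambda>n. z + c * \<rho> ^ n" z sequentially]) auto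
qed

lemma h_at_end: "t \<in> {0..1} \<Longrightarrow> e \<in> {0, 1} \<Longrightarrow> h (closed_segment e t) \<le> c * \<bar>e - t\<bar>"
  using h_at_end_approx le_if_le_approx by blast

text \<open>An interval inside one child rescales, and the error gains the factor \<open>\<rho>\<close>. Otherwise it has
parts of two children at its ends, whose two errors together need not be smaller than the original
one; but these parts start at end points of the children, where the exact estimate \<open>h_at_end\<close> leaves no error.\<close>
lemma h_interval_approx:
  "u \<in> {0..1} \<Longrightarrow> v \<in> {0..1} \<Longrightarrow> u < v \<Longrightarrow> h (closed_segment u v) \<le> c * \<bar>u - v\<bar> + c * \<rho> ^ n"
proof (induction n arbitrary: u v)
  case 0
  have "h (closed_segment u v) \<le> c" using 0 by (intro h_le segment_subset) auto
  then show ?case using c_nonneg by (simp add: add_increasing)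
next
  case (Suc n)
  show ?case using Suc.prems
  proof (cases rule: separate_children)
    case (same j u' v')
    have "u' \<noteq> v'" using same Suc.prems by auto
    have "h (closed_segment u' v') \<le> c * \<bar>u' - v'\<bar> + c * \<rho> ^ n"
    proof (cases "u' < v'")
      case False
      then have "h (closed_segment v' u') \<le> c * \<bar>v' - u'\<bar> + c * \<rho> ^ n" using Suc.IH[of v' u'] same \<open>u' \<noteq> v'\<close> by simp
      then show ?thesis by (simp add: closed_segment_commute abs_minus_commute)
    qed (use Suc.IH same in blast)
    then have "h (closed_segment u v) \<le> c * \<bar>u - v\<bar> + p j * (c * \<rho> ^ n)"
      using h_segment_scale[OF same(1-3)] same by simp
    moreover have "p j * (c * \<rho> ^ n) \<le> c * \<rho> ^ Suc n"
      using mult_right_mono[OF p_le[OF same(1)], of "c * \<rho> ^ n"] c_nonneg \<rho>_pos by (simp add: algebra_simps)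
    ultimately show ?thesis by simp
  next
    case (different i j u' v' e e')
    have ee: "e \<in> {0..1}" "e' \<in> {0..1}" using different by auto
    have 1: "h (closed_segment (a i) u) \<le> c * \<bar>a i - u\<bar> + p i * 0"
      using h_segment_scale[OF different(2) ee(1) different(4), of 0] h_at_end[OF different(4,6)] different by simp
    have 2: "h (closed_segment (a (j - 1)) v) \<le> c * \<bar>a (j - 1) - v\<bar> + p j * 0"
      using h_segment_scale[OF different(3) ee(2) different(5), of 0] h_at_end[OF different(5,7)] different by simp
    have 3: "h {a i..a (j - 1)} \<le> c * (a (j - 1) - a i)" using different by (intro h_children) auto
    have bounds: "0 \<le> a i" "a (j - 1) \<le> 1" using a_bounds[of i] a_bounds[of "j - 1"] different by auto
    have "h {a i..v} \<le> h {a i..a (j - 1)} + h (closed_segment (a (j - 1)) v)"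
      using different bounds Suc.prems by (intro h_Un) (auto simp: closed_segment_eq_real_ivl)
    moreover have "h (closed_segment u v) \<le> h (closed_segment (a i) u) + h {a i..v}"
      using different bounds Suc.prems by (intro h_Un) (auto simp: closed_segment_eq_real_ivl)
    ultimately have "h (closed_segment u v) \<le> c * (a i - u) + c * (a (j - 1) - a i) + c * (v - a (j - 1))"
      using 1 2 3 different(12-14) by simp
    also have "\<dots> = c * \<bar>u - v\<bar>" using Suc.prems by (simp add: algebra_simps)
    finally show ?thesis using c_nonneg \<rho>_pos by (simp add: add_increasing2)
  qed
qed

lemma H_interval:
  assumes "0 \<le> u" "u \<le> v" "v \<le> 1" shows "H {u..v} \<le> ennreal (c * (v - u))"
proof -
  have "h {u..v} \<le> c * (v - u)"
  proof (cases "u = v")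
    case False
    then have "h (closed_segment u v) \<le> c * \<bar>u - v\<bar>"
      using assms by - (rule le_if_le_approx, rule h_interval_approx, auto)
    then show ?thesis using assms by (simp add: closed_segment_eq_real_ivl)
  qed (simp add: h_singleton)
  then show ?thesis using assms H_eq_h[of "{u..v}"] by (simp add: ennreal_leI)
qed

lemma H_le_lebesgue:
  assumes "X \<in> sets lebesgue" "X \<subseteq> {0..1}" shows "H X \<le> ennreal c * emeasure lebesgue X"
proof (rule le_lebesgue_if_le_on_intervals[where \<mu> = H])
  show "H (\<Union>n. A n) \<le> (\<Sum>n. H (A n))" for A :: "nat \<Rightarrow> real set"
    unfolding image_UN by (rule hausdorff_measure_countably_subadditive)
qed (use H_mono H_interval c_nonneg assms in auto)

text \<open>The upper bounds for \<open>X\<close> and for its complement add up to \<open>c = H [0, 1]\<close>, which is at most the sum of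
the two values. So neither bound is strict.\<close>
lemma H_eq_lebesgue:
  assumes X: "X \<in> sets lebesgue" "X \<subseteq> {0..1}"
  shows "H X = ennreal c * emeasure lebesgue X"
proof (rule antisym[OF H_le_lebesgue[OF assms]])
  let ?Y = "{0..1} - X"
  have Y: "?Y \<in> sets lebesgue" "?Y \<subseteq> {0..1}" using X by auto
  have "emeasure lebesgue X + emeasure lebesgue ?Y = emeasure lebesgue (X \<union> ?Y)"
    using X Y by (intro plus_emeasure) auto
  also have "X \<union> ?Y = {0..1}" using X by auto
  finally have XY: "emeasure lebesgue X + emeasure lebesgue ?Y = 1" by simp
  have "ennreal c * emeasure lebesgue ?Y + ennreal c * emeasure lebesgue X = ennreal c"
    using XY by (simp add: add.commute flip: distrib_left)
  also have "\<dots> = H (X \<union> ?Y)" using H_unit \<open>X \<union> ?Y = {0..1}\<close> by simp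
  also have "\<dots> \<le> H X + H ?Y" by (rule H_Un)
  also have "\<dots> \<le> H X + ennreal c * emeasure lebesgue ?Y" using H_le_lebesgue[OF Y] by (rule add_left_mono)
  also have "\<dots> = ennreal c * emeasure lebesgue ?Y + H X" by (rule add.commute)
  finally have "ennreal c * emeasure lebesgue ?Y + ennreal c * emeasure lebesgue X \<le> ennreal c * emeasure lebesgue ?Y + H X" .
  moreover have "ennreal c * emeasure lebesgue ?Y < top"
  proof -
    have "emeasure lebesgue ?Y \<le> 1" using XY by (metis add.commute le_iff_add)
    then have "emeasure lebesgue ?Y < top" using ennreal_one_less_top by (rule le_less_trans)
    then show ?thesis by (simp add: ennreal_mult_less_top)
  qed
  ultimately show "ennreal c * emeasure lebesgue X \<le> H X"
    unfolding ennreal_add_left_cancel_le by auto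
qed

lemma vimage_borel:
  assumes "B \<in> sets borel" shows "{t \<in> {0..1}. \<psi> t \<in> B} \<in> sets borel"
proof -
  have "\<psi> \<in> borel_measurable (restrict_space borel {0..1})"
    by (rule borel_measurable_continuous_on_restrict[OF continuous_\<psi>])
  then have "\<psi> -` B \<inter> space (restrict_space borel {0..1}) \<in> sets (restrict_space borel {0..1})"
    using assms by (rule measurable_sets)
  moreover have "\<psi> -` B \<inter> space (restrict_space borel {0..1}) = {t \<in> {0..1}. \<psi> t \<in> B}"
    by (auto simp: space_restrict_space)
  ultimately show ?thesis by (simp add: sets_restrict_space_iff)
qed

lemma hausdorff_eq_lebesgue_vimage:
  assumes "B \<in> sets borel" "B \<subseteq> K"
  shows "hausdorff_measure s B = ennreal c * emeasure lebesgue {t \<in> {0..1}. \<psi> t \<in> B}"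
proof -
  let ?P = "{t \<in> {0..1}. \<psi> t \<in> B}"
  have "\<psi> ` ?P = B" using assms(2) unfolding \<psi>_image[symmetric] by blast
  moreover have "?P \<in> sets lebesgue" "?P \<subseteq> {0..1}" using vimage_borel[OF assms(1)] by auto
  ultimately show ?thesis using H_eq_lebesgue[of ?P] by simp
qed

text \<open>The common part \<open>B\<close> of the two images is the image of a part of \<open>X\<close> and also of a part of \<open>Y\<close>, each
of the same measure as the whole preimage of \<open>B\<close>. As these parts are disjoint, this measure is \<open>0\<close>.\<close>
lemma overlap_null:
  assumes c: "0 < c" and X: "closed X" "X \<subseteq> {0..1}" and Y: "closed Y" "Y \<subseteq> {0..1}" and disj: "X \<inter> Y = {}"
  shows "{t \<in> {0..1}. \<psi> t \<in> \<psi> ` X \<inter> \<psi> ` Y} \<in> null_sets lebesgue"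
proof -
  define B where "B = \<psi> ` X \<inter> \<psi> ` Y"
  define P where "P = {t \<in> {0..1}. \<psi> t \<in> B}"
  have "compact (\<psi> ` Z)" if "closed Z" "Z \<subseteq> {0..1}" for Z
    using that continuous_on_subset[OF continuous_\<psi>]
    by (intro compact_continuous_image) (auto simp: compact_eq_bounded_closed intro: bounded_subset[OF compact_imp_bounded[OF compact_Icc]])
  then have "closed B" using X Y by (auto simp: B_def compact_imp_closed)
  then have B: "B \<in> sets borel" "B \<subseteq> K" using X \<psi>_image by (auto simp: B_def)
  have P: "P \<in> sets borel" using vimage_borel[OF B(1)] by (simp add: P_def)
  have eq: "emeasure lebesgue (P \<inter> Z) = emeasure lebesgue P" if Z: "closed Z" "Z \<subseteq> {0..1}" "B \<subseteq> \<psi> ` Z" for Z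
  proof -
    have "\<psi> ` (P \<inter> Z) = B"
    proof
      show "B \<subseteq> \<psi> ` (P \<inter> Z)"
      proof
        fix y assume y: "y \<in> B"
        then obtain z where "z \<in> Z" "y = \<psi> z" using Z(3) by blast
        then show "y \<in> \<psi> ` (P \<inter> Z)" using y Z(2) unfolding P_def by blast
      qed
    qed (auto simp: P_def)
    moreover have "P \<inter> Z \<in> sets lebesgue" "P \<inter> Z \<subseteq> {0..1}" using P Z by auto
    ultimately have "ennreal c * emeasure lebesgue (P \<inter> Z) = ennreal c * emeasure lebesgue P"
      using H_eq_lebesgue[of "P \<inter> Z"] hausdorff_eq_lebesgue_vimage[OF B] unfolding P_def by metis
    then show ?thesis using c by (simp add: ennreal_mult_cancel_left)
  qed
  have "emeasure lebesgue P + emeasure lebesgue P = emeasure lebesgue (P \<inter> X) + emeasure lebesgue (P \<inter> Y)"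
    using eq[OF X] eq[OF Y] by (simp add: B_def)
  also have "\<dots> = emeasure lebesgue ((P \<inter> X) \<union> (P \<inter> Y))"
    using P X Y disj by (intro plus_emeasure) auto
  also have "\<dots> \<le> emeasure lebesgue P" using P by (intro emeasure_mono) auto
  finally have "emeasure lebesgue P + emeasure lebesgue P \<le> emeasure lebesgue P" .
  moreover have "emeasure lebesgue P < top"
  proof -
    have "emeasure lebesgue P \<le> emeasure lebesgue {0..1::real}" by (intro emeasure_mono) (auto simp: P_def)
    then show ?thesis by (simp add: le_less_trans)
  qed
  ultimately have "emeasure lebesgue P = 0"
    by (cases "emeasure lebesgue P") (auto simp flip: ennreal_plus)
  then show ?thesis using P unfolding P_def[symmetric] B_def[symmetric] by (auto simp: null_sets_def)
qed

text \<open>Two different parameters with the same value are separated by a pair of rational numbers, so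
countably many instances of the preceding lemma suffice.\<close>
lemma non_injective_points_null:
  assumes c: "0 < c"
  shows "{t \<in> {0..1}. \<exists>u\<in>{0..1}. u \<noteq> t \<and> \<psi> u = \<psi> t} \<in> null_sets lebesgue"
proof -
  define V where "V = (\<lambda>(b :: real, d :: real). {t \<in> {0..1}. \<psi> t \<in> \<psi> ` {0..b} \<inter> \<psi> ` {d..1}})"
  define I :: "(real \<times> real) set" where "I = {(b, d). b \<in> \<rat> \<inter> {0..1} \<and> d \<in> \<rat> \<inter> {0..1} \<and> b < d}"
  have "V i \<in> null_sets lebesgue" if "i \<in> I" for i
  proof -
    from that obtain b d where i: "i = (b, d)" "0 \<le> b" "d \<le> 1" "b < d" by (auto simp: I_def)
    have "{t \<in> {0..1}. \<psi> t \<in> \<psi> ` {0..b} \<inter> \<psi> ` {d..1}} \<in> null_sets lebesgue"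
      by (rule overlap_null[OF c]) (use i in auto)
    then show ?thesis by (simp add: V_def i)
  qed
  moreover have "countable I"
    by (rule countable_subset[of _ "\<rat> \<times> \<rat>"]) (auto simp: I_def countable_rat)
  ultimately have null: "(\<Union>i\<in>I. V i) \<in> null_sets lebesgue" by (intro null_sets_UN') auto
  have sep: "\<psi> u = \<psi> t \<Longrightarrow> u < t \<Longrightarrow> u \<in> {0..1} \<Longrightarrow> t \<in> {0..1} \<Longrightarrow> t \<in> (\<Union>i\<in>I. V i) \<and> u \<in> (\<Union>i\<in>I. V i)" for u t
  proof -
    assume ut: "\<psi> u = \<psi> t" "u < t" "u \<in> {0..1}" "t \<in> {0..1}"
    obtain b where b: "b \<in> \<rat>" "u < b" "b < t" using Rats_dense_in_real[OF ut(2)] by blast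
    obtain d where d: "d \<in> \<rat>" "b < d" "d < t" using Rats_dense_in_real[OF b(3)] by blast
    have "(b, d) \<in> I" using b d ut by (auto simp: I_def)
    moreover have "\<psi> t \<in> \<psi> ` {0..b}" using ut b by (auto intro!: image_eqI[of _ _ u])
    moreover have "\<psi> t \<in> \<psi> ` {d..1}" using ut d by auto
    ultimately have "t \<in> V (b, d)" "u \<in> V (b, d)" using ut by (auto simp: V_def)
    then show ?thesis using \<open>(b, d) \<in> I\<close> by blast
  qed
  have "{t \<in> {0..1}. \<exists>u\<in>{0..1}. u \<noteq> t \<and> \<psi> u = \<psi> t} = (\<Union>i\<in>I. V i)"
  proof
    show "{t \<in> {0..1}. \<exists>u\<in>{0..1}. u \<noteq> t \<and> \<psi> u = \<psi> t} \<subseteq> (\<Union>i\<in>I. V i)"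
      using sep by (smt (verit, del_insts) mem_Collect_eq subsetI)
    show "(\<Union>i\<in>I. V i) \<subseteq> {t \<in> {0..1}. \<exists>u\<in>{0..1}. u \<noteq> t \<and> \<psi> u = \<psi> t}"
    proof
      fix t assume "t \<in> (\<Union>i\<in>I. V i)"
      then obtain b d u v where "0 \<le> b" "b < d" "d \<le> 1" "t \<in> {0..1}" "u \<in> {0..b}" "v \<in> {d..1}" "\<psi> t = \<psi> u" "\<psi> t = \<psi> v"
        by (auto simp: I_def V_def)
      then show "t \<in> {t \<in> {0..1}. \<exists>u\<in>{0..1}. u \<noteq> t \<and> \<psi> u = \<psi> t}"
        by (cases "u = t") (auto intro: bexI[of _ u] bexI[of _ v])
    qed
  qed
  then show ?thesis using null by simp
qed

theorem optimal_parametrization: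
  assumes pos: "0 < hausdorff_measure s K"
  shows "optimal_parametrization s K \<psi>"
  unfolding optimal_parametrization_def
proof (intro conjI)
  have HK: "hausdorff_measure s K = ennreal c" using H_unit \<psi>_image by simp
  then have c: "0 < c" using pos by simp
  show "compact K" "0 < s" "0 < hausdorff_measure s K" "\<psi> ` {0..1} = K"
    using compact_K s_pos pos \<psi>_image by auto
  show "hausdorff_measure s K < \<infinity>" by (simp add: HK)
  show "\<forall>X\<in>sets borel. X \<subseteq> {0..1} \<longrightarrow> H X = hausdorff_measure s K * emeasure lebesgue X"
    using H_eq_lebesgue HK by auto
  show "\<forall>B\<in>sets borel. B \<subseteq> K \<longrightarrow>
      emeasure lebesgue {t \<in> {0..1}. \<psi> t \<in> B} = inverse (hausdorff_measure s K) * hausdorff_measure s B"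
  proof (intro ballI impI)
    fix B assume "B \<in> sets (borel :: 'a measure)" "B \<subseteq> K"
    then have "inverse (ennreal c) * hausdorff_measure s B =
        inverse (ennreal c) * ennreal c * emeasure lebesgue {t \<in> {0..1}. \<psi> t \<in> B}"
      using hausdorff_eq_lebesgue_vimage by (simp add: mult.assoc)
    also have "inverse (ennreal c) * ennreal c = 1"
      using c by (simp add: inverse_ennreal flip: ennreal_mult)
    finally show "emeasure lebesgue {t \<in> {0..1}. \<psi> t \<in> B} = inverse (hausdorff_measure s K) * hausdorff_measure s B"
      by (simp add: HK)
  qed
  show "\<exists>c'>0. \<forall>u\<in>{0..1}. \<forall>v\<in>{0..1}. dist (\<psi> u) (\<psi> v) \<le> c' * \<bar>u - v\<bar> powr (1 / s)"
  proof (intro exI[of _ "3 * C + 1"] conjI ballI)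
    fix u v :: real assume "u \<in> {0..1}" "v \<in> {0..1}"
    then have "dist (\<psi> u) (\<psi> v) \<le> 3 * C * \<bar>u - v\<bar> powr (1 / s)" by (rule holder)
    also have "\<dots> \<le> (3 * C + 1) * \<bar>u - v\<bar> powr (1 / s)" by (intro mult_right_mono) auto
    finally show "dist (\<psi> u) (\<psi> v) \<le> (3 * C + 1) * \<bar>u - v\<bar> powr (1 / s)" .
  qed (use C_nonneg in simp)
  define X where "X = {t \<in> {0..1}. \<exists>u\<in>{0..1}. u \<noteq> t \<and> \<psi> u = \<psi> t}"
  have X: "X \<in> null_sets lebesgue" unfolding X_def by (rule non_injective_points_null[OF c])
  have "K - \<psi> ` ({0..1} - X) \<subseteq> \<psi> ` X" using \<psi>_image by auto
  then have "hausdorff_measure s (K - \<psi> ` ({0..1} - X)) \<le> H X" by (rule hausdorff_measure_mono)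
  also have "H X = 0"
  proof -
    have "X \<in> sets lebesgue" "emeasure lebesgue X = 0" using X by (auto simp: null_sets_def)
    moreover have "X \<subseteq> {0..1}" by (auto simp: X_def)
    ultimately show ?thesis using H_eq_lebesgue[of X] by simp
  qed
  finally have "hausdorff_measure s (K - \<psi> ` ({0..1} - X)) = 0" by simp
  moreover have "{0..1} - ({0..1} - X) = X" by (auto simp: X_def)
  moreover have "inj_on \<psi> ({0..1} - X)" by (auto simp: inj_on_def X_def)
  ultimately show "\<exists>F' I'. F' \<subseteq> K \<and> hausdorff_measure s (K - F') = 0 \<and> I' \<subseteq> {0..1} \<and>
      {0..1} - I' \<in> null_sets lebesgue \<and> bij_betw \<psi> I' F'"
    using X \<psi>_image
    by (intro exI[of _ "\<psi> ` ({0..1} - X)"] exI[of _ "{0..1} - X"]) (auto simp: bij_betw_def)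
qed

end

section \<open>Positive measure under the open set condition\<close>

text \<open>A similitude is a linear map up to a translation, and an injective linear map of a finite-dimensional
space is onto.\<close>
lemma
  fixes f :: "'a::euclidean_space \<Rightarrow> 'a"
  assumes r: "0 < r" and f: "\<And>x y. dist (f x) (f y) = r * dist x y"
  shows bij_similitude: "bij f" and similitude_cball_image: "f ` cball x d = cball (f x) (r * d)"
proof -
  have "linear (\<lambda>x. f x - f 0)"
    using f by (intro scaling_linear[where c = r]) (auto simp: dist_norm)
  moreover have inj: "inj f" using f r by (intro injI) (metis dist_eq_0_iff mult_eq_0_iff less_irrefl)
  then have "inj (\<lambda>x. f x - f 0)" by (auto simp: inj_def)
  ultimately have "surj (\<lambda>x. f x - f 0)" by (rule linear_inj_imp_surj)
  then have "surj f" by (metis (no_types, lifting) add_diff_cancel diff_add_cancel surj_def)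
  then show bij: "bij f" using inj by (simp add: bij_def)
  show "f ` cball x d = cball (f x) (r * d)"
  proof
    show "f ` cball x d \<subseteq> cball (f x) (r * d)" using f r by auto
    show "cball (f x) (r * d) \<subseteq> f ` cball x d"
    proof
      fix z assume z: "z \<in> cball (f x) (r * d)"
      obtain y where "z = f y" using \<open>surj f\<close> by blast
      then show "z \<in> f ` cball x d" using z f[of x y] r by simp
    qed
  qed
qed

lemma open_similitude_image:
  fixes f :: "'a::euclidean_space \<Rightarrow> 'a"
  assumes r: "0 < r" and f: "\<And>x y. dist (f x) (f y) = r * dist x y" and X: "open X"
  shows "open (f ` X)"
  unfolding open_contains_cball
proof
  fix z assume "z \<in> f ` X"
  then obtain x where x: "x \<in> X" "z = f x" by blast
  obtain d where d: "0 < d" "cball x d \<subseteq> X" using X x open_contains_cball by blast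
  have "cball z (r * d) \<subseteq> f ` X"
    using image_mono[OF d(2), of f] by (simp add: similitude_cball_image[OF r f] x(2))
  then show "\<exists>e>0. cball z e \<subseteq> f ` X" using r d(1) by (meson mult_pos_pos)
qed

text \<open>Balls are mapped to balls, and by Vitali's theorem an open set is a disjoint union of balls up to a
null set.\<close>
lemma emeasure_similitude_image_ge:
  fixes f :: "'a::euclidean_space \<Rightarrow> 'a"
  assumes r: "0 < r" and f: "\<And>x y. dist (f x) (f y) = r * dist x y" and X: "open X"
  shows "ennreal (r ^ DIM('a)) * emeasure lebesgue X \<le> emeasure lebesgue (f ` X)"
proof -
  define I where "I = {(z, d). 0 < d \<and> cball z d \<subseteq> X}"
  have cov: "\<exists>i. i \<in> I \<and> x \<in> cball (fst i) (snd i) \<and> snd i < e" if "x \<in> X" "0 < e" for x e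
  proof -
    obtain d where d: "0 < d" "cball x d \<subseteq> X" using X \<open>x \<in> X\<close> open_contains_cball by blast
    have "cball x (min d (e / 2)) \<subseteq> X" using d by auto
    then show ?thesis using d that(2)
      by (intro exI[of _ "(x, min d (e / 2))"]) (auto simp: I_def)
  qed
  obtain J where J: "countable J" "J \<subseteq> I"
     "pairwise (\<lambda>i j. disjnt (cball (fst i) (snd i)) (cball (fst j) (snd j))) J"
     "negligible (X - (\<Union>i\<in>J. cball (fst i) (snd i)))"
  proof (rule Vitali_covering_theorem_cballs[of I snd X fst])
    show "0 < snd i" if "i \<in> I" for i using that by (auto simp: I_def)
  qed (rule cov | rule that)+
  let ?B = "\<lambda>i. cball (fst i) (snd i)"
  let ?B' = "\<lambda>i. cball (f (fst i)) (r * snd i)"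
  have disj: "disjoint_family_on ?B J" using J(3) unfolding disjoint_family_on_def pairwise_def disjnt_def by blast
  have B': "?B' i = f ` ?B i" for i using similitude_cball_image[OF r f] by simp
  have inj: "inj f" using bij_similitude[OF r f] bij_def by blast
  have disj': "disjoint_family_on ?B' J"
    using disj inj unfolding B' disjoint_family_on_def by (metis image_Int image_empty)
  have BX: "?B i \<subseteq> X" if "i \<in> J" for i
    using subsetD[OF J(2) that] by (simp add: I_def case_prod_beta)
  have "emeasure lebesgue X \<le> emeasure lebesgue ((\<Union>i\<in>J. ?B i) \<union> (X - (\<Union>i\<in>J. ?B i)))"
    using X J(1) by (intro emeasure_mono sets.Un sets.countable_UN' sets.Diff) auto
  also have "\<dots> = emeasure lebesgue (\<Union>i\<in>J. ?B i)"
    using J(1,4) by (intro emeasure_Un_null_set) (auto simp: negligible_iff_null_sets intro!: sets.countable_UN')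
  also have "\<dots> = (\<integral>\<^sup>+i. emeasure lebesgue (?B i) \<partial>count_space J)"
    using J(1) disj by (intro emeasure_UN_countable) auto
  finally have "ennreal (r ^ DIM('a)) * emeasure lebesgue X \<le> ennreal (r ^ DIM('a)) * (\<integral>\<^sup>+i. emeasure lebesgue (?B i) \<partial>count_space J)"
    by (rule mult_left_mono) simp
  also have "\<dots> = (\<integral>\<^sup>+i. ennreal (r ^ DIM('a)) * emeasure lebesgue (?B i) \<partial>count_space J)"
    by (rule nn_integral_cmult[symmetric]) simp
  also have "\<dots> = (\<integral>\<^sup>+i. emeasure lebesgue (?B' i) \<partial>count_space J)"
  proof (rule nn_integral_cong)
    fix i assume "i \<in> space (count_space J)"
    then have "0 < snd i" using J(2) by (auto simp: I_def)
    then show "ennreal (r ^ DIM('a)) * emeasure lebesgue (?B i) = emeasure lebesgue (?B' i)"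
      using r by (simp add: emeasure_cball power_mult_distrib mult_ac flip: ennreal_mult)
  qed
  also have "\<dots> = emeasure lebesgue (\<Union>i\<in>J. ?B' i)"
    using J(1) disj' by (intro emeasure_UN_countable[symmetric]) auto
  also have "\<dots> \<le> emeasure lebesgue (f ` X)"
  proof (rule emeasure_mono)
    show "(\<Union>i\<in>J. ?B' i) \<subseteq> f ` X" unfolding B' using BX by blast
    show "f ` X \<in> sets lebesgue" using open_similitude_image[OF r f X] by simp
  qed
  finally show ?thesis .
qed

context zipper_parametrization
begin

definition mass :: "'a \<Rightarrow> real \<Rightarrow> ennreal" where
  "mass y \<epsilon> = emeasure lebesgue {t \<in> {0..1}. \<psi> t \<in> cball y \<epsilon>}"

text \<open>The \<open>j\<close>-th child contributes the mass of the preimage of the ball under \<open>S j\<close>, which is a ball of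
radius \<open>\<epsilon> / r j\<close>.\<close>
lemma mass_le_children:
  "\<exists>y. \<forall>j\<in>{1..N}. S j (y j) = z \<and> mass z \<epsilon> \<le> (\<Sum>j=1..N. ennreal (p j) * mass (y j) (\<epsilon> / r j))"
proof -
  have "\<forall>j\<in>{1..N}. \<exists>y. S j y = z"
    using bij_similitude[OF r_pos dist_S] by (metis bij_pointE)
  then obtain y where y: "\<And>j. j \<in> {1..N} \<Longrightarrow> S j (y j) = z" by metis
  let ?P = "\<lambda>y \<epsilon>. {t \<in> {0..1}. \<psi> t \<in> cball y \<epsilon>}"
  have P: "compact (?P y \<epsilon>)" for y \<epsilon>
  proof -
    have "closed ({0..1} \<inter> \<psi> -` cball y \<epsilon>)"
      by (intro continuous_closed_preimage continuous_\<psi>) auto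
    moreover have "{0..1} \<inter> \<psi> -` cball y \<epsilon> = ?P y \<epsilon>" by auto
    ultimately show ?thesis
      by (auto simp: compact_eq_bounded_closed intro: bounded_subset[OF compact_imp_bounded[OF compact_Icc]])
  qed
  have image: "emeasure lebesgue (\<sigma> j ` X) = ennreal (p j) * emeasure lebesgue X"
    and meas: "compact X \<Longrightarrow> \<sigma> j ` X \<in> sets lebesgue" if j: "j \<in> {1..N}" for j X
  proof -
    define k where "k = (if \<beta> j = 1 then p j else - p j)"
    define b where "b = (if \<beta> j = 1 then a (j - 1) else a j)"
    have \<sigma>: "\<sigma> j = (\<lambda>t. k *\<^sub>R t + b)" by (auto simp: \<sigma>_def k_def b_def)
    have "\<bar>k\<bar> = p j" using p_pos[OF j] by (auto simp: k_def)
    then show "emeasure lebesgue (\<sigma> j ` X) = ennreal (p j) * emeasure lebesgue X"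
      unfolding \<sigma> using emeasure_lebesgue_affine[of k b X] by simp
    assume "compact X"
    then have "compact (\<sigma> j ` X)" unfolding \<sigma> by (intro compact_continuous_image continuous_intros)
    then show "\<sigma> j ` X \<in> sets lebesgue" by (simp add: compact_imp_closed)
  qed
  have "?P z \<epsilon> \<subseteq> (\<Union>j\<in>{1..N}. \<sigma> j ` ?P (y j) (\<epsilon> / r j))"
  proof
    fix t assume t: "t \<in> ?P z \<epsilon>"
    then obtain j u where j: "j \<in> {1..N}" "u \<in> {0..1}" "\<sigma> j u = t" using exists_child[of t] by blast
    then have "\<psi> t = S j (\<psi> u)" using \<psi>_\<sigma> by auto
    then have "dist z (\<psi> t) = r j * dist (y j) (\<psi> u)" using dist_S[OF j(1)] y[OF j(1)] by metis
    then have "u \<in> ?P (y j) (\<epsilon> / r j)" using t j(2) r_pos[OF j(1)] by (simp add: field_simps)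
    then show "t \<in> (\<Union>j\<in>{1..N}. \<sigma> j ` ?P (y j) (\<epsilon> / r j))" using j by blast
  qed
  then have "mass z \<epsilon> \<le> emeasure lebesgue (\<Union>j\<in>{1..N}. \<sigma> j ` ?P (y j) (\<epsilon> / r j))"
    unfolding mass_def using meas[OF _ P] by (intro emeasure_mono) auto
  also have "\<dots> \<le> (\<Sum>j=1..N. emeasure lebesgue (\<sigma> j ` ?P (y j) (\<epsilon> / r j)))"
    using meas[OF _ P] by (intro emeasure_subadditive_finite) auto
  also have "\<dots> = (\<Sum>j=1..N. ennreal (p j) * mass (y j) (\<epsilon> / r j))"
    unfolding mass_def using image by (intro sum.cong) auto
  finally show ?thesis using y by blast
qed

text \<open>The mass of a ball of radius \<open>\<epsilon>\<close> scales like \<open>\<epsilon>\<^sup>s\<close> and the volume like \<open>\<epsilon>\<^sup>d\<close>, which explains the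
exponent \<open>s - d\<close>: with it, the inequality for the children is multiplied by exactly the right factor.
The volumes of the parts \<open>S\<^sub>j(V \<inter> \<dots>)\<close> then add up, by disjointness, to at most that of
\<open>V \<inter> B(z, R \<epsilon>)\<close>. The induction stops at radii in \<open>[r0, 1]\<close>, where \<open>V \<inter> B(z, R \<epsilon>)\<close> is all of \<open>V\<close>
whenever the ball meets \<open>K\<close>, and \<open>A\<close> is large enough for the total mass \<open>1\<close>.\<close>
lemma mass_le_volume:
  assumes V: "open V" "\<And>j. j \<in> {1..N} \<Longrightarrow> S j ` V \<subseteq> V" "disjoint_family_on (\<lambda>j. S j ` V) {1..N}"
    and r0: "0 < r0" "\<And>j. j \<in> {1..N} \<Longrightarrow> r0 \<le> r j"
    and R: "0 \<le> R" "\<And>z. K \<inter> cball z 1 \<noteq> {} \<Longrightarrow> V \<subseteq> ball z (R * r0)"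
    and A: "0 \<le> A" "1 \<le> ennreal (A * min 1 (r0 powr (s - DIM('a)))) * emeasure lebesgue V"
    and \<epsilon>: "q ^ n \<le> \<epsilon>" "\<epsilon> \<le> 1"
  shows "mass z \<epsilon> \<le> ennreal (A * \<epsilon> powr (s - DIM('a))) * emeasure lebesgue (V \<inter> ball z (R * \<epsilon>))"
proof -
  have coarse: "mass z \<epsilon> \<le> ennreal (A * \<epsilon> powr (s - DIM('a))) * emeasure lebesgue (V \<inter> ball z (R * \<epsilon>))"
    if \<epsilon>: "r0 \<le> \<epsilon>" "\<epsilon> \<le> 1" for z \<epsilon>
  proof (cases "{t \<in> {0..1}. \<psi> t \<in> cball z \<epsilon>} = {}")
    case True
    then show ?thesis unfolding mass_def by (simp only: emeasure_empty) simp
  next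
    case False
    then have "K \<inter> cball z 1 \<noteq> {}" using \<epsilon> \<psi>_image by fastforce
    then have "V \<subseteq> ball z (R * \<epsilon>)"
      using R(2)[of z] mult_left_mono[OF \<epsilon>(1) R(1)] subset_ball by (meson order_trans)
    then have VV: "V \<inter> ball z (R * \<epsilon>) = V" by blast
    have "min 1 (r0 powr (s - DIM('a))) \<le> \<epsilon> powr (s - DIM('a))"
    proof (cases "0 \<le> s - real DIM('a)")
      case True
      then have "r0 powr (s - DIM('a)) \<le> \<epsilon> powr (s - DIM('a))" using r0 \<epsilon> by (intro powr_mono2) auto
      then show ?thesis by simp
    next
      case False
      then have "1 powr (s - DIM('a)) \<le> \<epsilon> powr (s - DIM('a))" using r0 \<epsilon> by (intro powr_mono2') auto
      then show ?thesis by simp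
    qed
    then have "ennreal (A * min 1 (r0 powr (s - DIM('a)))) \<le> ennreal (A * \<epsilon> powr (s - DIM('a)))"
      using A(1) by (intro ennreal_leI mult_left_mono)
    then have "1 \<le> ennreal (A * \<epsilon> powr (s - DIM('a))) * emeasure lebesgue V"
      using A(2) by (meson mult_right_mono order_trans zero_le)
    moreover have "mass z \<epsilon> \<le> emeasure lebesgue {0..1::real}"
      unfolding mass_def by (intro emeasure_mono) auto
    ultimately show ?thesis unfolding VV by simp
  qed
  show ?thesis using \<epsilon>
  proof (induction n arbitrary: z \<epsilon>)
    case 0
    have "r0 \<le> 1" using r0(2)[of 1] r_less_1[of 1] index_1 by force
    then show ?case using 0 by (intro coarse) auto
  next
    case (Suc n)
    show ?case
    proof (cases "r0 \<le> \<epsilon>")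
      case False
      have \<epsilon>: "0 < \<epsilon>" using Suc.prems(1) q_pos by (meson less_le_trans zero_less_power)
      obtain y where y: "\<And>j. j \<in> {1..N} \<Longrightarrow> S j (y j) = z"
        and le: "mass z \<epsilon> \<le> (\<Sum>j=1..N. ennreal (p j) * mass (y j) (\<epsilon> / r j))"
        using mass_le_children[of z \<epsilon>] index_1 by fastforce
      define W where "W j = V \<inter> ball (y j) (R * (\<epsilon> / r j))" for j
      have W: "open (W j)" for j using V(1) by (auto simp: W_def)
      have SW: "S j ` W j \<subseteq> V \<inter> ball z (R * \<epsilon>)" if j: "j \<in> {1..N}" for j
      proof -
        have "dist z (S j v) < R * \<epsilon>" if "v \<in> W j" for v
          using that dist_S[OF j, of "y j" v] y[OF j] r_pos[OF j] by (simp add: W_def field_simps)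
        then show ?thesis using V(2)[OF j] by (auto simp: W_def)
      qed
      have openSW: "open (S j ` W j)" if "j \<in> {1..N}" for j
        using open_similitude_image[OF r_pos[OF that] dist_S[OF that] W] .
      have child: "ennreal (p j) * mass (y j) (\<epsilon> / r j) \<le> ennreal (A * \<epsilon> powr (s - DIM('a))) * emeasure lebesgue (S j ` W j)"
        if j: "j \<in> {1..N}" for j
      proof -
        have "q ^ n * r j \<le> q ^ n * q" using r_le_q[OF j] q_pos by simp
        also have "\<dots> \<le> \<epsilon>" using Suc.prems(1) by (simp add: mult.commute)
        finally have "q ^ n \<le> \<epsilon> / r j" using r_pos[OF j] by (simp add: field_simps)
        moreover have "\<epsilon> / r j \<le> 1" using False r0(2)[OF j] r_pos[OF j] by simp
        ultimately have "mass (y j) (\<epsilon> / r j) \<le> ennreal (A * (\<epsilon> / r j) powr (s - DIM('a))) * emeasure lebesgue (W j)"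
          unfolding W_def by (rule Suc.IH)
        then have "ennreal (p j) * mass (y j) (\<epsilon> / r j) \<le> ennreal (p j) * (ennreal (A * (\<epsilon> / r j) powr (s - DIM('a))) * emeasure lebesgue (W j))"
          by (rule mult_left_mono) simp
        also have "\<dots> = ennreal (p j * (A * (\<epsilon> / r j) powr (s - DIM('a)))) * emeasure lebesgue (W j)"
          using p_pos[OF j] A(1) by (simp add: ennreal_mult mult.assoc)
        also have "p j * (A * (\<epsilon> / r j) powr (s - DIM('a))) = A * \<epsilon> powr (s - DIM('a)) * r j ^ DIM('a)"
          using r_pos[OF j] \<epsilon> by (simp add: p_def powr_divide powr_diff powr_realpow)
        also have "ennreal (A * \<epsilon> powr (s - DIM('a)) * r j ^ DIM('a)) * emeasure lebesgue (W j) =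
            ennreal (A * \<epsilon> powr (s - DIM('a))) * (ennreal (r j ^ DIM('a)) * emeasure lebesgue (W j))"
          using A(1) r_pos[OF j] by (simp add: ennreal_mult mult.assoc)
        also have "\<dots> \<le> ennreal (A * \<epsilon> powr (s - DIM('a))) * emeasure lebesgue (S j ` W j)"
          by (intro mult_left_mono emeasure_similitude_image_ge[OF r_pos[OF j] dist_S[OF j] W]) simp
        finally show ?thesis .
      qed
      have disj: "disjoint_family_on (\<lambda>j. S j ` W j) {1..N}"
        using V(3) unfolding disjoint_family_on_def W_def by blast
      have "mass z \<epsilon> \<le> (\<Sum>j=1..N. ennreal (A * \<epsilon> powr (s - DIM('a))) * emeasure lebesgue (S j ` W j))"
        using le child by (meson order_trans sum_mono)
      also have "\<dots> = ennreal (A * \<epsilon> powr (s - DIM('a))) * (\<Sum>j=1..N. emeasure lebesgue (S j ` W j))"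
        by (rule sum_distrib_left[symmetric])
      also have "(\<Sum>j=1..N. emeasure lebesgue (S j ` W j)) = emeasure lebesgue (\<Union>j\<in>{1..N}. S j ` W j)"
        using openSW disj by (intro sum_emeasure) auto
      also have "ennreal (A * \<epsilon> powr (s - DIM('a))) * \<dots> \<le>
          ennreal (A * \<epsilon> powr (s - DIM('a))) * emeasure lebesgue (V \<inter> ball z (R * \<epsilon>))"
      proof (intro mult_left_mono emeasure_mono)
        show "(\<Union>j\<in>{1..N}. S j ` W j) \<subseteq> V \<inter> ball z (R * \<epsilon>)" using SW by (rule UN_least)
      qed (use V(1) in auto)
      finally show ?thesis .
    qed (use Suc.prems coarse in blast)
  qed
qed

text \<open>Intersecting the open set \<open>U\<close> with an absorbing ball gives a bounded set \<open>V\<close> of the same kind. Then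
\<open>vol(V \<inter> B(z, R \<epsilon>)) = O(\<epsilon>\<^sup>d)\<close>, so that balls have mass \<open>O(\<epsilon>\<^sup>s)\<close>. Degenerate zippers, with \<open>K\<close> a
single point, are thereby excluded.\<close>
lemma hausdorff_measure_pos:
  assumes "open_set_condition N S"
  shows "0 < hausdorff_measure s K"
proof -
  obtain U where U: "open U" "U \<noteq> {}" "\<And>j. j \<in> {1..N} \<Longrightarrow> S j ` U \<subseteq> U" "disjoint_family_on (\<lambda>j. S j ` U) {1..N}"
    using assms unfolding open_set_condition_def by blast
  obtain u where u: "u \<in> U" using U(2) by blast
  obtain M0 where M0: "0 \<le> M0" "\<And>M j u. M0 \<le> M \<Longrightarrow> j \<in> {1..N} \<Longrightarrow> norm (u::'a) \<le> M \<Longrightarrow> norm (S j u) \<le> M"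
    using exists_absorbing_radius by metis
  \<comment> \<open>Strictly larger than \<open>M0\<close>, so that the open ball is mapped into itself, too; and larger than \<open>norm u\<close>, so that \<open>u\<close> stays in the set.\<close>
  define M where "M = max M0 (norm u) + 1"
  define V where "V = U \<inter> ball 0 M"
  have "open V" "u \<in> V" using U(1) u by (auto simp: V_def M_def)
  have V: "S j ` V \<subseteq> V" if j: "j \<in> {1..N}" for j
  proof -
    have "norm (S j v) < M" if "norm v < M" for v
    proof -
      have "norm (S j v) \<le> max M0 (norm v)" by (rule M0(2)[OF _ j]) auto
      also have "\<dots> < M" using that by (auto simp: M_def)
      finally show ?thesis .
    qed
    then show ?thesis using U(3)[OF j] by (auto simp: V_def)
  qed
  have Vdisj: "disjoint_family_on (\<lambda>j. S j ` V) {1..N}"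
    using U(4) unfolding disjoint_family_on_def V_def by blast
  define r0 where "r0 = Min (r ` {1..N})"
  have r0: "0 < r0" "\<And>j. j \<in> {1..N} \<Longrightarrow> r0 \<le> r j"
  proof -
    have "r0 \<in> r ` {1..N}" unfolding r0_def by (intro Min_in) (use N in auto)
    then show "0 < r0" using r_pos by auto
    show "\<And>j. j \<in> {1..N} \<Longrightarrow> r0 \<le> r j" unfolding r0_def by (intro Min_le) auto
  qed
  obtain B where B: "0 \<le> B" "\<And>y. y \<in> K \<Longrightarrow> norm y \<le> B"
    using compact_imp_bounded[OF compact_K] unfolding bounded_pos by (meson less_imp_le)
  have M: "0 \<le> M" using M0(1) by (simp add: M_def)
  \<comment> \<open>\<open>R * r0\<close> bounds the distance between a point of \<open>V\<close> and a center at distance at most \<open>1\<close> from \<open>K\<close>.\<close>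
  define R where "R = (M + B + 1) / r0"
  have R: "0 \<le> R" using M B(1) r0(1) by (simp add: R_def)
  have VR: "V \<subseteq> ball z (R * r0)" if K: "K \<inter> cball z 1 \<noteq> {}" for z
  proof
    fix v assume "v \<in> V"
    then have v: "norm v < M" by (simp add: V_def)
    obtain y where y: "y \<in> K" "dist z y \<le> 1" using K by auto
    have "dist z v \<le> dist z y + dist y v" by (rule dist_triangle)
    also have "dist y v \<le> norm y + norm v" by (simp add: dist_norm norm_triangle_ineq4)
    finally have "dist z v < R * r0" using v y B(2)[OF y(1)] r0(1) by (simp add: R_def)
    then show "v \<in> ball z (R * r0)" by simp
  qed
  have volV: "0 < emeasure lebesgue V" "emeasure lebesgue V < top"
  proof -
    obtain d where d: "0 < d" "ball u d \<subseteq> V" using \<open>open V\<close> \<open>u \<in> V\<close> open_contains_ball by blast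
    have "0 < emeasure lebesgue (ball u d)" using d(1) by (simp add: emeasure_ball)
    also have "\<dots> \<le> emeasure lebesgue V" using d(2) \<open>open V\<close> by (intro emeasure_mono) auto
    finally show "0 < emeasure lebesgue V" .
    have "emeasure lebesgue V \<le> emeasure lebesgue (ball (0::'a) M)"
      by (intro emeasure_mono) (auto simp: V_def)
    then show "emeasure lebesgue V < top"
      using emeasure_lborel_ball_finite[of "0::'a" M] by (simp add: le_less_trans)
  qed
  define v where "v = enn2real (emeasure lebesgue V)"
  have v: "emeasure lebesgue V = ennreal v" "0 < v"
    using volV by (auto simp: v_def enn2real_positive_iff)
  define A where "A = 1 / (v * min 1 (r0 powr (s - DIM('a))))"
  have A: "0 < A" using v(2) r0(1) by (simp add: A_def)
  have A1: "1 \<le> ennreal (A * min 1 (r0 powr (s - DIM('a)))) * emeasure lebesgue V"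
  proof -
    have "0 < min 1 (r0 powr (s - DIM('a)))" using r0(1) by simp
    then have "A * min 1 (r0 powr (s - DIM('a))) * v = 1"
      unfolding A_def using v(2) by (simp del: min_less_iff_conj)
    then show ?thesis unfolding v(1) using A v(2) r0(1) by (simp flip: ennreal_mult)
  qed
  define C where "C = A * unit_ball_vol DIM('a) * (R + 1) ^ DIM('a)"
  have mass: "mass z \<epsilon> \<le> ennreal (C * \<epsilon> powr s)" if \<epsilon>: "0 < \<epsilon>" "\<epsilon> \<le> 1" for z \<epsilon>
  proof -
    obtain n where "q ^ n \<le> \<epsilon>" using real_arch_pow_inv[OF \<epsilon>(1) q_less_1] by (meson less_imp_le)
    then have "mass z \<epsilon> \<le> ennreal (A * \<epsilon> powr (s - DIM('a))) * emeasure lebesgue (V \<inter> ball z (R * \<epsilon>))"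
      using \<open>open V\<close> V Vdisj r0 R VR A A1 \<epsilon>(2) by (intro mass_le_volume) auto
    also have "\<dots> \<le> ennreal (A * \<epsilon> powr (s - DIM('a))) * emeasure lebesgue (ball z ((R + 1) * \<epsilon>))"
      using \<epsilon> by (intro mult_left_mono emeasure_mono) (auto simp: algebra_simps)
    also have "emeasure lebesgue (ball z ((R + 1) * \<epsilon>)) = ennreal (unit_ball_vol DIM('a) * ((R + 1) * \<epsilon>) ^ DIM('a))"
      using R \<epsilon> by (simp add: emeasure_ball)
    also have "ennreal (A * \<epsilon> powr (s - DIM('a))) * \<dots> = ennreal (A * \<epsilon> powr (s - DIM('a)) * (unit_ball_vol DIM('a) * ((R + 1) * \<epsilon>) ^ DIM('a)))"
      using A by (intro ennreal_mult''[symmetric]) (use R \<epsilon> in auto)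
    also have "A * \<epsilon> powr (s - DIM('a)) * (unit_ball_vol DIM('a) * ((R + 1) * \<epsilon>) ^ DIM('a)) = C * \<epsilon> powr s"
      using \<epsilon> by (simp add: C_def powr_diff powr_realpow power_mult_distrib)
    finally show ?thesis .
  qed
  have vim: "\<psi> -` B \<inter> space (lebesgue_on {0..1}) = {t \<in> {0..1}. \<psi> t \<in> B}" for B by auto
  have sets: "{t \<in> {0..1}. \<psi> t \<in> B} \<in> sets (lebesgue_on {0..1})"
    and emeas: "emeasure (lebesgue_on {0..1}) {t \<in> {0..1}. \<psi> t \<in> B} = emeasure lebesgue {t \<in> {0..1}. \<psi> t \<in> B}"
    if "B \<in> sets borel" for B
  proof -
    have *: "{t \<in> {0..1}. \<psi> t \<in> B} \<in> sets borel" by (rule vimage_borel[OF that])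
    then show "{t \<in> {0..1}. \<psi> t \<in> B} \<in> sets (lebesgue_on {0..1})"
      by (auto simp: sets_restrict_space_iff)
    show "emeasure (lebesgue_on {0..1}) {t \<in> {0..1}. \<psi> t \<in> B} = emeasure lebesgue {t \<in> {0..1}. \<psi> t \<in> B}"
      using * by (intro emeasure_restrict_space) auto
  qed
  have K1: "{t \<in> {0..1}. \<psi> t \<in> K} = {0..1}" using \<psi>_image by auto
  have KB: "K \<in> sets borel" using compact_K by (simp add: compact_imp_closed)
  show ?thesis
  proof (rule hausdorff_measure_pos_mass_distribution[of s C "lebesgue_on {0..1}" \<psi> K])
    show "0 < C" using A R by (simp add: C_def)
    show "0 < emeasure (lebesgue_on {0..1}) (\<psi> -` K \<inter> space (lebesgue_on {0..1}))"
      using emeas[OF KB] unfolding vim K1 by simp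
    show "\<psi> -` K \<inter> space (lebesgue_on {0..1}) \<in> sets (lebesgue_on {0..1})"
      unfolding vim by (rule sets[OF KB])
    show "\<psi> -` cball z \<epsilon> \<inter> space (lebesgue_on {0..1}) \<in> sets (lebesgue_on {0..1})" for z \<epsilon>
      unfolding vim by (rule sets) simp
    show "emeasure (lebesgue_on {0..1}) (\<psi> -` cball z \<epsilon> \<inter> space (lebesgue_on {0..1})) \<le> ennreal (C * \<epsilon> powr s)"
      if "0 < \<epsilon>" "\<epsilon> \<le> 1" for z \<epsilon>
      using mass[OF that] emeas[of "cball z \<epsilon>"] unfolding vim mass_def by simp
  qed (rule s_pos)
qed

end

section \<open>Conclusion\<close>

text \<open>The sum is \<open>N \<ge> 2\<close> at \<open>s = 0\<close> and less than \<open>1\<close> for large \<open>s\<close>.\<close>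
lemma (in similitude_ifs) exists_similarity_dimension:
  "\<exists>s>0. (\<Sum>j = 1..N. r j powr s) = 1"
proof -
  let ?f = "\<lambda>s. \<Sum>j = 1..N. r j powr s"
  obtain n where n: "q ^ n < 1 / real N" using real_arch_pow_inv[of "1 / real N" q] q_less_1 N by auto
  define t where "t = real n"
  have t: "0 \<le> t" "real N * q powr t < 1"
    using n q_pos N by (auto simp: t_def powr_realpow field_simps)
  have "?f t \<le> (\<Sum>j = 1..N. q powr t)"
    using r_pos r_le_q t(1) by (intro sum_mono powr_mono2) (auto simp: less_imp_le)
  then have ft: "?f t \<le> 1" using t(2) by simp
  have "?f 0 = (\<Sum>j = 1..N. 1)" using r_pos by (intro sum.cong) force+
  then have f0: "?f 0 = real N" by simp
  have "\<exists>s\<ge>0. s \<le> t \<and> ?f s = 1"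
  proof (rule IVT2')
    show "?f t \<le> 1" "1 \<le> ?f 0" "0 \<le> t" using ft f0 N t(1) by auto
    show "continuous_on {0..t} ?f" using r_pos by (intro continuous_intros) force
  qed
  then obtain s where s: "0 \<le> s" "?f s = 1" by blast
  have "s \<noteq> 0" using s(2) f0 N by auto
  then have "0 < s" using s(1) by simp
  then show ?thesis using s(2) by blast
qed

theorem theorem1p3:
  fixes N :: nat and S :: "nat \<Rightarrow> 'a::euclidean_space \<Rightarrow> 'a" and \<beta> :: "nat \<Rightarrow> int"
  assumes "ifs N S"
    and "\<forall>j\<in>{1..N}. \<beta> j \<in> {-1, 1}"
  shows "(self_similar_zipper N S \<beta> \<longleftrightarrow> linear_eqs {1, -1} (zipper_eqs N S \<beta>)) \<and>
    (self_similar_zipper N S \<beta> \<and> open_set_condition N S \<longrightarrow>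
       (\<exists>\<psi>. optimal_parametrization (hausdorff_dim (ifs_invariant_set N S))
               (ifs_invariant_set N S) \<psi>))"
proof (intro conjI impI)
  obtain r where "similitude_ifs N S r" using ifs_imp_similitude_ifs[OF assms(1)] .
  then interpret similitude_ifs N S r .
  interpret signed_ifs N S r \<beta> using assms(2) by unfold_locales auto
  show "self_similar_zipper N S \<beta> \<longleftrightarrow> linear_eqs {1, -1} (zipper_eqs N S \<beta>)"
    by (rule zipper_iff_linear)
  assume asm: "self_similar_zipper N S \<beta> \<and> open_set_condition N S"
  then obtain x where x: "\<And>j. j \<in> {1..N} \<Longrightarrow> \<beta> j = 1 \<Longrightarrow> S j (x 0) = x (j - 1) \<and> S j (x N) = x j"
     "\<And>j. j \<in> {1..N} \<Longrightarrow> \<beta> j = -1 \<Longrightarrow> S j (x 0) = x j \<and> S j (x N) = x (j - 1)"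
    unfolding self_similar_zipper_def by blast
  obtain s where s: "0 < s" "(\<Sum>j = 1..N. r j powr s) = 1" using exists_similarity_dimension by blast
  interpret zipper_curve N S r \<beta> x s
  proof unfold_locales
    fix j assume j: "j \<in> {1..N}"
    show "S j (if \<beta> j = 1 then x 0 else x N) = x (j - 1)" "S j (if \<beta> j = 1 then x N else x 0) = x j"
      using \<beta>[OF j] x[OF j] by auto
  qed (rule s)+
  obtain \<psi> where \<psi>: "bounded (\<psi> ` {0..1})" "\<And>j u. j \<in> {1..N} \<Longrightarrow> u \<in> {0..1} \<Longrightarrow> \<psi> (\<sigma> j u) = S j (\<psi> u)"
    using exists_self_similar_parametrization by blast
  interpret zipper_parametrization N S r \<beta> x s \<psi>
    using \<psi> by unfold_locales
  have pos: "0 < hausdorff_measure s K" using asm by (intro hausdorff_measure_pos) simp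
  have "optimal_parametrization s K \<psi>" by (rule optimal_parametrization[OF pos])
  moreover from this have "hausdorff_dim K = s"
    using pos s(1) unfolding optimal_parametrization_def by (intro hausdorff_dim_eqI) auto
  ultimately show "\<exists>\<psi>. optimal_parametrization (hausdorff_dim (ifs_invariant_set N S)) (ifs_invariant_set N S) \<psi>"
    unfolding K_def by auto
qed

end
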